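(* Let $k\geq 4$ be an integer and let $\mathcal H$ be a $\{2,3\}$-uniform linear hypergraph on $n$ vertices that contains no Berge path of length $k$ as a subhypergraph. Then the number of edges of the $2$-shadow $\partial\mathcal H$ is at most $\frac{k-1}{2}n$.
   Context: A hypergraph $\mathcal H$ is a family of subsets (hyperedges) of a finite vertex set $V(\mathcal H)$. For a set of integers $R$, $\mathcal H$ is $R$-uniform if the size of every hyperedge belongs to $R$; thus a $\{2,3\}$-uniform hypergraph has all hyperedges of size $2$ or $3$. It is linear if any two distinct hyperedges share at most one vertex. The $2$-shadow $\partial\mathcal H$ is the graph on vertex set $V(\mathcal H)$ whose edge set is $\{\{u,v\}: u\neq v,\ \{u,v\}\subseteq h \text{ for some } h\in E(\mathcal H)\}$. A Berge path of length $k$ in $\mathcal H$ is an alternating sequence $v_1,h_1,v_2,h_2,\dots,h_k,v_{k+1}$ of pairwise distinct vertices $v_1,\dots,v_{k+1}$ and pairwise distinct hyperedges $h_1,\dots,h_k$ of $\mathcal H$ such that $\{v_i,v_{i+1}\}\subseteq h_i$ for all $i\in\{1,\dots,k\}$. *)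

theory Defs
  imports Complex_Main
begin

definition hypergraph :: "'a set \<Rightarrow> 'a set set \<Rightarrow> bool" where
  "hypergraph V E \<longleftrightarrow> finite V \<and> (\<forall>h\<in>E. h \<subseteq> V)"

definition uniform_in :: "nat set \<Rightarrow> 'a set set \<Rightarrow> bool" where
  "uniform_in R E \<longleftrightarrow> (\<forall>h\<in>E. card h \<in> R)"

definition linear_hg :: "'a set set \<Rightarrow> bool" where
  "linear_hg E \<longleftrightarrow> (\<forall>h1\<in>E. \<forall>h2\<in>E. h1 \<noteq> h2 \<longrightarrow> card (h1 \<inter> h2) \<le> 1)"

definition shadow2 :: "'a set set \<Rightarrow> 'a set set" where
  "shadow2 E = {{u, v} | u v. u \<noteq> v \<and> (\<exists>h\<in>E. {u, v} \<subseteq> h)}"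

definition berge_path :: "'a set \<Rightarrow> 'a set set \<Rightarrow> 'a list \<Rightarrow> 'a set list \<Rightarrow> bool" where
  "berge_path V E vs hs \<longleftrightarrow>
     length vs = length hs + 1 \<and> distinct vs \<and> distinct hs \<and>
     set vs \<subseteq> V \<and> set hs \<subseteq> E \<and>
     (\<forall>i < length hs. {vs ! i, vs ! (i + 1)} \<subseteq> hs ! i)"

definition has_berge_path :: "'a set \<Rightarrow> 'a set set \<Rightarrow> nat \<Rightarrow> bool" where
  "has_berge_path V E k \<longleftrightarrow> (\<exists>vs hs. berge_path V E vs hs \<and> length hs = k)"

end

theory Submission
  imports Defs
begin

text \<open>
  By linearity every pair of vertices lies in at most one triple, so Berge paths and cycles are the paths and
  cycles of the shadow in which no three consecutive vertices form a triple. In a vertex-minimal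
  counterexample the shadow is connected and every nonempty vertex set \<open>S\<close> meets more than
  \<open>(k - 1) |S| / 2\<close> edges; by induction on \<open>k\<close> it contains a Berge path on \<open>k\<close> vertices.

  There is no Berge cycle on \<open>k\<close>, \<open>k - 1\<close> or \<open>k - 2\<close> vertices: the first would extend to a longer path by
  connectivity, and for the other two the edges between the cycle and its complement are counted, since two
  outside vertices attached at neighbouring positions of the cycle produce a longer path or cycle.

  Hence the neighbourhoods of the two ends of a Berge path on \<open>k\<close> vertices cannot cross. Together with the
  lower bounds on degrees this makes \<open>k\<close> odd and determines both neighbourhoods: each is half of the path and
  one vertex off the path that completes the end edge to a triple. Rotating the path at its first half then
  yields one and the same off-path vertex for different end vertices, a contradiction.
\<close>

text \<open>The obstacle throughout is that an exchange which is free in a graph fails here when a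
  new edge and an adjacent edge of the path lie in one triple. The third pair of that triple is then
  itself an edge and skips one vertex, so a blocked chord can be replaced at the price of one
  vertex. Closing a path by crossing chords uses two of them, so two vertices may be lost; this is
  why cycles on \<open>k - 2\<close> vertices have to be excluded as well. In the counts, the edges
  from outside vertices to a cycle are distributed over the edges of the cycle, each outside vertex
  scoring at both ends. The excess comes only from cycle edges that form a triple with an outside
  vertex, and each of them has just one such vertex. The bound fails for \<open>k = 3\<close>: if
  \<open>t \<ge> 2\<close>, then \<open>t\<close> triples through one vertex contain no walk on 4
  vertices, but have \<open>3 * t\<close> shadow edges on \<open>2 * t + 1\<close> vertices. The
  induction therefore rests on a separate statement, walks on at most 3 vertices with the weaker
  density \<open>K = 3\<close>.\<close>

lemma periodic_mult:
  fixes c :: "int \<Rightarrow> 'a"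
  assumes "\<And>i. c (i + m) = c i"
  shows "c (i + m * t) = c i"
proof -
  have *: "c (i + m * int n) = c i" for n i
  proof (induction n)
    case (Suc n)
    then show ?case using assms[of "i + m * int n"] by (simp add: algebra_simps)
  qed simp
  show ?thesis
  proof (cases "t \<ge> 0")
    case True
    then show ?thesis using *[of i "nat t"] by simp
  next
    case False
    then show ?thesis using *[of "i + m * t" "nat (-t)"] by (simp add: algebra_simps)
  qed
qed

subsection \<open>Shadow graphs with triples, walks and cycles\<close>

locale tgraph =
  fixes adj :: "'a \<Rightarrow> 'a \<Rightarrow> bool" and tri :: "'a \<Rightarrow> 'a \<Rightarrow> 'a \<Rightarrow> bool"
  assumes adj_sym: "adj x y \<Longrightarrow> adj y x"
    and adj_irrefl: "\<not> adj x x"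
    and tri_12: "tri x y z = tri y x z"
    and tri_23: "tri x y z = tri x z y"
    and tri_adj: "tri x y z \<Longrightarrow> adj x y"
    and tri_unique: "tri x y z \<Longrightarrow> tri x y z' \<Longrightarrow> z = z'"
begin

lemmas tri_ac = tri_12 tri_23

lemma adj_commute: "adj x y = adj y x"
  using adj_sym by blast

lemma tri_adjs:
  assumes "tri x y z"
  shows "adj x y" "adj y x" "adj x z" "adj z x" "adj y z" "adj z y"
  using assms tri_adj tri_12 tri_23 by metis+

lemma tri_neq:
  assumes "tri x y z"
  shows "x \<noteq> y" "x \<noteq> z" "y \<noteq> z"
  using tri_adjs[OF assms] adj_irrefl by auto

lemma tri_unique1: "tri x y z \<Longrightarrow> tri x' y z \<Longrightarrow> x = x'"
  using tri_unique[of y z x x'] tri_12 tri_23 by metis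

lemma tri_unique2: "tri x y z \<Longrightarrow> tri x y' z \<Longrightarrow> y = y'"
  using tri_unique[of x z y y'] tri_23 by metis

lemma triD: "tri x y z \<Longrightarrow> tri y x z" "tri x y z \<Longrightarrow> tri x z y" "tri x y z \<Longrightarrow> tri y z x" "tri x y z \<Longrightarrow> tri z x y" "tri x y z \<Longrightarrow> tri z y x"
  using tri_12 tri_23 by metis+

text \<open>As sets, two triples with two common vertices coincide; the parts are the choices of the
  shared pair. Most hypothetical triples below are refuted this way.\<close>

lemma tri_share:
  assumes "tri x y z" "tri u v w"
  defines "S \<equiv> {u, v, w}"
  shows "x \<in> S \<Longrightarrow> y \<in> S \<Longrightarrow> z \<in> S" "x \<in> S \<Longrightarrow> z \<in> S \<Longrightarrow> y \<in> S" "y \<in> S \<Longrightarrow> z \<in> S \<Longrightarrow> x \<in> S"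
proof -
  have *: "z \<in> S" if t: "tri x y z" and x: "x \<in> S" and y: "y \<in> S" for x y z
  proof -
    have "x \<noteq> y" using tri_neq[OF t] by simp
    then obtain w' where w': "tri x y w'" "w' \<in> S"
      using x y triD[OF assms(2)] assms(2) unfolding S_def by blast
    then show ?thesis using tri_unique[OF t w'(1)] by simp
  qed
  show "x \<in> S \<Longrightarrow> y \<in> S \<Longrightarrow> z \<in> S" "x \<in> S \<Longrightarrow> z \<in> S \<Longrightarrow> y \<in> S" "y \<in> S \<Longrightarrow> z \<in> S \<Longrightarrow> x \<in> S"
    using *[OF assms(1)] *[OF triD(2)[OF assms(1)]] *[OF triD(3)[OF assms(1)]] by blast+
qed

text \<open>
  Since a pair lies in at most one triple, three consecutive vertices of a path force a repeated hyperedge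
  exactly when they form a triple; so distinct walks are the vertex sequences of Berge paths.
\<close>

fun walk :: "'a list \<Rightarrow> bool" where
  "walk [] = True"
| "walk [x] = True"
| "walk [x, y] = adj x y"
| "walk (x # y # z # xs) = (adj x y \<and> \<not> tri x y z \<and> walk (y # z # xs))"

lemma walk_Cons:
  "ys \<noteq> [] \<Longrightarrow> walk (x # ys) \<longleftrightarrow> adj x (hd ys) \<and> (tl ys \<noteq> [] \<longrightarrow> \<not> tri x (hd ys) (hd (tl ys))) \<and> walk ys"
  by (cases "(x, ys)" rule: prod.exhaust, cases ys rule: walk.cases) auto

lemma walk_append:
  "xs \<noteq> [] \<Longrightarrow> ys \<noteq> [] \<Longrightarrow> walk (xs @ ys) \<longleftrightarrow> walk xs \<and> walk ys \<and> adj (last xs) (hd ys)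
     \<and> (tl xs \<noteq> [] \<longrightarrow> \<not> tri (last (butlast xs)) (last xs) (hd ys))
     \<and> (tl ys \<noteq> [] \<longrightarrow> \<not> tri (last xs) (hd ys) (hd (tl ys)))"
proof (induction xs rule: walk.induct)
  case (3 x y)
  then show ?case by (auto simp: walk_Cons)
next
  case (4 x y z xs)
  then show ?case by (auto simp: walk_Cons)
qed (auto simp: walk_Cons)

lemma walk_rev: "walk (rev xs) = walk xs"
proof (induction xs rule: walk.induct)
  case (3 x y)
  then show ?case by (auto simp: adj_commute)
next
  case (4 x y z xs)
  have "walk (rev (x # y # z # xs)) = walk (rev (y # z # xs) @ [x])" by simp
  also have "\<dots> = (walk (y # z # xs) \<and> adj y x \<and> \<not> tri z y x)"
    by (subst walk_append) (use 4 in \<open>auto simp: butlast_append tl_append split: list.splits\<close>)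
  finally show ?case using tri_ac by (auto simp: adj_commute tri_ac)
qed auto

lemma walk_nth:
  "walk xs \<longleftrightarrow> (\<forall>i. Suc i < length xs \<longrightarrow> adj (xs ! i) (xs ! Suc i))
     \<and> (\<forall>i. Suc (Suc i) < length xs \<longrightarrow> \<not> tri (xs ! i) (xs ! Suc i) (xs ! Suc (Suc i)))"
proof (induction xs rule: walk.induct)
  case (3 x y)
  then show ?case by (auto simp: less_Suc_eq)
next
  case (4 x y z xs)
  show ?case (is "?L = (?R1 \<and> ?R2)")
  proof -
    have a: "?R1 \<longleftrightarrow> adj x y \<and> (\<forall>i. Suc i < length (y # z # xs) \<longrightarrow> adj ((y # z # xs) ! i) ((y # z # xs) ! Suc i))"
      by (rule iffI, force, clarify, rename_tac i, case_tac i) auto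
    have b: "?R2 \<longleftrightarrow> \<not> tri x y z \<and> (\<forall>i. Suc (Suc i) < length (y # z # xs) \<longrightarrow> \<not> tri ((y # z # xs) ! i) ((y # z # xs) ! Suc i) ((y # z # xs) ! Suc (Suc i)))"
      by (rule iffI, force, clarify, rename_tac i, case_tac i) auto
    show ?thesis using 4 a b by auto
  qed
qed auto

text \<open>Periodic functions on the integers make shifts, reflections and windows with any
  starting point plain reparametrisations, without reducing indices. The conditions over all
  \<open>i\<close> include the closing edge.\<close>

definition cyc :: "int \<Rightarrow> (int \<Rightarrow> 'a) \<Rightarrow> bool" where
  "cyc m c \<longleftrightarrow> 3 \<le> m \<and> (\<forall>i. c (i + m) = c i) \<and> inj_on c {0..<m}
     \<and> (\<forall>i. adj (c i) (c (i + 1))) \<and> (\<forall>i. \<not> tri (c i) (c (i + 1)) (c (i + 2)))"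

lemma hd_map_upto [simp]: "i \<le> j \<Longrightarrow> hd (map c [i..j]) = c i"
  by (simp add: upto.simps)
lemma last_map_upto [simp]: "i \<le> j \<Longrightarrow> last (map c [i..j]) = c j"
  by (simp add: upto_rec2)
lemma tl_map_upto [simp]: "tl (map c [i..j]) = map c [i+1..j]"
  by (cases "i \<le> j") (simp_all add: upto.simps)
lemma butlast_map_upto [simp]: "butlast (map c [i..j]) = map c [i..j-1]"
  by (cases "i \<le> j") (simp_all add: upto_rec2)

lemma tl_rev: "tl (rev xs) = rev (butlast xs)"
  by (metis butlast_rev rev_rev_ident)

lemmas walk_simps = walk_append walk_Cons walk_rev hd_rev last_rev tl_rev butlast_rev butlast_append

lemma walk_map_upto:
  assumes "\<And>l. i \<le> l \<Longrightarrow> l < j \<Longrightarrow> adj (c l) (c (l+1))"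
    and "\<And>l. i \<le> l \<Longrightarrow> l + 1 < j \<Longrightarrow> \<not> tri (c l) (c (l+1)) (c (l+2))"
  shows "walk (map c [i..j])"
proof -
  { fix n assume n: "Suc n < nat (j - i + 1)"
    have "i + int (Suc n) = i + int n + 1" by simp
    then have "adj (c (i + int n)) (c (i + int (Suc n)))"
      using n assms(1)[of "i + int n"] by (auto simp: algebra_simps) }
  moreover
  { fix n assume n: "Suc (Suc n) < nat (j - i + 1)"
    have e: "i + int (Suc n) = i + int n + 1" "i + int (Suc (Suc n)) = i + int n + 2" by simp_all
    have "\<not> tri (c (i + int n)) (c (i + int (Suc n))) (c (i + int (Suc (Suc n))))"
      unfolding e using n assms(2)[of "i + int n"] by auto }
  ultimately show ?thesis
    unfolding walk_nth by (auto simp: nth_upto)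
qed

lemma cyc_ge3: "cyc m c \<Longrightarrow> 3 \<le> m"
  unfolding cyc_def by auto

lemma cycD:
  assumes "cyc m c"
  shows "c (i + m) = c i" "adj (c i) (c (i + 1))" "\<not> tri (c i) (c (i + 1)) (c (i + 2))"
  using assms unfolding cyc_def by auto

lemma cyc_mod:
  assumes "cyc m c" shows "c (i mod m) = c i"
proof -
  have "c (i mod m + m * (i div m)) = c (i mod m)"
    by (rule periodic_mult) (use assms cycD in blast)
  then show ?thesis by simp
qed

lemma cyc_eq_iff:
  assumes "cyc m c" shows "c i = c j \<longleftrightarrow> i mod m = j mod m"
proof
  assume "c i = c j"
  then have "c (i mod m) = c (j mod m)" using cyc_mod[OF assms] by simp
  moreover have "i mod m \<in> {0..<m}" "j mod m \<in> {0..<m}" using cyc_ge3[OF assms] by auto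
  ultimately show "i mod m = j mod m" using assms unfolding cyc_def inj_on_def by blast
next
  assume "i mod m = j mod m"
  then show "c i = c j" using cyc_mod[OF assms] by metis
qed

lemma cyc_neq:
  assumes "cyc m c" "i < j" "j < i + m" shows "c i \<noteq> c j"
proof
  assume "c i = c j"
  then have "i mod m = j mod m" using cyc_eq_iff[OF assms(1)] by simp
  then have "m dvd (j - i)" by (metis mod_eq_dvd_iff)
  then show False using assms(2,3) zdvd_imp_le[of m "j - i"] by linarith
qed

lemma cyc_inj_on:
  assumes "cyc m c" "b < a + m" shows "inj_on c {a..b}"
  unfolding inj_on_def
proof (intro ballI impI)
  fix x y assume "x \<in> {a..b}" "y \<in> {a..b}" "c x = c y"
  then show "x = y" using cyc_neq[OF assms(1), of x y] cyc_neq[OF assms(1), of y x] assms(2)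
    by (cases x y rule: linorder_cases) auto
qed

lemma cyc_distinct_map:
  assumes "cyc m c" "distinct L" "set L \<subseteq> {a..b}" "b < a + m"
  shows "distinct (map c L)"
  unfolding distinct_map using assms(2) inj_on_subset[OF cyc_inj_on[OF assms(1,4)] assms(3)] ..

lemma cyc_range:
  assumes "cyc m c" "b + 1 = a + m" shows "c ` {a..b} = range c"
proof -
  have "c x \<in> c ` {a..b}" for x
  proof
    have m: "m > 0" using cyc_ge3[OF assms(1)] by simp
    show "c x = c (a + (x - a) mod m)"
      using cyc_eq_iff[OF assms(1)] by (simp add: mod_simps)
    show "a + (x - a) mod m \<in> {a..b}" using assms(2) m pos_mod_bound[OF m, of "x-a"] pos_mod_sign[OF m, of "x-a"] unfolding atLeastAtMost_iff by linarith
  qed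
  then show ?thesis by auto
qed

lemma cyc_card: assumes "cyc m c" shows "finite (range c)" "int (card (range c)) = m"
proof -
  have e: "range c = c ` {0..m-1}" using cyc_range[OF assms, of "m-1" 0] by simp
  show "finite (range c)" unfolding e by simp
  have "card (c ` {0..m-1}) = card {0..m-1}"
    by (rule card_image, rule cyc_inj_on[OF assms]) simp
  then show "int (card (range c)) = m" using e cyc_ge3[OF assms] by simp
qed

lemma cyc_shift: assumes "cyc m c" shows "cyc m (\<lambda>i. c (i + t))"
proof -
  have "inj_on (\<lambda>i. c (i + t)) {0..<m}"
    unfolding inj_on_def
  proof (intro ballI impI)
    fix x y assume "x \<in> {0..<m}" "y \<in> {0..<m}" "c (x + t) = c (y + t)"
    then show "x = y" using cyc_neq[OF assms, of "x+t" "y+t"] cyc_neq[OF assms, of "y+t" "x+t"]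
      by (cases x y rule: linorder_cases) auto
  qed
  moreover have "c (i + m + t) = c (i + t)" "adj (c (i + t)) (c (i + 1 + t))"
     "\<not> tri (c (i + t)) (c (i + 1 + t)) (c (i + 2 + t))" for i
    using cycD[OF assms, of "i + t"] by (simp_all add: algebra_simps)
  ultimately show ?thesis using cyc_ge3[OF assms] unfolding cyc_def by auto
qed

lemma cyc_uminus: assumes "cyc m c" shows "cyc m (\<lambda>i. c (- i))"
proof -
  have "inj_on (\<lambda>i. c (- i)) {0..<m}"
    unfolding inj_on_def
  proof (intro ballI impI)
    fix x y assume "x \<in> {0..<m}" "y \<in> {0..<m}" "c (- x) = c (- y)"
    then show "x = y" using cyc_neq[OF assms, of "-x" "-y"] cyc_neq[OF assms, of "-y" "-x"]
      by (cases x y rule: linorder_cases) auto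
  qed
  moreover have "c (- (i + m)) = c (- i)" for i
    using cycD(1)[OF assms, of "-i-m"] by simp
  moreover have "adj (c (- i)) (c (- (i + 1)))" for i
    using cycD(2)[OF assms, of "-(i+1)"] by (simp add: adj_commute)
  moreover have "\<not> tri (c (- i)) (c (- (i + 1))) (c (- (i + 2)))" for i
  proof -
    have "- (i + 2) + 1 = - (i + 1)" "- (i + 2) + 2 = - i" by simp_all
    then show ?thesis using cycD(3)[OF assms, of "-(i+2)"] tri_ac by metis
  qed
  ultimately show ?thesis using cyc_ge3[OF assms] unfolding cyc_def by auto
qed

lemma range_shift: "range (\<lambda>i::int. c (i + t)) = range c"
  by (metis (no_types) add.commute diff_add_cancel image_cong image_image surj_def surjI)
lemma range_uminus: "range (\<lambda>i::int. c (- i)) = range c"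
  by (auto simp: image_iff) (metis minus_minus)

lemma cyc_walk: assumes "cyc m c" shows "walk (map c [i..j])"
  by (rule walk_map_upto) (use cycD[OF assms] in auto)

text \<open>Doubling the list turns the conditions on the closing edge and on the two triples across
  it into ordinary conditions on a walk.\<close>

lemma cyc_of_list:
  assumes d: "distinct xs" and l: "3 \<le> length xs" and w: "walk (xs @ xs)"
  shows "\<exists>c. cyc (int (length xs)) c \<and> range c = set xs"
proof -
  define n where "n = length xs"
  define c where "c i = xs ! nat (i mod int n)" for i
  have n: "n \<ge> 3" using l n_def by simp
  have aux: "c i = (xs @ xs) ! nat (i mod int n)" "c (i+1) = (xs @ xs) ! Suc (nat (i mod int n))"
     "c (i+2) = (xs @ xs) ! Suc (Suc (nat (i mod int n)))" for i
  proof -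
    define r where "r = nat (i mod int n)"
    have r: "r < n" "i mod int n = int r" unfolding r_def using n
      by (auto simp: nat_less_iff)
    have s: "(i + 1) mod int n = (int r + 1) mod int n" "(i + 2) mod int n = (int r + 2) mod int n"
      unfolding r(2)[symmetric] by (simp_all add: mod_simps)
    show "c i = (xs @ xs) ! nat (i mod int n)" using r by (simp add: c_def nth_append n_def)
    show "c (i+1) = (xs @ xs) ! Suc (nat (i mod int n))"
    proof (cases "Suc r < n")
      case True
      then show ?thesis using r s by (simp add: c_def nth_append n_def nat_add_distrib)
    next
      case False
      then have e: "Suc r = n" using r by simp
      then have "(int r + 1) mod int n = 0" by (metis of_nat_Suc add.commute mod_self)
      then show ?thesis using r s e by (simp add: c_def nth_append n_def)
    qed
    show "c (i+2) = (xs @ xs) ! Suc (Suc (nat (i mod int n)))"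
    proof (cases "Suc (Suc r) < n")
      case True
      then show ?thesis using r s by (simp add: c_def nth_append n_def nat_add_distrib)
    next
      case False
      have "(int r + 2) mod int n = (int r + 2 - int n) mod int n" by (metis minus_mod_self2)
      also have "\<dots> = int r + 2 - int n" using False r n by (intro mod_pos_pos_trivial) auto
      finally have "nat ((i+2) mod int n) = Suc (Suc r) - n" using s by linarith
      then show ?thesis using r False by (simp add: c_def nth_append n_def)
    qed
  qed
  have rn: "nat (i mod int n) < n" for i using n by (auto simp: nat_less_iff)
  have a: "adj (c i) (c (i+1))" "\<not> tri (c i) (c (i+1)) (c (i+2))" for i
    unfolding aux(2,3)[of i] aux(1)[of i] using w rn[of i] n unfolding walk_nth by (auto simp: n_def)
  have inj: "inj_on c {0..<int n}"
    unfolding inj_on_def c_def using d by (auto simp: nth_eq_iff_index_eq n_def)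
  have "range c = set xs"
  proof
    show "range c \<subseteq> set xs" using rn by (auto simp: c_def n_def)
    show "set xs \<subseteq> range c"
    proof
      fix x assume "x \<in> set xs"
      then obtain i where "i < n" "x = xs ! i" by (metis in_set_conv_nth n_def)
      then have "c (int i) = x" by (simp add: c_def)
      then show "x \<in> range c" by blast
    qed
  qed
  moreover have "cyc (int n) c" unfolding cyc_def using n a inj by (simp add: c_def)
  ultimately show ?thesis by (auto simp: n_def)
qed

end

subsection \<open>Minimal counterexamples\<close>

lemma sum_card_swap:
  assumes "finite A" "finite B"
  shows "(\<Sum>x\<in>A. card {y\<in>B. R x y}) = (\<Sum>y\<in>B. card {x\<in>A. R x y})"
proof -
  have "(\<Sum>x\<in>A. card {y\<in>B. R x y}) = (\<Sum>x\<in>A. \<Sum>y\<in>B. of_bool (R x y))"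
    using assms by (simp add: Collect_conj_eq Int_commute)
  also have "\<dots> = (\<Sum>y\<in>B. \<Sum>x\<in>A. of_bool (R x y))" by (rule sum.swap)
  also have "\<dots> = (\<Sum>y\<in>B. card {x\<in>A. R x y})"
    using assms by (simp add: Collect_conj_eq Int_commute)
  finally show ?thesis .
qed

context tgraph
begin

definition nb :: "'a set \<Rightarrow> 'a \<Rightarrow> 'a set" where
  "nb W u = {v \<in> W. adj u v}"

text \<open>Ordered adjacent pairs, that is twice the number of edges, so that the bound stays free
  of fractions.\<close>

definition E2 :: "'a set \<Rightarrow> nat" where
  "E2 W = (\<Sum>u\<in>W. card (nb W u))"

lemma nb_finite [simp]: "finite W \<Longrightarrow> finite (nb W u)"
  by (simp add: nb_def)

lemma nb_Un_card:
  assumes "finite A" "finite B" "A \<inter> B = {}"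
  shows "card (nb (A \<union> B) u) = card (nb A u) + card (nb B u)"
proof -
  have "nb (A \<union> B) u = nb A u \<union> nb B u" "nb A u \<inter> nb B u = {}"
    using assms by (auto simp: nb_def)
  then show ?thesis using assms by (simp add: card_Un_disjoint)
qed

lemma nb_swap_sum:
  assumes "finite A" "finite B"
  shows "(\<Sum>u\<in>A. card (nb B u)) = (\<Sum>u\<in>B. card (nb A u))"
proof -
  have "(\<Sum>u\<in>A. card (nb B u)) = (\<Sum>u\<in>B. card {v\<in>A. adj v u})"
    unfolding nb_def by (rule sum_card_swap[OF assms])
  then show ?thesis by (simp add: nb_def adj_commute)
qed

lemma E2_Un:
  assumes "finite A" "finite B" "A \<inter> B = {}"
  shows "E2 (A \<union> B) = E2 A + E2 B + 2 * (\<Sum>u\<in>B. card (nb A u))"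
proof -
  have "E2 (A \<union> B) = (\<Sum>u\<in>A. card (nb A u) + card (nb B u)) + (\<Sum>u\<in>B. card (nb A u) + card (nb B u))"
    unfolding E2_def using assms by (simp add: sum.union_disjoint nb_Un_card)
  then show ?thesis
    using nb_swap_sum[of A B] assms by (simp add: sum.distrib E2_def)
qed

lemma nb_card_less: "finite W \<Longrightarrow> u \<in> W \<Longrightarrow> card (nb W u) \<le> card W - 1"
proof -
  assume a: "finite W" "u \<in> W"
  have "nb W u \<subseteq> W - {u}" using adj_irrefl by (auto simp: nb_def)
  then show ?thesis using card_mono[of "W - {u}" "nb W u"] a by simp
qed

lemma E2_le: "finite W \<Longrightarrow> E2 W \<le> card W * (card W - 1)"
  unfolding E2_def using sum_bounded_above[of W "\<lambda>u. card (nb W u)" "card W - 1"] nb_card_less by simp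

end

text \<open>The bound \<open>l\<close> on walks and the density \<open>K\<close> are independent,
  because the main part has \<open>l = k\<close> and \<open>K = k - 1\<close>, but the base of the
  induction has \<open>l = 3\<close> and \<open>K = 3\<close>.\<close>

locale mincex = tgraph +
  fixes V :: "'a set" and l K :: nat
  assumes finV: "finite V"
    and path_bound: "walk xs \<Longrightarrow> distinct xs \<Longrightarrow> set xs \<subseteq> V \<Longrightarrow> length xs \<le> l"
    and big: "K * card V < E2 V"
    and sub: "W \<subset> V \<Longrightarrow> E2 W \<le> K * card W"
begin

abbreviation deg :: "'a \<Rightarrow> nat" where "deg u \<equiv> card (nb V u)"

text \<open>Removing \<open>S\<close> leaves a set within the bound, so the edges meeting
  \<open>S\<close> account for more than \<open>K * card S\<close> in \<open>E2\<close>. The degree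
  sum counts these edges, those inside \<open>S\<close> twice, whence the term
  \<open>E2 S\<close>.\<close>

lemma deg_sum_gt:
  assumes "S \<subseteq> V" "S \<noteq> {}"
  shows "K * card S + E2 S < 2 * (\<Sum>u\<in>S. deg u)"
proof -
  define W where "W = V - S"
  have fS: "finite S" "finite W" "S \<inter> W = {}" "W \<inter> S = {}" using assms finV finite_subset W_def by auto
  have V: "V = W \<union> S" using assms W_def by auto
  have W: "W \<subset> V" using assms W_def by auto
  have "card V = card W + card S" unfolding V using fS by (simp add: card_Un_disjoint)
  moreover have "E2 V = E2 W + E2 S + 2 * (\<Sum>u\<in>S. card (nb W u))" unfolding V using E2_Un fS by simp
  moreover have "(\<Sum>u\<in>S. deg u) = (\<Sum>u\<in>S. card (nb W u)) + E2 S"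
    unfolding V using fS by (simp add: nb_Un_card sum.distrib E2_def)
  moreover have "E2 W \<le> K * card W" by (rule sub[OF W])
  ultimately show ?thesis using big by (simp add: distrib_left)
qed

lemma deg_gt: "u \<in> V \<Longrightarrow> K < 2 * deg u"
  using deg_sum_gt[of "{u}"] by auto

lemma E2_pair: "u \<noteq> v \<Longrightarrow> E2 {u, v} = (if adj u v then 2 else 0)"
proof -
  assume "u \<noteq> v"
  have "nb {u,v} u = (if adj u v then {v} else {})" "nb {u,v} v = (if adj u v then {u} else {})"
    using adj_irrefl by (auto simp: nb_def adj_commute)
  then show ?thesis using \<open>u \<noteq> v\<close> by (simp add: E2_def)
qed

lemma E2_triangle: "adj u v \<Longrightarrow> adj u w \<Longrightarrow> adj v w \<Longrightarrow> E2 {u, v, w} = 6"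
proof -
  assume a: "adj u v" "adj u w" "adj v w"
  have ne: "u \<noteq> v" "u \<noteq> w" "v \<noteq> w" using a adj_irrefl by auto
  have "nb {u,v,w} u = {v,w}" "nb {u,v,w} v = {u,w}" "nb {u,v,w} w = {u,v}"
    using a adj_irrefl adj_sym by (auto simp: nb_def)
  then show ?thesis using ne by (simp add: E2_def)
qed

lemma deg_pair_gt:
  assumes "u \<in> V" "v \<in> V" "u \<noteq> v"
  shows "2 * K + (if adj u v then 2 else 0) < 2 * (deg u + deg v)"
  using deg_sum_gt[of "{u, v}"] assms E2_pair[OF assms(3)] by (auto simp: mult.commute)

lemma deg_triangle_gt:
  assumes "u \<in> V" "v \<in> V" "w \<in> V" "adj u v" "adj u w" "adj v w"
  shows "3 * K + 6 < 2 * (deg u + deg v + deg w)"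
proof -
  have ne: "u \<noteq> v" "u \<noteq> w" "v \<noteq> w" using assms adj_irrefl by auto
  show ?thesis using deg_sum_gt[of "{u, v, w}"] assms E2_triangle[OF assms(4-6)] ne by (auto simp: mult.commute)
qed

lemma connected:
  assumes "S \<subset> V" "S \<noteq> {}"
  shows "\<exists>u\<in>S. \<exists>v\<in>V - S. adj u v"
proof (rule ccontr)
  assume n: "\<not> ?thesis"
  have "nb V u = nb S u" if "u \<in> S" for u using n that assms by (auto simp: nb_def)
  then have "(\<Sum>u\<in>S. deg u) = E2 S" by (simp add: E2_def)
  then show False using deg_sum_gt[of S] sub[OF assms(1)] assms by auto
qed

lemma card_V: "K + 2 \<le> card V"
proof (rule ccontr)
  assume "\<not> ?thesis"
  then have "card V - 1 \<le> K" by simp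
  then have "card V * (card V - 1) \<le> card V * K" by (rule mult_le_mono2)
  then show False using big E2_le[OF finV] mult.commute[of K "card V"] by linarith
qed

text \<open>The walk \<open>zs\<close> enters the cycle at \<open>c j\<close> and runs around it
  completely. At most one of the two directions is blocked, because the edge from
  \<open>last zs\<close> to \<open>c j\<close> lies in at most one triple.\<close>

lemma attach_to_cyc:
  assumes c: "cyc m c" and r: "range c \<subseteq> V"
    and zs: "zs \<noteq> []" "walk zs" "distinct zs" "set zs \<subseteq> V - range c"
    and a: "adj (last zs) (c j)" and t: "tl zs \<noteq> [] \<Longrightarrow> \<not> tri (last (butlast zs)) (last zs) (c j)"
  shows "int (length zs) + m \<le> int l"
proof -
  have m3: "3 \<le> m" using cyc_ge3[OF c] .
  have path: ?thesis if c': "cyc m c'" "range c' = range c" "c' 0 = c j" "\<not> tri (last zs) (c' 0) (c' 1)" for c'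
  proof -
    let ?p = "zs @ map c' [0..m - 1]"
    have "walk ?p" using that m3 cyc_walk[OF c'(1)] zs a t by (subst walk_append) auto
    moreover have "distinct ?p" using zs(3,4) c'(2) cyc_inj_on[OF c'(1), of "m - 1" 0]
      by (auto simp: distinct_map)
    moreover have "c' x \<in> V" for x using c'(2) r by blast
    then have "set ?p \<subseteq> V" using zs by auto
    ultimately have "length ?p \<le> l" by (intro path_bound)
    then show ?thesis using m3 by simp
  qed
  show ?thesis
  proof (cases "tri (last zs) (c j) (c (j+1))")
    case False
    then show ?thesis using path[OF cyc_shift[OF c, of j]] range_shift[of c j] by (simp add: add.commute)
  next
    case True
    have "\<not> tri (last zs) (c j) (c (j - 1))"
    proof
      assume "tri (last zs) (c j) (c (j - 1))"
      then have "c (j - 1) = c (j + 1)" using True tri_unique by blast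
      then show False using cyc_neq[OF c, of "j-1" "j+1"] m3 by auto
    qed
    then show ?thesis using path[of "\<lambda>i. c (- i + j)"] cyc_uminus[OF cyc_shift[OF c]]
        range_shift[of c j] range_uminus[of "\<lambda>i. c (i + j)"]
      by auto
  qed
qed

lemma no_cyc_l:
  assumes c: "cyc (int l) c" and r: "range c \<subseteq> V" and V: "l < card V"
  shows False
proof -
  have "card (range c) = l" using cyc_card(2)[OF c] by simp
  then have "range c \<subset> V" using r V by auto
  then obtain u v where uv: "u \<in> range c" "v \<in> V" "v \<notin> range c" "adj u v"
    using connected[of "range c"] by blast
  then obtain j where "u = c j" by auto
  then show False using attach_to_cyc[OF c r, of "[v]" j] uv by (auto simp: adj_commute)
qed

end

subsection \<open>Attaching a vertex to a cycle\<close>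

lemma card_periodic_shift:
  fixes P :: "int \<Rightarrow> bool"
  assumes p: "\<And>i. P (i + m) = P i" and m: "0 < m"
  shows "card {i\<in>{0..<m}. P (i + t)} = card {i\<in>{0..<m}. P i}"
proof (rule bij_betw_same_card)
  have pm: "P (i mod m) = P i" for i
    using periodic_mult[of P m "i mod m" "i div m", OF p] by simp
  show "bij_betw (\<lambda>i. (i + t) mod m) {i \<in> {0..<m}. P (i + t)} {i \<in> {0..<m}. P i}"
  proof (rule bij_betw_byWitness[where f' = "\<lambda>i. (i - t) mod m"])
    show "\<forall>a\<in>{i \<in> {0..<m}. P (i + t)}. ((a + t) mod m - t) mod m = a" by (auto simp: mod_simps)
    show "\<forall>a'\<in>{i \<in> {0..<m}. P i}. ((a' - t) mod m + t) mod m = a'" by (auto simp: mod_simps)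
    show "(\<lambda>i. (i + t) mod m) ` {i \<in> {0..<m}. P (i + t)} \<subseteq> {i \<in> {0..<m}. P i}"
      using pm m by auto
    show "(\<lambda>i. (i - t) mod m) ` {i \<in> {0..<m}. P i} \<subseteq> {i \<in> {0..<m}. P (i + t)}"
    proof clarify
      fix i assume i: "i \<in> {0..<m}" "P i"
      have "P (((i - t) mod m + t) mod m)" using i by (simp add: mod_simps)
      then show "(i - t) mod m \<in> {0..<m} \<and> P ((i - t) mod m + t)" using pm m by simp
    qed
  qed
qed

lemma card_periodic_interval:
  fixes P :: "int \<Rightarrow> bool"
  assumes p: "\<And>i. P (i + m) = P i" and m: "0 < m"
  shows "card {i\<in>{t..<t+m}. P i} = card {i\<in>{0..<m}. P i}"
proof -
  have "{i\<in>{t..<t+m}. P i} = (\<lambda>i. i + t) ` {i\<in>{0..<m}. P (i + t)}"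
    by (auto simp: image_iff) (metis add.commute add_diff_cancel_left' diff_add_cancel diff_ge_0_iff_ge diff_less_eq)
  then have "card {i\<in>{t..<t+m}. P i} = card {i\<in>{0..<m}. P (i + t)}"
    by (simp add: card_image)
  then show ?thesis using card_periodic_shift[of P, OF p m] by simp
qed

lemma finite_int_interval_Collect [simp]:
  "finite {i::int. a \<le> i \<and> i < b \<and> P i}" "finite {i::int. a \<le> i \<and> i \<le> b \<and> P i}"
  by (rule finite_subset[of _ "{a..b}"]; auto)+

lemma card_periodic_uminus:
  fixes P :: "int \<Rightarrow> bool"
  assumes p: "\<And>i. P (i + m) = P i" and m: "0 < m"
  shows "card {i\<in>{0..<m}. P (- i)} = card {i\<in>{0..<m}. P i}"
proof -
  have "{i\<in>{0..<m}. P (- i)} = uminus ` {i\<in>{1-m..<1-m+m}. P i}"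
  proof (intro equalityI subsetI)
    fix x assume "x \<in> {i\<in>{0..<m}. P (- i)}"
    then have "x = - (- x)" "- x \<in> {i\<in>{1-m..<1-m+m}. P i}" by auto
    then show "x \<in> uminus ` {i\<in>{1-m..<1-m+m}. P i}" by (rule image_eqI)
  qed auto
  then have "card {i\<in>{0..<m}. P (- i)} = card {i\<in>{1-m..<1-m+m}. P i}" by (simp add: card_image)
  then show ?thesis using card_periodic_interval[of P m "1-m", OF p m] by simp
qed

context tgraph
begin

text \<open>
  A vertex \<open>y\<close> off a cycle \<open>c\<close> can enter \<open>c\<close> at position \<open>i\<close> and go on forwards iff \<open>fr c y i\<close>,
  and go on backwards iff \<open>bk c y i\<close>; \<open>blk c y i\<close> means that \<open>y\<close> completes the \<open>i\<close>-th edge to a triple.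
\<close>

definition fr :: "(int \<Rightarrow> 'a) \<Rightarrow> 'a \<Rightarrow> int \<Rightarrow> bool" where
  "fr c y i \<longleftrightarrow> adj y (c i) \<and> \<not> tri y (c i) (c (i + 1))"
definition bk :: "(int \<Rightarrow> 'a) \<Rightarrow> 'a \<Rightarrow> int \<Rightarrow> bool" where
  "bk c y i \<longleftrightarrow> adj y (c i) \<and> \<not> tri y (c i) (c (i - 1))"
definition blk :: "(int \<Rightarrow> 'a) \<Rightarrow> 'a \<Rightarrow> int \<Rightarrow> bool" where
  "blk c y i \<longleftrightarrow> tri y (c i) (c (i + 1))"

lemma cyc_periodic:
  assumes "cyc m c"
  shows "fr c y (i + m) = fr c y i" "bk c y (i + m) = bk c y i" "blk c y (i + m) = blk c y i"
proof -
  have "c (i + m + 1) = c (i + 1)" "c (i + m - 1) = c (i - 1)"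
    using cycD(1)[OF assms, of "i+1"] cycD(1)[OF assms, of "i-1"] by (simp_all add: algebra_simps)
  then show "fr c y (i + m) = fr c y i" "bk c y (i + m) = bk c y i" "blk c y (i + m) = blk c y i"
    using cycD(1)[OF assms, of i] by (simp_all add: fr_def bk_def blk_def)
qed

lemma bk_shift: "bk (\<lambda>i. c (i + t)) y i = bk c y (i + t)"
  and blk_shift: "blk (\<lambda>i. c (i + t)) y i = blk c y (i + t)"
  by (simp_all add: bk_def blk_def algebra_simps)

lemma fr_uminus: "fr (\<lambda>i. c (- i)) y i = bk c y (- i)"
  and bk_uminus: "bk (\<lambda>i. c (- i)) y i = fr c y (- i)"
proof -
  have "- (i + 1) = - i - 1" "- (i - 1) = - i + 1" by simp_all
  then show "fr (\<lambda>i. c (- i)) y i = bk c y (- i)" "bk (\<lambda>i. c (- i)) y i = fr c y (- i)"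
    unfolding fr_def bk_def by simp_all
qed

text \<open>The only triple on \<open>y\<close> and \<open>c i\<close> is used up by
  \<open>c (i + 1)\<close>, so the backward direction is free.\<close>

lemma blk_bk: assumes "cyc m c" "blk c y i" shows "bk c y i"
proof -
  have "c (i - 1) \<noteq> c (i + 1)" using cyc_neq[OF assms(1), of "i-1" "i+1"] cyc_ge3[OF assms(1)] by auto
  then show ?thesis using assms(2) tri_unique tri_adj unfolding blk_def bk_def by blast
qed

lemma blk_fr: assumes "cyc m c" "blk c y i" shows "fr c y (i + 1)"
proof -
  have "c i \<noteq> c (i + 2)" using cyc_neq[OF assms(1), of "i" "i+2"] cyc_ge3[OF assms(1)] by auto
  then show ?thesis using assms(2) tri_unique tri_adjs(3) unfolding blk_def fr_def
    by (metis add.assoc one_add_one tri_23)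
qed

lemma blk_unique: "blk c y i \<Longrightarrow> blk c y' i \<Longrightarrow> y = y'"
  unfolding blk_def using tri_unique tri_ac by metis

lemma card_nb_cyc:
  assumes "cyc m c"
  shows "card (nb (range c) y) = card {i\<in>{0..<m}. adj y (c i)}"
proof -
  have e: "{0..<m} = {0..m-1}" by auto
  have "nb (range c) y = c ` {i\<in>{0..<m}. adj y (c i)}"
    unfolding nb_def e cyc_range[OF assms, of "m - 1" 0, simplified, symmetric] by auto
  moreover have "inj_on c {i\<in>{0..<m}. adj y (c i)}"
    by (rule inj_on_subset[OF cyc_inj_on[OF assms, of "m-1" 0]]) auto
  ultimately show ?thesis by (simp add: card_image)
qed

text \<open>A neighbour fails to be a forward entry exactly when \<open>y\<close> blocks the edge
  after it. The shift to \<open>i + 1\<close> prepares the pairing with \<open>bk\<close> at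
  \<open>i\<close>: these are the two ends of one cycle edge.\<close>

lemma card_fr:
  assumes "cyc m c"
  shows "card {i\<in>{0..<m}. fr c y (i + 1)} + card {i\<in>{0..<m}. blk c y i} = card (nb (range c) y)"
proof -
  have m: "0 < m" using cyc_ge3[OF assms] by simp
  have "card {i\<in>{0..<m}. fr c y (i + 1)} = card {i\<in>{0..<m}. fr c y i}"
    by (rule card_periodic_shift[OF _ m]) (rule cyc_periodic[OF assms])
  moreover have "{i\<in>{0..<m}. adj y (c i)} = {i\<in>{0..<m}. fr c y i} \<union> {i\<in>{0..<m}. blk c y i}"
    "{i\<in>{0..<m}. fr c y i} \<inter> {i\<in>{0..<m}. blk c y i} = {}"
    by (auto simp: fr_def blk_def tri_adjs)
  ultimately show ?thesis unfolding card_nb_cyc[OF assms] by (simp add: card_Un_disjoint)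
qed

lemma card_bk:
  assumes "cyc m c"
  shows "card {i\<in>{0..<m}. bk c y i} + card {i\<in>{0..<m}. blk c y i} = card (nb (range c) y)"
proof -
  have m: "0 < m" using cyc_ge3[OF assms] by simp
  have "card {i\<in>{0..<m}. blk c y (i + (-1))} = card {i\<in>{0..<m}. blk c y i}"
    by (rule card_periodic_shift[OF _ m]) (rule cyc_periodic[OF assms])
  moreover have "adj y (c i) \<longleftrightarrow> bk c y i \<or> blk c y (i + (-1))" "\<not> (bk c y i \<and> blk c y (i + (-1)))" for i
    using tri_adjs(3)[of y "c (i-1)" "c i"] tri_23[of y "c i" "c (i-1)"] by (auto simp: bk_def blk_def)
  then have "{i\<in>{0..<m}. adj y (c i)} = {i\<in>{0..<m}. bk c y i} \<union> {i\<in>{0..<m}. blk c y (i + (-1))}"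
    "{i\<in>{0..<m}. bk c y i} \<inter> {i\<in>{0..<m}. blk c y (i + (-1))} = {}"
    by auto
  ultimately show ?thesis unfolding card_nb_cyc[OF assms] by (simp add: card_Un_disjoint)
qed

text \<open>Ordered pairs, to match \<open>E2\<close>.\<close>

abbreviation missing :: "'a set \<Rightarrow> ('a \<times> 'a) set" where
  "missing W \<equiv> {(a, b). a \<in> W \<and> b \<in> W \<and> a \<noteq> b \<and> \<not> adj a b}"

lemma E2_missing:
  assumes "finite W"
  shows "E2 W + card (missing W) = card W * (card W - 1)"
proof -
  have "card (missing W) = (\<Sum>a\<in>W. card {b\<in>W. a \<noteq> b \<and> \<not> adj a b})"
  proof -
    have "missing W = (SIGMA a:W. {b\<in>W. a \<noteq> b \<and> \<not> adj a b})" by auto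
    then show ?thesis using assms by simp
  qed
  moreover have "card (nb W a) + card {b\<in>W. a \<noteq> b \<and> \<not> adj a b} = card W - 1" if "a \<in> W" for a
  proof -
    have "nb W a \<union> {b\<in>W. a \<noteq> b \<and> \<not> adj a b} = W - {a}" "nb W a \<inter> {b\<in>W. a \<noteq> b \<and> \<not> adj a b} = {}"
      using adj_irrefl by (auto simp: nb_def)
    then show ?thesis using assms that card_Un_disjoint[of "nb W a" "{b\<in>W. a \<noteq> b \<and> \<not> adj a b}"] by simp
  qed
  ultimately show ?thesis by (simp add: E2_def sum.distrib[symmetric])
qed

text \<open>Every cycle edge lies in at most one triple, so no position is counted for two
  vertices.\<close>

lemma sum_blk:
  assumes "finite Y"
  shows "(\<Sum>y\<in>Y. card {i\<in>{0..<m}. blk c y i}) = card {i\<in>{0..<m}. \<exists>y\<in>Y. blk c y i}"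
proof -
  have "(\<Sum>y\<in>Y. card {i\<in>{0..<m}. blk c y i}) = (\<Sum>i\<in>{0..<m}. card {y\<in>Y. blk c y i})"
    by (rule sum_card_swap) (use assms in auto)
  also have "\<dots> = (\<Sum>i\<in>{0..<m}. of_bool (\<exists>y\<in>Y. blk c y i))"
  proof (rule sum.cong[OF refl])
    fix i show "card {y\<in>Y. blk c y i} = of_bool (\<exists>y\<in>Y. blk c y i)"
    proof (cases "\<exists>y\<in>Y. blk c y i")
      case True
      then obtain y where "y \<in> Y" "blk c y i" by auto
      then have "{y\<in>Y. blk c y i} = {y}" using blk_unique by auto
      then show ?thesis using True by simp
    next
      case False
      then have e: "{y\<in>Y. blk c y i} = {}" by auto
      show ?thesis unfolding e using False by simp
    qed
  qed
  also have "\<dots> = card {i\<in>{0..<m}. \<exists>y\<in>Y. blk c y i}" by (simp add: Int_def)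
  finally show ?thesis .
qed

lemma cycI:
  assumes "distinct xs" "3 \<le> length xs" "walk xs" "adj (last xs) (hd xs)"
    "\<not> tri (last (butlast xs)) (last xs) (hd xs)" "\<not> tri (last xs) (hd xs) (hd (tl xs))"
  shows "\<exists>c. cyc (int (length xs)) c \<and> range c = set xs"
proof (rule cyc_of_list)
  have "xs \<noteq> []" using assms(2) by auto
  then show "walk (xs @ xs)" using assms by (simp add: walk_append)
qed (use assms in auto)

lemma cyc_insert:
  assumes c: "cyc m c" and y: "y \<notin> range c" "bk c y i" "fr c y (i + 1)" "\<not> blk c y i"
  shows "\<exists>c'. cyc (m + 1) c' \<and> range c' = insert y (range c)"
proof -
  have m: "3 \<le> m" using cyc_ge3[OF c] .
  let ?xs = "y # map c [i+1..i+m]"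
  have e: "i + m - 1 = (i - 1) + m" "i + 1 + 1 = i + 2" by simp_all
  have e3: "c (i + m - 1) = c (i - 1)" unfolding e using cycD(1)[OF c] by blast
  have f: "adj y (c (i+1))" "\<not> tri y (c (i + 1)) (c (i + 2))" "adj y (c i)" "\<not> tri y (c i) (c (i - 1))" "\<not> tri y (c i) (c (i + 1))"
    using y unfolding fr_def bk_def blk_def by (simp_all add: e)
  have "walk ?xs" using f m cyc_walk[OF c] by (subst walk_Cons) (auto simp: e)
  moreover have "distinct ?xs" using y cyc_inj_on[OF c, of "i+m" "i+1"] by (auto simp: distinct_map)
  ultimately have "\<exists>c. cyc (int (length ?xs)) c \<and> range c = set ?xs"
    using f m adj_sym tri_ac cycD(1)[OF c, of i] e3
    by (intro cycI) (auto simp: tri_ac)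
  moreover have "set ?xs = insert y (range c)" using cyc_range[OF c, of "i+m" "i+1"] by simp
  moreover have "int (length ?xs) = m + 1" using m by simp
  ultimately show ?thesis by metis
qed

end

context mincex
begin

text \<open>The path goes from \<open>y\<close> to \<open>c (i + 1)\<close>, around the cycle to
  \<open>c (i + m)\<close>, which is \<open>c i\<close>, and out to \<open>y'\<close>.\<close>

lemma ends_path:
  assumes c: "cyc m c" and r: "range c \<subseteq> V"
    and y: "y \<in> V - range c" "y' \<in> V - range c" "y \<noteq> y'" "fr c y (i + 1)" "bk c y' i"
  shows "m + 2 \<le> int l"
proof -
  have m: "3 \<le> m" using cyc_ge3[OF c] .
  let ?p = "(y # map c [i+1..i+m]) @ [y']"
  have e: "i + m - 1 = (i - 1) + m" "i + 1 + 1 = i + 2" by simp_all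
  have e3: "c (i + m - 1) = c (i - 1)" unfolding e using cycD(1)[OF c] by blast
  have f: "adj y (c (i+1))" "\<not> tri y (c (i + 1)) (c (i + 2))" "adj (c i) y'" "\<not> tri (c (i - 1)) (c i) y'"
    using y adj_sym tri_ac unfolding fr_def bk_def by (auto simp: e tri_ac)
  have "walk (y # map c [i+1..i+m])" using f m cyc_walk[OF c] by (subst walk_Cons) (auto simp: e)
  then have "walk ?p" using f m cycD(1)[OF c, of i] e3 by (subst walk_append) auto
  moreover have "distinct ?p" using y cyc_inj_on[OF c, of "i+m" "i+1"] by (auto simp: distinct_map)
  moreover have "set ?p \<subseteq> V" using r y by auto
  ultimately have "length ?p \<le> l" by (rule path_bound)
  then show ?thesis using m by simp
qed

lemma E2_split:
  assumes c: "cyc m c" and r: "range c \<subseteq> V"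
  shows "E2 V = E2 (range c) + E2 (V - range c) + 2 * (\<Sum>y\<in>V - range c. card (nb (range c) y))"
proof -
  have "V = range c \<union> (V - range c)" using r by blast
  then show ?thesis using E2_Un[of "range c" "V - range c"] finV cyc_card(1)[OF c] by simp
qed

lemma card_split:
  assumes c: "cyc m c" and r: "range c \<subseteq> V"
  shows "int (card V) = m + int (card (V - range c))"
  using cyc_card[OF c] r card_Diff_subset[of "range c" V] card_mono[OF finV r] by simp

lemma E2_indep: "(\<And>x y. x \<in> W \<Longrightarrow> y \<in> W \<Longrightarrow> \<not> adj x y) \<Longrightarrow> E2 W = 0"
proof -
  assume "\<And>x y. x \<in> W \<Longrightarrow> y \<in> W \<Longrightarrow> \<not> adj x y"
  then have "nb W u = {}" if "u \<in> W" for u using that by (auto simp: nb_def)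
  then show ?thesis by (simp add: E2_def)
qed

end

section \<open>Counting edges between a cycle on k - 1 vertices and its complement\<close>

locale core = mincex adj tri V k "k - 1"
  for adj :: "'a \<Rightarrow> 'a \<Rightarrow> bool" and tri and V and k :: nat +
  assumes k4: "4 \<le> k"
begin

lemma card_V_core: "k + 1 \<le> card V" using card_V k4 by simp

lemma no_cyc_k: "cyc (int k) c \<Longrightarrow> range c \<subseteq> V \<Longrightarrow> False"
  using no_cyc_l card_V_core by auto

text \<open>Connectivity yields an outside edge \<open>u w\<close> with \<open>w\<close> joined to
  the cycle. It prolongs to a walk on \<open>k + 1\<close> vertices unless it forms a triple with
  the cycle vertex. Then both ends have degree at most 2, below the bound for an adjacent pair when
  \<open>k \<ge> 4\<close>.\<close>

lemma cyc_k1_indep: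
  assumes c: "cyc (int k - 1) c" and r: "range c \<subseteq> V"
    and y: "y \<in> V - range c" "y' \<in> V - range c"
  shows "\<not> adj y y'"
proof
  assume yy: "adj y y'"
  define Y where "Y = V - range c"
  define S where "S = {w\<in>Y. \<exists>u\<in>Y. adj w u}"
  have "S \<noteq> {}" using y yy by (auto simp: S_def Y_def)
  moreover have "c 0 \<in> V" "c 0 \<notin> S" using r by (auto simp: S_def Y_def)
  then have "S \<subset> V" by (auto simp: S_def Y_def)
  ultimately obtain w v where wv: "w \<in> S" "v \<in> V" "v \<notin> S" "adj w v" using connected[of S] by blast
  then have "v \<notin> Y" using adj_sym by (auto simp: S_def)
  then obtain j where j: "v = c j" using wv by (auto simp: Y_def)
  obtain u where u: "u \<in> Y" "adj w u" and wY: "w \<in> Y" using wv by (auto simp: S_def)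
  have tr: "tri u w (c i)" if "u \<in> Y" "w \<in> Y" "adj w u" "adj w (c i)" for u w i
  proof (rule ccontr)
    assume "\<not> tri u w (c i)"
    then have "int (length [u, w]) + (int k - 1) \<le> int k"
      using that adj_irrefl by (intro attach_to_cyc[OF c r]) (auto simp: Y_def adj_commute)
    then show False by simp
  qed
  have t: "tri u w (c j)" using tr u wY wv j by auto
  have d2: "deg w \<le> 2" if "tri u w (c j)" "u \<in> Y" "w \<in> Y" for u w
  proof -
    have "nb V w \<subseteq> {u, c j}"
    proof
      fix x assume x: "x \<in> nb V w"
      show "x \<in> {u, c j}"
      proof (cases "x \<in> Y")
        case True
        then have "tri x w (c j)" using x tr[of x w j] that(3) tri_adjs(5)[OF that(1)] by (simp add: nb_def)
        then show ?thesis using tri_unique1[OF _ that(1)] by blast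
      next
        case False
        then obtain i where "x = c i" using x by (auto simp: nb_def Y_def)
        then have "tri u w x" using x tr[of u w i] that(2,3) tri_adjs(2)[OF that(1)] by (simp add: nb_def)
        then show ?thesis using tri_unique[OF _ that(1)] by blast
      qed
    qed
    then have "card (nb V w) \<le> card {u, c j}" by (intro card_mono) auto
    also have "\<dots> \<le> 2" by (simp add: card_insert_le_m1)
    finally show ?thesis .
  qed
  have "deg w \<le> 2" "deg u \<le> 2" using d2[of u w] d2[of w u] t u wY triD(1)[OF t] by blast+
  moreover have "2 * (k - 1) + 2 < 2 * (deg u + deg w)"
  proof -
    have "adj u w" "u \<noteq> w" using tri_adj[OF t] tri_neq[OF t] by simp_all
    then show ?thesis using deg_pair_gt[of u w] u wY by (simp add: Y_def)
  qed
  ultimately show False using k4 by arith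
qed

lemma cyc_k1_insert:
  assumes c: "cyc (int k - 1) c" and r: "range c \<subseteq> V"
    and y: "y \<in> V - range c" "bk c y i" "fr c y (i + 1)"
  shows "blk c y i"
proof (rule ccontr)
  assume "\<not> blk c y i"
  then obtain c' where c': "cyc (int k) c'" "range c' = insert y (range c)"
    using cyc_insert[OF c, of y i] y by auto
  have "range c' \<subseteq> V" unfolding c'(2) using r y(1) by blast
  then show False by (rule no_cyc_k[OF c'(1)])
qed

lemma cyc_k1_ends:
  assumes c: "cyc (int k - 1) c" and r: "range c \<subseteq> V"
    and y: "y \<in> V - range c" "y' \<in> V - range c" "fr c y (i + 1)" "bk c y' i"
  shows "y = y'"
  using ends_path[OF c r y(1,2) _ y(3,4)] by fastforce

text \<open>Twice the degree sum is distributed over the positions as \<open>fr\<close> at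
  \<open>i + 1\<close> plus \<open>bk\<close> at \<open>i\<close>. A position blocked by
  \<open>y\<close> admits only \<open>y\<close> at either end. Comparing the third and fourth
  conclusions leaves \<open>k - 1\<close> plus the number of missing pairs below
  \<open>(4 - N) * \<beta>\<close>, which rules out all \<open>N\<close> but 2.\<close>

lemma cyc_k1_count:
  assumes c: "cyc (int k - 1) c" and r: "range c \<subseteq> V"
  defines "Y \<equiv> V - range c"
  defines "\<beta> \<equiv> card {i\<in>{0..<int k - 1}. \<exists>y\<in>Y. blk c y i}"
  defines "N \<equiv> card Y"
  shows "2 \<le> N" "\<beta> \<le> k - 1"
    "int (k - 1) * (int N + 1) + (int (k - 1) * (int (k - 1) - 1) - int (E2 (range c))) < 2 * int (\<Sum>y\<in>Y. deg y)"
    "2 * int (\<Sum>y\<in>Y. deg y) \<le> int N * int (k - 1) + (4 - int N) * int \<beta>"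
    "\<And>y. y \<in> Y \<Longrightarrow> deg y = card (nb (range c) y)"
proof -
  define m where "m = int k - 1"
  have fY: "finite Y" using finV by (simp add: Y_def)
  have m: "int (k - 1) = m" "3 \<le> m" using k4 by (auto simp: m_def)
  have cV: "int (card V) = m + int N" using card_split[OF c r] by (simp add: N_def Y_def m_def)
  then show N2: "2 \<le> N" using card_V_core m by (simp add: m_def)
  have ind: "\<not> adj x y" if "x \<in> Y" "y \<in> Y" for x y using cyc_k1_indep[OF c r] that by (auto simp: Y_def)
  show dg: "deg y = card (nb (range c) y)" if "y \<in> Y" for y
  proof -
    have "nb V y = nb (range c) y" using ind[OF that] r by (auto simp: nb_def Y_def)
    then show ?thesis by simp
  qed
  have "E2 V = E2 (range c) + 2 * (\<Sum>y\<in>Y. deg y)"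
    using E2_split[OF c r] E2_indep[of Y] ind dg by (simp add: Y_def)
  then have "int (E2 V) = int (E2 (range c)) + 2 * int (\<Sum>y\<in>Y. deg y)" by simp
  moreover have "m * (m + int N) < int (E2 V)"
  proof -
    have "int ((k - 1) * card V) < int (E2 V)" using big of_nat_less_iff by blast
    then show ?thesis unfolding of_nat_mult cV m(1) .
  qed
  ultimately show "int (k - 1) * (int N + 1) + (int (k - 1) * (int (k - 1) - 1) - int (E2 (range c))) < 2 * int (\<Sum>y\<in>Y. deg y)"
    unfolding m(1) by (simp add: algebra_simps)
  let ?I = "{0..<int k - 1}"
  show bm: "\<beta> \<le> k - 1"
  proof -
    have "{i\<in>?I. \<exists>y\<in>Y. blk c y i} \<subseteq> ?I" by auto
    from card_mono[OF _ this] have "card {i\<in>?I. \<exists>y\<in>Y. blk c y i} \<le> nat (int k - 1)" by simp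
    then show ?thesis unfolding \<beta>_def by linarith
  qed
  define s where "s i = card {y\<in>Y. fr c y (i+1)} + card {y\<in>Y. bk c y i}" for i
  have sb: "s i \<le> (if \<exists>y\<in>Y. blk c y i then 2 else N)" for i
  proof (cases "\<exists>y\<in>Y. blk c y i")
    case True
    then obtain y where y: "y \<in> Y" "blk c y i" by auto
    have "fr c y (i+1)" "bk c y i" using blk_fr[OF c y(2)] blk_bk[OF c y(2)] by auto
    then have "{y\<in>Y. fr c y (i+1)} \<subseteq> {y}" "{y\<in>Y. bk c y i} \<subseteq> {y}"
      using cyc_k1_ends[OF c r, of _ y i] cyc_k1_ends[OF c r, of y _ i] y(1) unfolding Y_def by blast+
    from this[THEN card_mono[rotated]] have "card {y\<in>Y. fr c y (i+1)} \<le> 1" "card {y\<in>Y. bk c y i} \<le> 1"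
      by simp_all
    then show ?thesis using True by (simp add: s_def)
  next
    case False
    \<comment> \<open>Two different vertices here give a path on \<open>k + 1\<close> vertices, and
      a single one could be inserted into the cycle.\<close>
    have "{y\<in>Y. fr c y (i+1)} = {} \<or> {y\<in>Y. bk c y i} = {}"
    proof (rule ccontr)
      assume "\<not> ?thesis"
      then obtain y y' where "y \<in> Y" "fr c y (i+1)" "y' \<in> Y" "bk c y' i" by auto
      moreover then have "y = y'" using cyc_k1_ends[OF c r, of y y' i] unfolding Y_def by blast
      ultimately show False using False cyc_k1_insert[OF c r, of y i] unfolding Y_def by blast
    qed
    moreover have "card {y\<in>Y. fr c y (i+1)} \<le> N" "card {y\<in>Y. bk c y i} \<le> N"
      unfolding N_def using fY by (auto intro: card_mono)
    ultimately have "s i \<le> N" unfolding s_def by (metis (no_types, lifting) add_0 add_0_right card.empty)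
    then show ?thesis using False by simp
  qed
  have "2 * (\<Sum>y\<in>Y. deg y) = (\<Sum>y\<in>Y. card {i\<in>?I. fr c y (i + 1)}) + (\<Sum>y\<in>Y. card {i\<in>?I. bk c y i}) + 2 * \<beta>"
  proof -
    have "2 * (\<Sum>y\<in>Y. deg y) = (\<Sum>y\<in>Y. card {i\<in>?I. fr c y (i + 1)} + card {i\<in>?I. bk c y i} + 2 * card {i\<in>?I. blk c y i})"
      unfolding sum_distrib_left
    proof (rule sum.cong[OF refl])
      fix y assume "y \<in> Y"
      then show "2 * deg y = card {i\<in>?I. fr c y (i + 1)} + card {i\<in>?I. bk c y i} + 2 * card {i\<in>?I. blk c y i}"
        using card_fr[OF c, of y] card_bk[OF c, of y] dg[of y] by linarith
    qed
    then show ?thesis unfolding \<beta>_def sum_blk[OF fY, symmetric] by (simp add: sum.distrib sum_distrib_left)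
  qed
  also have "\<dots> = (\<Sum>i\<in>?I. s i) + 2 * \<beta>"
    unfolding s_def using sum_card_swap[OF fY, of ?I] by (simp add: sum.distrib)
  also have "\<dots> \<le> (\<Sum>i\<in>?I. if \<exists>y\<in>Y. blk c y i then 2 else N) + 2 * \<beta>"
    using sb by (intro add_right_mono sum_mono)
  also have "(\<Sum>i\<in>?I. if \<exists>y\<in>Y. blk c y i then 2 else N) = 2 * \<beta> + N * (k - 1 - \<beta>)"
  proof -
    have e: "?I \<inter> - {i. \<exists>y\<in>Y. blk c y i} = ?I - {i\<in>?I. \<exists>y\<in>Y. blk c y i}" by auto
    have "card (?I - {i\<in>?I. \<exists>y\<in>Y. blk c y i}) = card ?I - \<beta>"
      unfolding \<beta>_def by (rule card_Diff_subset) auto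
    moreover have "card ?I = k - 1" by auto
    ultimately have "card (?I \<inter> - {i. \<exists>y\<in>Y. blk c y i}) = k - 1 - \<beta>" unfolding e by simp
    moreover have "card (?I \<inter> {i. \<exists>y\<in>Y. blk c y i}) = \<beta>" by (simp add: \<beta>_def Int_def)
    ultimately show ?thesis by (subst sum.If_cases) (simp_all add: mult.commute)
  qed
  finally have "2 * (\<Sum>y\<in>Y. deg y) \<le> 2 * \<beta> + N * (k - 1 - \<beta>) + 2 * \<beta>" .
  then have "int (2 * (\<Sum>y\<in>Y. deg y)) \<le> int (2 * \<beta> + N * (k - 1 - \<beta>) + 2 * \<beta>)"
    by (simp only: of_nat_le_iff)
  then show "2 * int (\<Sum>y\<in>Y. deg y) \<le> int N * int (k - 1) + (4 - int N) * int \<beta>"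
  proof -
    obtain t where "k - 1 = \<beta> + t" using bm le_Suc_ex by blast
    then show ?thesis using \<open>int (2 * (\<Sum>y\<in>Y. deg y)) \<le> _\<close> by (simp add: algebra_simps)
  qed
qed

subsection \<open>No cycle on k - 1 vertices\<close>

text \<open>
  With two vertices \<open>y\<close>, \<open>y'\<close> off the cycle there are two consecutive triples \<open>y c\<^sub>1 c\<^sub>2\<close> and \<open>y' c\<^sub>2 c\<^sub>3\<close>; a pair of
  chords \<open>c\<^sub>2 c\<^sub>j\<close>, \<open>c\<^sub>1 c\<^sub>j\<^sub>-\<^sub>1\<close> then gives the path \<open>y c\<^sub>2 c\<^sub>j \<dots> c\<^sub>m c\<^sub>1 c\<^sub>j\<^sub>-\<^sub>1 \<dots> c\<^sub>3 y'\<close> through all vertices.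
\<close>

lemma two_outside_chords:
  assumes c: "cyc m c" and m: "m = int k - 1" and r: "range c \<subseteq> V"
    and y: "y \<in> V - range c" "y' \<in> V - range c" "y \<noteq> y'"
    and b: "tri y (c 1) (c 2)" "tri y' (c 2) (c 3)"
    and j: "4 \<le> j" "j \<le> m"
    and a: "adj (c 2) (c j)" "adj (c 1) (c (j - 1))"
    and t: "j < m \<Longrightarrow> \<not> tri (c 2) (c j) (c (j + 1))" "\<not> tri (c m) (c 1) (c (j - 1))"
      "5 \<le> j \<Longrightarrow> \<not> tri (c 1) (c (j - 1)) (c (j - 2))"
  shows False
proof -
  let ?L = "[2] @ [j..m] @ [1] @ rev [3..j-1]"
  let ?p = "[y] @ map c ?L @ [y']"
  have cm: "c (m + 1) = c 1" using cycD(1)[OF c, of 1] by (simp add: add.commute)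
  have yn: "c i \<noteq> y" "c i \<noteq> y'" for i using y by auto
  have ne: "c i \<noteq> c j" if "1 \<le> i" "i < j" "j \<le> m" for i j using cyc_neq[OF c, of i j] that by simp
  have ne4: "c 1 \<noteq> c 2" "c 1 \<noteq> c 3" "c 2 \<noteq> c 3" "c 4 \<noteq> c 2" "c 4 \<noteq> c 3" "c j \<noteq> c 1" "c j \<noteq> c 2" "c m \<noteq> c 1" "c m \<noteq> c 2"
    using ne[of 1 2] ne[of 1 3] ne[of 2 3] ne[of 2 4] ne[of 3 4] ne[of 1 j] ne[of 2 j] ne[of 1 m] ne[of 2 m] j by auto
  have n1: "\<not> tri (c 4) (c 3) y'" using tri_share(3)[OF _ b(2), of "c 4" "c 3" y'] ne4 yn by auto
  have n2: "\<not> tri (c 1) (c 3) y'" using tri_share(3)[OF _ b(2), of "c 1" "c 3" y'] ne4 yn by auto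
  have n3: "\<not> tri (c (m - 1)) (c m) (c 1)" using cycD(3)[OF c, of "m - 1"] cm by (simp add: add.commute)
  have n4: "\<not> tri y (c 2) (c j)" using tri_share(1)[OF _ b(1), of y "c 2" "c j"] ne4 yn by auto
  have n5: "\<not> tri (c 2) (c m) (c 1)" using tri_share(2)[OF _ b(1), of "c 2" "c m" "c 1"] ne4 yn by auto
  have e: "j = 4 \<or> 5 \<le> j" "j = m \<or> j < m" using j by auto
  have q4: "walk ([y, c 2] @ map c [j..m] @ [c 1] @ rev (map c [3..j-1]) @ [y'])"
    using e j a t n1 n2 n3 n4 n5 cyc_walk[OF c] tri_adjs(6)[OF b(2)] tri_adjs(4)[OF b(2)] tri_adjs(3)[OF b(1)]
      cycD(2)[OF c, of m] cm
    by (elim disjE) (simp_all add: walk_simps)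
  have w: "walk ?p" using q4 by (simp add: rev_map)
  have "distinct ?L" "set ?L \<subseteq> {1..m}" using j by auto
  then have "distinct (map c ?L)" by (rule cyc_distinct_map[OF c]) simp
  moreover have "y \<notin> set (map c ?L)" "y' \<notin> set (map c ?L)" using yn by auto
  ultimately have d: "distinct ?p" using y by auto
  have "set ?p \<subseteq> V" using y r by auto
  from path_bound[OF w d this] show False using j m by simp
qed

lemma two_outside_ends:
  assumes c: "cyc (int k - 1) c" and r: "range c \<subseteq> V"
    and Y: "V - range c = {y, y'}" "y \<noteq> y'"
  shows "\<not> (fr c y (i + 1) \<and> bk c y' i)" "\<not> (fr c y' (i + 1) \<and> bk c y i)"
  using cyc_k1_ends[OF c r, of y y' i] cyc_k1_ends[OF c r, of y' y i] Y by auto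

lemma two_outside_count:
  assumes c: "cyc m c" and m: "m = int k - 1" and r: "range c \<subseteq> V"
    and Y: "V - range c = {y, y'}" "y \<noteq> y'"
  defines "\<beta> \<equiv> card {i\<in>{0..<m}. \<exists>z\<in>{y,y'}. blk c z i}"
  defines "\<mu> \<equiv> card (missing (range c))"
  shows "3 * m + int \<mu> < 2 * int (deg y) + 2 * int (deg y')" "int (deg y) + int (deg y') \<le> m + int \<beta>"
    "deg y = card {i\<in>{1..m}. adj y (c i)}" "deg y' = card {i\<in>{1..m}. adj y' (c i)}"
proof -
  have c': "cyc (int k - 1) c" using c m by simp
  have N: "card (V - range c) = 2" using Y by simp
  have S: "(\<Sum>z\<in>V - range c. deg z) = deg y + deg y'" using Y by simp
  have km: "int (k - 1) = m" using k4 m by simp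
  note C = cyc_k1_count[OF c' r, unfolded S N km]
  have mu: "int (E2 (range c)) + int \<mu> = m * (m - 1)"
  proof -
    have "E2 (range c) + \<mu> = card (range c) * (card (range c) - 1)"
      unfolding \<mu>_def by (rule E2_missing) (rule cyc_card[OF c])
    then have "int (E2 (range c)) + int \<mu> = int (card (range c)) * int (card (range c) - 1)"
      by (metis of_nat_add of_nat_mult)
    then show ?thesis using cyc_card[OF c] cyc_ge3[OF c] by (simp add: of_nat_diff)
  qed
  have b: "\<beta> = card {i \<in> {0..<int k - 1}. \<exists>y\<in>V - range c. blk c y i}" unfolding \<beta>_def Y m by simp
  show "3 * m + int \<mu> < 2 * int (deg y) + 2 * int (deg y')" using C(3) mu by (simp add: algebra_simps)
  show "int (deg y) + int (deg y') \<le> m + int \<beta>" using C(4) unfolding b[symmetric] by simp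
  have e: "{1..m} = {1..<1+m}" by auto
  have d: "deg z = card {i\<in>{1..m}. adj z (c i)}" if "z \<in> V - range c" for z
    unfolding C(5)[OF that] card_nb_cyc[OF c] e
    by (rule card_periodic_interval[symmetric]) (use cycD(1)[OF c] cyc_ge3[OF c] in auto)
  show "deg y = card {i\<in>{1..m}. adj y (c i)}" "deg y' = card {i\<in>{1..m}. adj y' (c i)}"
    using d Y by auto
qed

text \<open>Every \<open>j\<close> in \<open>{4..m}\<close> violates some premise of
  \<open>two_outside_chords\<close>. A missing chord costs two ordered pairs of
  \<open>\<mu>\<close>, and a triple of cycle vertices on a cycle edge keeps that edge from being
  blocked. Hence \<open>m - 3 \<le> \<mu> / 2 + (m - \<beta>)\<close>, and
  \<open>m + \<mu> < 2 * \<beta>\<close> leaves only \<open>m < 6\<close>.\<close>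

lemma two_outside_small:
  assumes c: "cyc m c" and m: "m = int k - 1" and r: "range c \<subseteq> V"
    and Y: "V - range c = {y, y'}" "y \<noteq> y'"
    and b: "tri y (c 1) (c 2)" "tri y' (c 2) (c 3)"
  shows "m < 6"
proof -
  define \<mu> where "\<mu> = card (missing (range c))"
  define P where "P i \<longleftrightarrow> (\<exists>z\<in>{y,y'}. blk c z i)" for i
  define \<beta> where "\<beta> = card {i\<in>{0..<m}. P i}"
  have "3 * m + int \<mu> < 2 * int (deg y) + 2 * int (deg y')" unfolding \<mu>_def by (rule two_outside_count(1)[OF c m r Y])
  moreover have "(int (deg y) + int (deg y')) \<le> m + int \<beta>" unfolding \<beta>_def P_def by (rule two_outside_count(2)[OF c m r Y])
  ultimately have cnt: "m + int \<mu> < 2 * int \<beta>" by linarith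
  have m3: "3 \<le> m" using cyc_ge3[OF c] .
  have ne: "c i \<noteq> c j" if "1 \<le> i" "i < j" "j \<le> m" for i j using cyc_neq[OF c, of i j] that by simp
  have yn: "c i \<noteq> y" "c i \<noteq> y'" for i using Y by auto
  define J1 where "J1 = {j\<in>{4..m}. \<not> adj (c 2) (c j)}"
  define J2 where "J2 = {j\<in>{4..m}. \<not> adj (c 1) (c (j-1))}"
  define J3 where "J3 = {j\<in>{4..m}. j < m \<and> tri (c 2) (c j) (c (j+1))}"
  define J4 where "J4 = {j\<in>{4..m}. tri (c m) (c 1) (c (j-1))}"
  define J5 where "J5 = {j\<in>{4..m}. 5 \<le> j \<and> tri (c 1) (c (j-1)) (c (j-2))}"
  have fin: "finite J1" "finite J2" "finite J3" "finite J4" "finite J5"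
    unfolding J1_def J2_def J3_def J4_def J5_def by simp_all
  have sub: "{4..m} \<subseteq> J1 \<union> J2 \<union> J3 \<union> J4 \<union> J5"
  proof
    fix j assume j: "j \<in> {4..m}"
    show "j \<in> J1 \<union> J2 \<union> J3 \<union> J4 \<union> J5"
    proof (rule ccontr)
      assume "j \<notin> J1 \<union> J2 \<union> J3 \<union> J4 \<union> J5"
      then show False
        using two_outside_chords[OF c m r _ _ Y(2) b, of j] j Y(1)
        unfolding J1_def J2_def J3_def J4_def J5_def by auto
    qed
  qed
  have "card {4..m} \<le> card (J1 \<union> J2 \<union> J3 \<union> J4 \<union> J5)" using sub fin by (intro card_mono) auto
  also have "\<dots> \<le> card J1 + card J2 + card J3 + card J4 + card J5"
    by (meson add_mono card_Un_le order_refl order_trans)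
  finally have J: "m - 3 \<le> int (card J1 + card J2 + (card J3 + card J4 + card J5))" by simp
  have A: "2 * card J1 + 2 * card J2 \<le> \<mu>"
  proof -
    let ?M1 = "(\<lambda>j. (c 2, c j)) ` J1" and ?M2 = "(\<lambda>j. (c j, c 2)) ` J1"
    let ?M3 = "(\<lambda>j. (c 1, c (j-1))) ` J2" and ?M4 = "(\<lambda>j. (c (j-1), c 1)) ` J2"
    have i1: "inj_on c J1" by (rule inj_on_subset[OF cyc_inj_on[OF c, of m 1]]) (auto simp: J1_def)
    have i2: "inj_on (\<lambda>j. c (j-1)) J2"
    proof (rule inj_onI)
      fix x z assume "x \<in> J2" "z \<in> J2" "c (x-1) = c (z-1)"
      then show "x = z" using inj_onD[OF cyc_inj_on[OF c, of m 1], of "x-1" "z-1"] by (auto simp: J2_def)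
    qed
    have cc: "card ?M1 = card J1" "card ?M2 = card J1" "card ?M3 = card J2" "card ?M4 = card J2"
      using i1 i2 by (auto intro!: card_image simp: inj_on_def)
    have n2: "c j \<noteq> c 2" "c j \<noteq> c 1" if "j \<in> J1" for j using ne[of 2 j] ne[of 1 j] that by (auto simp: J1_def)
    have n1: "c (j-1) \<noteq> c 1" if "j \<in> J2" for j using ne[of 1 "j-1"] that by (auto simp: J2_def)
    have n12: "c 1 \<noteq> c 2" using ne[of 1 2] m3 by simp
    have dis: "?M1 \<inter> ?M2 = {}" "(?M1 \<union> ?M2) \<inter> (?M3 \<union> ?M4) = {}" "?M3 \<inter> ?M4 = {}"
      using n1 n2 n12 by (auto dest: sym)
    have "card ((?M1 \<union> ?M2) \<union> (?M3 \<union> ?M4)) = 2 * card J1 + 2 * card J2"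
      using dis cc fin by (simp add: card_Un_disjoint)
    moreover have "(?M1 \<union> ?M2) \<union> (?M3 \<union> ?M4) \<subseteq> missing (range c)"
      using n1 n2 by (auto simp: J1_def J2_def adj_commute dest: sym)
    moreover have "finite (missing (range c))"
      by (rule finite_subset[of _ "range c \<times> range c"]) (use cyc_card[OF c] in auto)
    ultimately show ?thesis unfolding \<mu>_def using card_mono by (metis (no_types, lifting))
  qed
  have np: "\<not> P i" if "tri (c a) (c i) (c (i+1))" for a i
    using tri_unique1[OF that, of y] tri_unique1[OF that, of y'] yn unfolding P_def blk_def by auto
  have B: "card J3 + card J4 + card J5 \<le> card {i\<in>{1..m}. \<not> P i}"
  proof -
    have c1: "c (m + 1) = c 1" using cycD(1)[OF c, of 1] by (simp add: add.commute)
    have J4: "card J4 \<le> 1"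
    proof -
      have "x = z" if "x \<in> J4" "z \<in> J4" for x z
      proof -
        have "c (x-1) = c (z-1)" using that tri_unique unfolding J4_def by blast
        then show ?thesis using inj_onD[OF cyc_inj_on[OF c, of m 1], of "x-1" "z-1"] that by (auto simp: J4_def)
      qed
      then show ?thesis using card_le_Suc0_iff_eq[OF fin(4)] by auto
    qed
    \<comment> \<open>Unblocked cycle edges to which the triples are charged: \<open>j\<close> in
      \<open>J3\<close> goes to position \<open>j\<close>, \<open>j\<close> in \<open>J5\<close> to
      \<open>j - 2\<close>, and the at most one element of \<open>J4\<close> to the closing edge at
      \<open>m\<close>.\<close>
    define Q4 where "Q4 = (if J4 = {} then {} else {m})"
    let ?Q5 = "(\<lambda>j. j - 2) ` J5"
    have q4: "card J4 \<le> card Q4" "finite Q4" using J4 by (auto simp: Q4_def)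
    have "J3 \<inter> ?Q5 = {}"
    proof (rule ccontr)
      assume "J3 \<inter> ?Q5 \<noteq> {}"
      then obtain j where t: "tri (c 2) (c (j - 2)) (c (j - 1))" "tri (c 1) (c (j - 1)) (c (j - 2))"
        by (auto simp: J3_def J5_def)
      have "c 1 = c 2" by (rule tri_unique1[OF triD(2)[OF t(2)] t(1)])
      then show False using ne[of 1 2] m3 by simp
    qed
    moreover have "(J3 \<union> ?Q5) \<inter> Q4 = {}" by (auto simp: J3_def J5_def Q4_def)
    ultimately have "card (J3 \<union> ?Q5 \<union> Q4) = card J3 + card J5 + card Q4"
      using fin q4 by (simp add: card_Un_disjoint card_image)
    moreover have "J3 \<union> ?Q5 \<union> Q4 \<subseteq> {i\<in>{1..m}. \<not> P i}"
    proof -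
      have "\<not> P j" if "j \<in> J3" for j using that np[of 2 j] by (auto simp: J3_def)
      moreover have "\<not> P (j-2)" if "j \<in> J5" for j
      proof -
        have "tri (c 1) (c (j - 2)) (c (j - 2 + 1))" using that triD(2)[of "c 1" "c (j-1)" "c (j-2)"] by (simp add: J5_def)
        then show ?thesis by (rule np)
      qed
      moreover have "\<not> P m" if ne4: "J4 \<noteq> {}"
      proof -
        obtain j where "tri (c m) (c 1) (c (j-1))" using ne4 by (auto simp: J4_def)
        then have "tri (c (j-1)) (c m) (c (m + 1))" unfolding c1 by (rule triD(4))
        then show ?thesis by (rule np)
      qed
      ultimately show ?thesis using m3 by (auto simp: Q4_def J3_def J5_def split: if_splits)
    qed
    ultimately show ?thesis using card_mono[of "{i\<in>{1..m}. \<not> P i}" "J3 \<union> ?Q5 \<union> Q4"] q4 by simp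
  qed
  have per: "(\<not> P (i + m)) = (\<not> P i)" for i unfolding P_def using cyc_periodic(3)[OF c] by simp
  have e: "{1..m} = {1..<1+m}" by auto
  have "card {i\<in>{1..m}. \<not> P i} = card {i\<in>{0..<m}. \<not> P i}"
    unfolding e by (rule card_periodic_interval[of "\<lambda>i. \<not> P i", OF per]) (use m3 in simp)
  moreover have "\<beta> + card {i\<in>{0..<m}. \<not> P i} = nat m"
  proof -
    have "{i\<in>{0..<m}. P i} \<union> {i\<in>{0..<m}. \<not> P i} = {0..<m}" "{i\<in>{0..<m}. P i} \<inter> {i\<in>{0..<m}. \<not> P i} = {}" by auto
    then show ?thesis using card_Un_disjoint[of "{i\<in>{0..<m}. P i}" "{i\<in>{0..<m}. \<not> P i}"] unfolding \<beta>_def by simp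
  qed
  ultimately have "int (card {i\<in>{1..m}. \<not> P i}) = m - int \<beta>" using m3 by linarith
  then show ?thesis using J A B cnt by linarith
qed

section \<open>Two outside vertices and a cycle on 3, 4 or 5 vertices\<close>

lemma card_int_interval_numeral:
  "card {i\<in>{1..3::int}. P i} = of_bool (P 1) + of_bool (P 2) + of_bool (P 3)"
  "card {i\<in>{1..4::int}. P i} = of_bool (P 1) + of_bool (P 2) + of_bool (P 3) + of_bool (P 4)"
  "card {i\<in>{1..5::int}. P i} = of_bool (P 1) + of_bool (P 2) + of_bool (P 3) + of_bool (P 4) + of_bool (P 5)"
proof -
  have *: "card {i\<in>A. P i} = (\<Sum>i\<in>A. of_bool (P i))" if "finite A" for A :: "int set"
    using that by (simp add: Int_def)
  have i: "{1..3::int} = {1,2,3}" "{1..4::int} = {1,2,3,4}" "{1..5::int} = {1,2,3,4,5}" by auto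
  show "card {i\<in>{1..3::int}. P i} = of_bool (P 1) + of_bool (P 2) + of_bool (P 3)"
    "card {i\<in>{1..4::int}. P i} = of_bool (P 1) + of_bool (P 2) + of_bool (P 3) + of_bool (P 4)"
    "card {i\<in>{1..5::int}. P i} = of_bool (P 1) + of_bool (P 2) + of_bool (P 3) + of_bool (P 4) + of_bool (P 5)"
    unfolding *[OF finite_atLeastAtMost_int] unfolding i by (simp_all add: add.assoc)
qed

text \<open>Since \<open>y'\<close> enters backwards at 2, a forward entry of \<open>y\<close> at 3
  would give a path on \<open>k + 1\<close> vertices; an edge from \<open>y\<close> to
  \<open>c 3\<close> must be blocked by \<open>c 4\<close>. The second part is the mirror
  image.\<close>

lemma two_outside_adj:
  assumes c: "cyc m c" and m: "m = int k - 1" and r: "range c \<subseteq> V"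
    and Y: "V - range c = {y, y'}" "y \<noteq> y'"
    and b: "tri y (c 1) (c 2)" "tri y' (c 2) (c 3)"
  shows "adj y (c 3) \<Longrightarrow> tri y (c 3) (c 4)" "adj y' (c 1) \<Longrightarrow> tri y' (c 1) (c m)"
proof -
  have c': "cyc (int k - 1) c" using c m by simp
  have "blk c y 1" "blk c y' 2" using b by (simp_all add: blk_def)
  then have "fr c y 2" "bk c y' 2" using blk_fr[OF c, of y 1] blk_bk[OF c, of y' 2] by simp_all
  then have "\<not> fr c y 3" "\<not> bk c y' 1" using two_outside_ends(1)[OF c' r Y, of 2] two_outside_ends(1)[OF c' r Y, of 1] by auto
  moreover have "c 0 = c m" using cycD(1)[OF c, of 0] by simp
  ultimately show "adj y (c 3) \<Longrightarrow> tri y (c 3) (c 4)" "adj y' (c 1) \<Longrightarrow> tri y' (c 1) (c m)"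
    by (simp_all add: fr_def bk_def)
qed

lemma two_outside_3:
  assumes c: "cyc m c" and m: "m = int k - 1" and r: "range c \<subseteq> V"
    and Y: "V - range c = {y, y'}" "y \<noteq> y'"
    and b: "tri y (c 1) (c 2)" "tri y' (c 2) (c 3)" and m3: "m = 3"
  shows False
proof -
  have c4: "c 4 = c 1" using cycD(1)[OF c, of 1] m3 by simp
  have ne: "c 1 \<noteq> c 2" "c 2 \<noteq> c 3" "c 1 \<noteq> c 3"
    using cyc_neq[OF c, of 1 2] cyc_neq[OF c, of 2 3] cyc_neq[OF c, of 1 3] m3 by auto
  have yn: "c i \<noteq> y" "c i \<noteq> y'" for i using Y by auto
  have "\<not> adj y (c 3)"
  proof
    assume "adj y (c 3)"
    then have "tri y (c 3) (c 1)" using two_outside_adj(1)[OF assms(1-7)] c4 by simp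
    from tri_share(2)[OF this b(1)] show False using ne yn by auto
  qed
  moreover have "\<not> adj y' (c 1)"
  proof
    assume "adj y' (c 1)"
    then have "tri y' (c 1) (c 3)" using two_outside_adj(2)[OF assms(1-7)] m3 by simp
    from tri_share(2)[OF this b(2)] show False using ne yn by auto
  qed
  ultimately have "deg y \<le> 2" "deg y' \<le> 2"
    using two_outside_count(3,4)[OF c m r Y] unfolding m3 card_int_interval_numeral by auto
  then show False using two_outside_count(1)[OF c m r Y] m3 by linarith
qed

lemma no_path_6:
  assumes "k = 5" "set [v1,v2,v3,v4,v5,v6] \<subseteq> V" "distinct [v1,v2,v3,v4,v5,v6]"
    "adj v1 v2" "adj v2 v3" "adj v3 v4" "adj v4 v5" "adj v5 v6"
    "\<not> tri v1 v2 v3" "\<not> tri v2 v3 v4" "\<not> tri v3 v4 v5" "\<not> tri v4 v5 v6"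
  shows False
  using path_bound[of "[v1,v2,v3,v4,v5,v6]"] assms by simp

lemma two_outside_4:
  assumes c: "cyc m c" and m: "m = int k - 1" and r: "range c \<subseteq> V"
    and Y: "V - range c = {y, y'}" "y \<noteq> y'"
    and b: "tri y (c 1) (c 2)" "tri y' (c 2) (c 3)" and m4: "m = 4"
  shows False
proof -
  have c': "cyc (int k - 1) c" using c m by simp
  have c5: "c 5 = c 1" using cycD(1)[OF c, of 1] m4 by simp
  have ne: "c i \<noteq> c j" if "1 \<le> i" "i < j" "j \<le> 4" for i j using cyc_neq[OF c, of i j] that m4 by simp
  have ne4: "c 1 \<noteq> c 2" "c 1 \<noteq> c 3" "c 1 \<noteq> c 4" "c 2 \<noteq> c 3" "c 2 \<noteq> c 4" "c 3 \<noteq> c 4" by (simp_all add: ne)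
  have yn: "c i \<noteq> y" "c i \<noteq> y'" for i using Y by auto
  have inV: "c i \<in> V" "y \<in> V" "y' \<in> V" for i using r Y by auto
  define M where "M = missing (range c)"
  have cnt: "12 + int (card M) < 2 * int (deg y) + 2 * int (deg y')"
    using two_outside_count(1)[OF c m r Y] unfolding M_def m4 by simp
  note d = two_outside_count(3,4)[OF c m r Y, unfolded m4 card_int_interval_numeral]
  have f: "adj y (c 3) \<Longrightarrow> tri y (c 3) (c 4)" "adj y' (c 1) \<Longrightarrow> tri y' (c 1) (c 4)"
    using two_outside_adj[OF assms(1-7)] m4 by simp_all
  have "adj y' (c 1)"
  proof (rule ccontr)
    assume n: "\<not> adj y' (c 1)"
    then have "adj y (c 3)" "adj y' (c 4)" using d cnt by (auto simp: of_bool_def split: if_splits)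
    then have t: "tri y (c 3) (c 4)" using f by simp
    then have "bk c y 3" using blk_bk[OF c, of y 3] by (simp add: blk_def)
    then have "\<not> fr c y' 4" using two_outside_ends(2)[OF c' r Y, of 3] by auto
    then have "tri y' (c 4) (c 1)" using \<open>adj y' (c 4)\<close> c5 by (simp add: fr_def)
    then show False using n tri_adjs(3) by blast
  qed
  moreover have "adj y (c 3)"
  proof (rule ccontr)
    assume n: "\<not> adj y (c 3)"
    then have "adj y' (c 1)" "adj y (c 4)" using d cnt by (auto simp: of_bool_def split: if_splits)
    then have t: "tri y' (c 4) (c 1)" using f triD(2) by blast
    then have "fr c y' 5" using blk_fr[OF c, of y' 4] c5 by (simp add: blk_def)
    then have "\<not> bk c y 4" using two_outside_ends(2)[OF c' r Y, of 4] by auto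
    then have "tri y (c 4) (c 3)" using \<open>adj y (c 4)\<close> by (simp add: bk_def)
    then show False using n tri_adjs(3) by blast
  qed
  ultimately have t: "tri y (c 3) (c 4)" "tri y' (c 1) (c 4)" using f by auto
  note ts = b t
  note ad = ts[THEN tri_adjs(1)] ts[THEN tri_adjs(2)] ts[THEN tri_adjs(3)] ts[THEN tri_adjs(4)] ts[THEN tri_adjs(5)] ts[THEN tri_adjs(6)]
  \<comment> \<open>Without both diagonals four ordered pairs are missing, and even degrees 4 and 4
    only reach \<open>16 = 12 + 4\<close>, not more.\<close>
  have "adj (c 1) (c 3) \<or> adj (c 2) (c 4)"
  proof (rule ccontr)
    assume n: "\<not> ?thesis"
    then have "{(c 1, c 3), (c 3, c 1), (c 2, c 4), (c 4, c 2)} \<subseteq> M"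
      using ne4 by (auto simp: M_def adj_commute)
    moreover have "finite M" unfolding M_def
      by (rule finite_subset[of _ "range c \<times> range c"]) (use cyc_card[OF c] in auto)
    ultimately have "card {(c 1, c 3), (c 3, c 1), (c 2, c 4), (c 4, c 2)} \<le> card M" by (rule card_mono[rotated])
    then have "4 \<le> card M" using ne4 ne4[symmetric] by simp
    moreover have "deg y \<le> 4" "deg y' \<le> 4" unfolding d by auto
    ultimately show False using cnt by simp
  qed
  then show False
  proof
    assume a: "adj (c 1) (c 3)"
    have n: "\<not> tri (c 4) y (c 2)" "\<not> tri y (c 2) y'" "\<not> tri (c 2) y' (c 1)" "\<not> tri y' (c 1) (c 3)"
      using tri_share(2)[OF _ b(1), of y "c 4" "c 2"] tri_share(1)[OF _ b(1), of y "c 2" y']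
        tri_share(1)[OF _ b(2), of "c 2" y' "c 1"] tri_share(2)[OF _ b(2), of y' "c 1" "c 3"]
        triD(1)[of "c 4" y "c 2"] ne4 ne4[symmetric] yn yn[symmetric] Y(2) by auto
    show False
      by (rule no_path_6[of "c 4" y "c 2" y' "c 1" "c 3"])
        (use a n ne4 ne4[symmetric] yn yn[symmetric] Y(2) inV m m4 ad in simp_all)
  next
    assume a: "adj (c 2) (c 4)"
    have n: "\<not> tri (c 1) y' (c 3)" "\<not> tri y' (c 3) y" "\<not> tri (c 3) y (c 2)" "\<not> tri y (c 2) (c 4)"
      using tri_share(3)[OF _ b(2), of "c 1" y' "c 3"] tri_share(1)[OF _ b(2), of y' "c 3" y]
        tri_share(3)[OF _ b(1), of "c 3" y "c 2"] tri_share(1)[OF _ b(1), of y "c 2" "c 4"]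
        ne4 ne4[symmetric] yn yn[symmetric] Y(2) by auto
    show False
      by (rule no_path_6[of "c 1" y' "c 3" y "c 2" "c 4"])
        (use a n ne4 ne4[symmetric] yn yn[symmetric] Y(2) inV m m4 ad in simp_all)
  qed
qed

text \<open>The count requires degree sum at least 8, and exactly 8 forces every chord of the cycle
  (\<open>compl\<close>). Then \<open>two_outside_chords\<close> can fail only through the triples
  in \<open>A4\<close> and \<open>A5\<close>, which clash with each other or with the triples at
  \<open>y\<close> and \<open>y'\<close>. The premise \<open>n\<close> omits one case, which
  reflection maps to a covered one.\<close>

lemma two_outside_5:
  assumes c: "cyc m c" and m: "m = int k - 1" and r: "range c \<subseteq> V"
    and Y: "V - range c = {y, y'}" "y \<noteq> y'"
    and b: "tri y (c 1) (c 2)" "tri y' (c 2) (c 3)" and m5: "m = 5"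
    and n: "\<not> adj y' (c 1) \<or> adj y (c 3)"
  shows False
proof -
  have c': "cyc (int k - 1) c" using c m by simp
  have c6: "c 6 = c 1" using cycD(1)[OF c, of 1] m5 by simp
  have ne: "c i \<noteq> c j" if "1 \<le> i" "i < j" "j \<le> 5" for i j using cyc_neq[OF c, of i j] that m5 by simp
  have ne4: "c 1 \<noteq> c 2" "c 1 \<noteq> c 3" "c 1 \<noteq> c 4" "c 1 \<noteq> c 5" "c 2 \<noteq> c 3" "c 2 \<noteq> c 4" "c 2 \<noteq> c 5" "c 3 \<noteq> c 4" "c 3 \<noteq> c 5" "c 4 \<noteq> c 5"
    by (simp_all add: ne)
  have yn: "c i \<noteq> y" "c i \<noteq> y'" for i using Y by auto
  note neq = ne4 ne4[symmetric] yn yn[symmetric] Y(2) Y(2)[symmetric]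
  define M where "M = missing (range c)"
  have cnt: "15 + int (card M) < 2 * int (deg y) + 2 * int (deg y')"
    using two_outside_count(1)[OF c m r Y] unfolding M_def m5 by simp
  note d = two_outside_count(3,4)[OF c m r Y, unfolded m5 card_int_interval_numeral]
  have f: "adj y (c 3) \<Longrightarrow> tri y (c 3) (c 4)" "adj y' (c 1) \<Longrightarrow> tri y' (c 1) (c 5)"
    using two_outside_adj[OF assms(1-7)] m5 by simp_all
  have finM: "finite M" unfolding M_def
    by (rule finite_subset[of _ "range c \<times> range c"]) (use cyc_card[OF c] in auto)
  have compl: "adj (c i) (c j)" if "deg y + deg y' \<le> 8" "c i \<noteq> c j" for i j
  proof (rule ccontr)
    assume "\<not> adj (c i) (c j)"
    then have "(c i, c j) \<in> M" using that by (simp add: M_def)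
    then have "0 < card M" using finM card_gt_0_iff by blast
    then show False using cnt that(1) by linarith
  qed
  have A4: "tri (c 2) (c 4) (c 5) \<or> tri (c 5) (c 1) (c 3)" if "deg y + deg y' \<le> 8"
    using two_outside_chords[OF c m r _ _ Y(2) b, of 4] Y(1) m5 compl[OF that, of 2 4] compl[OF that, of 1 3] ne4 by auto
  have A5: "tri (c 5) (c 1) (c 4) \<or> tri (c 1) (c 4) (c 3)" if "deg y + deg y' \<le> 8"
    using two_outside_chords[OF c m r _ _ Y(2) b, of 5] Y(1) m5 compl[OF that, of 2 5] compl[OF that, of 1 4] ne4 by auto
  show False
  proof (cases "adj y (c 3)")
    case True
    then have t: "tri y (c 3) (c 4)" using f by simp
    then have "bk c y 3" using blk_bk[OF c, of y 3] by (simp add: blk_def)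
    then have fr4: "\<not> fr c y' 4" using two_outside_ends(2)[OF c' r Y, of 3] by auto
    have no143: "\<not> tri (c 1) (c 4) (c 3)" using tri_share(3)[OF _ t, of "c 1" "c 4" "c 3"] neq by auto
    show False
    proof (cases "adj y' (c 1)")
      case True
      then have t': "tri y' (c 1) (c 5)" using f by simp
      have "\<not> adj y' (c 4)"
      proof
        assume "adj y' (c 4)"
        then have "tri y' (c 4) (c 5)" using fr4 by (simp add: fr_def)
        from tri_share(2)[OF this t'] show False using neq by auto
      qed
      moreover have "\<not> adj y (c 5)"
      proof
        assume a: "adj y (c 5)"
        have "fr c y' 6" using blk_fr[OF c, of y' 5] c6 triD(2)[OF t'] by (simp add: blk_def)
        then have "\<not> bk c y 5" using two_outside_ends(2)[OF c' r Y, of 5] by auto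
        then have "tri y (c 5) (c 4)" using a by (simp add: bk_def)
        from tri_share(2)[OF this t] show False using neq by auto
      qed
      ultimately have "deg y + deg y' \<le> 8" unfolding d by simp
      then have "tri (c 5) (c 1) (c 4)" using A5 no143 by simp
      from tri_share(1)[OF this t'] show False using neq by auto
    next
      case n1: False
      show False
      proof (cases "adj y' (c 4)")
        case False
        then have "deg y + deg y' \<le> 8" unfolding d using n1 by simp
        then have a: "tri (c 5) (c 1) (c 4)" "tri (c 2) (c 4) (c 5) \<or> tri (c 5) (c 1) (c 3)" using A5 A4 no143 by auto
        show False using a(2)
        proof
          assume "tri (c 2) (c 4) (c 5)"
          from tri_share(3)[OF this a(1)] show False using neq by auto
        next
          assume "tri (c 5) (c 1) (c 3)"
          from tri_share(1)[OF this a(1)] show False using neq by auto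
        qed
      next
        case True
        then have t': "tri y' (c 4) (c 5)" using fr4 by (simp add: fr_def)
        have "\<not> adj y (c 5)"
        proof
          assume a: "adj y (c 5)"
          have "bk c y' 4" using blk_bk[OF c, of y' 4] t' by (simp add: blk_def)
          then have "\<not> fr c y 5" using two_outside_ends(1)[OF c' r Y, of 4] by auto
          then have "tri y (c 5) (c 1)" using a c6 by (simp add: fr_def)
          from tri_share(2)[OF this b(1)] show False using neq by auto
        qed
        then have "deg y + deg y' \<le> 8" unfolding d using n1 by simp
        then have "tri (c 5) (c 1) (c 4)" using A5 no143 by simp
        from tri_share(2)[OF this t'] show False using neq by auto
      qed
    qed
  next
    case n3: False
    then have n1: "\<not> adj y' (c 1)" using n by simp
    then have a: "adj y (c 4)" "adj y (c 5)" "adj y' (c 4)" "adj y' (c 5)"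
      using n3 cnt d by (auto simp: of_bool_def split: if_splits)
    have "\<not> tri y (c 4) (c 3)" using n3 tri_adjs(3) by blast
    moreover have "\<not> tri y (c 5) (c 1)" using tri_share(2)[OF _ b(1), of y "c 5" "c 1"] neq by auto
    ultimately have "blk c y 4" using cyc_k1_insert[OF c' r, of y 4] Y a c6 by (auto simp: bk_def fr_def)
    moreover have "\<not> tri y' (c 4) (c 3)" using tri_share(2)[OF _ b(2), of y' "c 4" "c 3"] neq by auto
    moreover have "\<not> tri y' (c 5) (c 1)" using n1 tri_adjs(3) by blast
    ultimately have "blk c y' 4" using cyc_k1_insert[OF c' r, of y' 4] Y a c6 by (auto simp: bk_def fr_def)
    then show False using \<open>blk c y 4\<close> blk_unique Y(2) by blast
  qed
qed

lemma no_two_outside: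
  assumes c: "cyc m c" and m: "m = int k - 1" and r: "range c \<subseteq> V"
    and Y: "V - range c = {y, y'}" "y \<noteq> y'"
    and b: "tri y (c 1) (c 2)" "tri y' (c 2) (c 3)"
  shows False
proof -
  have "m = 3 \<or> m = 4 \<or> m = 5" using two_outside_small[OF assms] cyc_ge3[OF c] by auto
  then show False
  proof (elim disjE)
    assume m5: "m = 5"
    show False
    proof (cases "adj y' (c 1) \<and> \<not> adj y (c 3)")
      case False
      then show False using two_outside_5[OF assms m5] by blast
    next
      case True
      \<comment> \<open>The reflection exchanges positions 1 and 3, and with them the roles of
        \<open>y\<close> and \<open>y'\<close>.\<close>
      let ?c = "\<lambda>i. c (- i + 4)"
      have "cyc m ?c" using cyc_uminus[OF cyc_shift[OF c, of 4]] by simp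
      moreover have rr: "range ?c = range c"
        using range_uminus[of "\<lambda>i. c (i + 4)"] range_shift[of c 4] by simp
      ultimately show False
        by (intro two_outside_5[of m ?c y' y]) (use m r Y m5 True triD(2)[OF b(1)] triD(2)[OF b(2)] in \<open>auto simp: insert_commute\<close>)
    qed
  qed (use two_outside_3[OF assms] two_outside_4[OF assms] in blast)+
qed

text \<open>The count leaves two outside vertices and more than half of the cycle edges blocked, so
  two consecutive edges are blocked. Different vertices block them, since a common one would lie
  with the middle vertex in two triples. A shift moves the two edges to positions 1 and 2.\<close>

lemma no_cyc_k1:
  assumes c: "cyc (int k - 1) c" and r: "range c \<subseteq> V"
  shows False
proof -
  define m where "m = int k - 1"
  define N where "N = card (V - range c)"
  define \<beta> where "\<beta> = card {i\<in>{0..<m}. \<exists>y\<in>V - range c. blk c y i}"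
  define S where "S = int (\<Sum>y\<in>V - range c. deg y)"
  have km: "int (k - 1) = m" using k4 m_def by simp
  have m3: "3 \<le> m" using k4 m_def by simp
  have cm: "cyc m c" using c m_def by simp
  note C = cyc_k1_count[OF c r, folded m_def N_def S_def, folded \<beta>_def, unfolded km]
  have mu: "int (E2 (range c)) \<le> m * (m - 1)"
  proof -
    have "int (E2 (range c)) \<le> int (card (range c) * (card (range c) - 1))"
      using E2_le[OF cyc_card(1)[OF c]] by (simp only: of_nat_le_iff)
    then show ?thesis using cyc_card(2)[OF cm] m3 by (simp add: of_nat_diff)
  qed
  have b: "int \<beta> \<le> m" using C(2) km by linarith
  have s1: "m * int N + m < 2 * S" using C(3) mu by (simp add: algebra_simps)
  have s2: "2 * S \<le> m * int N + (4 - int N) * int \<beta>" using C(4) by (simp add: mult.commute)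
  have "N = 2"
  proof (rule ccontr)
    assume "N \<noteq> 2"
    then consider "N = 3" | "4 \<le> N" using C(1) by linarith
    then show False
    proof cases
      case 1
      then show ?thesis using s1 s2 b by simp
    next
      case 2
      then have "(4 - int N) * int \<beta> \<le> 0" by (intro mult_nonpos_nonneg) auto
      then show ?thesis using s1 s2 m3 by linarith
    qed
  qed
  then obtain y y' where Y: "V - range c = {y, y'}" "y \<noteq> y'" unfolding N_def by (meson card_2_iff)
  define P where "P i \<longleftrightarrow> (\<exists>y\<in>V - range c. blk c y i)" for i
  have b2: "m < 2 * int \<beta>" using s1 s2 \<open>N = 2\<close> by simp
  have "\<exists>i. P i \<and> P (i + 1)"
  proof (rule ccontr)
    assume n: "\<nexists>i. P i \<and> P (i + 1)"
    have per: "P (i + m) = P i" for i unfolding P_def using cyc_periodic(3)[OF cm] by simp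
    have "card {i\<in>{0..<m}. P (i + 1)} = \<beta>"
      using card_periodic_shift[of P m 1, OF per] m3 unfolding \<beta>_def P_def by simp
    moreover have "card {i\<in>{0..<m}. P i} = \<beta>" unfolding \<beta>_def P_def ..
    moreover have "{i\<in>{0..<m}. P (i + 1)} \<inter> {i\<in>{0..<m}. P i} = {}" using n by auto
    ultimately have "card ({i\<in>{0..<m}. P (i + 1)} \<union> {i\<in>{0..<m}. P i}) = 2 * \<beta>"
      by (simp add: card_Un_disjoint)
    moreover have "card ({i\<in>{0..<m}. P (i + 1)} \<union> {i\<in>{0..<m}. P i}) \<le> card {0..<m}"
      by (rule card_mono) auto
    ultimately show False using b2 m3 by simp
  qed
  then obtain i z z' where z: "z \<in> {y,y'}" "z' \<in> {y,y'}" "tri z (c i) (c (i+1))" "tri z' (c (i+1)) (c (i+2))"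
    unfolding P_def Y blk_def by (auto simp: add.assoc)
  have "z \<noteq> z'"
  proof
    assume "z = z'"
    then have "c i = c (i + 2)" using z(3,4) triD(2)[OF z(3)] tri_unique by blast
    then show False using cyc_neq[OF cm, of i "i+2"] m3 by simp
  qed
  then have Y': "V - range c = {z, z'}" using Y z by auto
  let ?c = "\<lambda>j. c (j + (i - 1))"
  show False
  proof (rule no_two_outside[of m ?c z z'])
    show "cyc m ?c" by (rule cyc_shift[OF cm])
    show "V - range ?c = {z, z'}" using Y' range_shift[of c "i - 1"] by simp
    show "range ?c \<subseteq> V" using r range_shift[of c "i - 1"] by simp
  qed (use z \<open>z \<noteq> z'\<close> m_def in \<open>simp_all add: add.commute\<close>)
qed

subsection \<open>No cycle on k - 2 vertices\<close>

lemma cyc_k2_insert: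
  assumes c: "cyc (int k - 2) c" and r: "range c \<subseteq> V"
    and y: "y \<in> V - range c" "bk c y i" "fr c y (i + 1)"
  shows "blk c y i"
proof (rule ccontr)
  assume "\<not> blk c y i"
  then obtain c' where c': "cyc (int k - 1) c'" "range c' = insert y (range c)"
    using cyc_insert[OF c, of y i] y by auto
  have "range c' \<subseteq> V" unfolding c'(2) using r y(1) by blast
  then show False by (rule no_cyc_k1[OF c'(1)])
qed

text \<open>The outside edge replaces either the cycle edge after \<open>c i\<close> or the vertex
  \<open>c (i + 1)\<close>; this gives a cycle on \<open>k\<close> or on \<open>k - 1\<close>
  vertices.\<close>

lemma no_cyc_edge_detour:
  assumes c: "cyc q c" and q: "q = int k - 2" and r: "range c \<subseteq> V"
    and x: "x \<in> V - range c" "y \<in> V - range c" "adj x y" "bk c x i" "fr c y j"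
    and j: "j = i + 1 \<or> j = i + 2"
    and t: "\<not> tri x y (c i)" "\<not> tri x y (c j)"
  shows False
proof -
  have q3: "3 \<le> q" using cyc_ge3[OF c] .
  let ?xs = "[x, y] @ map c [j..i+q]"
  have xy: "x \<noteq> y" using x adj_irrefl by auto
  have cq: "c (i + q) = c i" "c (i + q - 1) = c (i - 1)"
    using cycD(1)[OF c, of i] cycD(1)[OF c, of "i-1"] by (simp_all add: algebra_simps)
  have f: "adj x (c i)" "\<not> tri x (c i) (c (i - 1))" "adj y (c j)" "\<not> tri y (c j) (c (j + 1))"
    using x unfolding bk_def fr_def by auto
  have w: "walk ?xs" using f q3 j x t xy cyc_walk[OF c, of j "i+q"]
    by (auto simp: walk_simps)
  have d: "distinct (map c [j..i+q])" by (rule cyc_distinct_map[OF c, of _ j "i+q"]) (use j q3 in auto)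
  then have d: "distinct ?xs" using x xy by auto
  have "\<not> tri (c (i - 1)) (c i) x" "\<not> tri (c i) x y" "adj (c i) x"
    using f t triD by (blast intro: adj_sym)+
  moreover have "last ?xs = c i" "last (butlast ?xs) = c (i - 1)" using j q3 cq by (auto simp: butlast_append)
  ultimately have "\<exists>c'. cyc (int (length ?xs)) c' \<and> range c' = set ?xs"
    using d w q3 j by (intro cycI) auto
  moreover have "set ?xs \<subseteq> V" using x r by auto
  moreover have "int (length ?xs) = int k \<or> int (length ?xs) = int k - 1" using j q3 q by auto
  ultimately show False using no_cyc_k no_cyc_k1 by metis
qed

section \<open>Edges off a cycle on k - 2 vertices\<close>

lemma deg_ge_3:
  assumes c: "cyc (int k - 2) c" and u: "u \<in> V"
  shows "3 \<le> deg u"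
  using deg_gt[OF u] cyc_ge3[OF c] by auto

text \<open>The vertex \<open>w\<close> and the third vertex of the edge \<open>u w\<close> account
  for only two neighbours.\<close>

lemma third_nb:
  assumes "3 \<le> deg u"
  shows "\<exists>v\<in>V. adj u v \<and> v \<noteq> w \<and> \<not> tri u w v"
proof (rule ccontr)
  assume n: "\<not> ?thesis"
  then have n': "tri u w v" if "v \<in> nb V u" "v \<noteq> w" for v using that by (auto simp: nb_def)
  have "\<exists>z. nb V u \<subseteq> {w, z}"
  proof (cases "\<exists>z\<in>nb V u. z \<noteq> w")
    case True
    then obtain z where "z \<in> nb V u" "z \<noteq> w" by auto
    then have "nb V u \<subseteq> {w, z}" using n' tri_unique by blast
    then show ?thesis by blast
  qed auto
  then obtain z where "nb V u \<subseteq> {w, z}" by auto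
  then have "card (nb V u) \<le> card {w, z}" by (rule card_mono[rotated]) simp
  also have "\<dots> \<le> 2" by (simp add: card_insert_le_m1)
  finally show False using assms by simp
qed

lemma three_path:
  assumes c: "cyc (int k - 2) c" and r: "range c \<subseteq> V"
    and Y: "u \<in> V - range c" "w \<in> V - range c" "v \<in> V - range c"
    and a: "adj u w" "adj v u" "v \<noteq> w" "adj w (c i)" "\<not> tri u w (c i)"
  shows "tri v u w"
proof (rule ccontr)
  assume "\<not> tri v u w"
  then have "int (length [v, u, w]) + (int k - 2) \<le> int k"
    using assms adj_irrefl by (intro attach_to_cyc[OF c r]) auto
  then show False by simp
qed

text \<open>A gate of an outside edge is an attachment of one of its ends to the cycle that does not
  complete the edge to a triple. By degree, \<open>u\<close> has a neighbour beyond \<open>w\<close>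
  and the third vertex of \<open>u w\<close>; off the cycle it would be forced into that triple by
  \<open>three_path\<close>.\<close>

lemma gate_swap:
  assumes c: "cyc (int k - 2) c" and r: "range c \<subseteq> V"
    and Y: "u \<in> V - range c" "w \<in> V - range c"
    and a: "adj u w" "adj w (c i)" "\<not> tri u w (c i)"
  shows "\<exists>j. adj u (c j) \<and> \<not> tri u w (c j)"
proof -
  obtain v where v: "v \<in> V" "adj u v" "v \<noteq> w" "\<not> tri u w v"
    using third_nb[OF deg_ge_3[OF c], of u w] Y by auto
  have "v \<in> range c"
  proof (rule ccontr)
    assume "v \<notin> range c"
    then have "tri v u w" using three_path[OF c r Y _ a(1) _ v(3) a(2,3)] v(1,2) adj_sym by blast
    then show False using v(4) triD(3) by blast
  qed
  then show ?thesis using v by auto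
qed

text \<open>If every attachment of \<open>w\<close> completed \<open>u w\<close> to a triple, the
  extra neighbour \<open>v\<close> of \<open>w\<close> would be off the cycle.
  \<open>gate_swap\<close> for the edge \<open>v w\<close> gives \<open>v\<close> a gate, and
  \<open>three_path\<close> then forces the triple that \<open>third_nb\<close> excluded.\<close>

lemma gate_of_nb:
  assumes c: "cyc (int k - 2) c" and r: "range c \<subseteq> V"
    and Y: "u \<in> V - range c" "w \<in> V - range c"
    and a: "adj u w" "adj w (c i)"
  shows "\<exists>j. adj w (c j) \<and> \<not> tri u w (c j)"
proof (rule ccontr)
  assume n: "\<not> ?thesis"
  then have t: "tri u w (c i)" using a by blast
  obtain v where v: "v \<in> V" "adj w v" "v \<noteq> u" "\<not> tri w u v"
    using third_nb[OF deg_ge_3[OF c], of w u] Y by auto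
  have vY: "v \<in> V - range c" using n v triD(1) by blast
  have "\<not> tri v w (c i)" using tri_unique1[OF t] v(3) by blast
  then obtain j where j: "adj v (c j)" "\<not> tri v w (c j)"
    using gate_swap[OF c r vY Y(2) _ a(2)] v(2) adj_sym by blast
  then have "tri u w v"
    using three_path[OF c r Y(2) vY Y(1) v(2) a(1) v(3)[symmetric] j(1)] triD(1) by blast
  then show False using v(4) triD(1) by blast
qed

text \<open>The set \<open>A\<close> collects the counterexamples. An edge leaving it, supplied by
  connectivity, leads to an outside vertex with a gate, and \<open>gate_swap\<close> carries a gate
  back into \<open>A\<close>.\<close>

lemma gate:
  assumes c: "cyc (int k - 2) c" and r: "range c \<subseteq> V"
    and Y: "u \<in> V - range c" "w \<in> V - range c" and a: "adj u w"
  shows "\<exists>j. adj w (c j) \<and> \<not> tri u w (c j)"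
proof -
  define A where "A = {x\<in>V - range c. (\<exists>z\<in>V - range c. adj x z) \<and> \<not> (\<exists>i. adj x (c i))}"
  have "A = {}"
  proof (rule ccontr)
    assume "A \<noteq> {}"
    moreover have "c 0 \<in> V" "c 0 \<notin> A" using r by (auto simp: A_def)
    then have "A \<subset> V" unfolding A_def by blast
    ultimately obtain x z where xz: "x \<in> A" "z \<in> V" "z \<notin> A" "adj x z" using connected[of A] by blast
    have xY: "x \<in> V - range c" and nx: "\<not> adj x (c i)" for i using xz(1) by (auto simp: A_def)
    have zY: "z \<in> V - range c" using xz nx by auto
    then obtain i where "adj z (c i)" using xz(3,4) xY adj_sym unfolding A_def by blast
    then obtain j where "adj z (c j)" "\<not> tri x z (c j)"
      using gate_of_nb[OF c r xY zY xz(4)] by blast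
    then show False using gate_swap[OF c r xY zY xz(4)] nx by blast
  qed
  then have "\<exists>i. adj w (c i)" using Y a adj_sym unfolding A_def by blast
  then show ?thesis using gate_of_nb[OF c r Y a] by blast
qed

text \<open>
  A position of the cycle joined to two vertices of the clique \<open>K\<close> forces its two neighbouring positions
  to be joined to none, which balances the count.
\<close>

lemma clique_attach_bound:
  assumes c: "cyc q c" and q: "q = int k - 2" and r: "range c \<subseteq> V"
    and K: "finite K" "K \<subseteq> V - range c" "\<And>x y. x \<in> K \<Longrightarrow> y \<in> K \<Longrightarrow> x \<noteq> y \<Longrightarrow> adj x y"
    and tg: "\<And>x y i. x \<in> K \<Longrightarrow> y \<in> K \<Longrightarrow> good i \<Longrightarrow> \<not> tri x y (c i)"
    and per: "\<And>i. good (i + q) = good i"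
    and bad: "\<And>x i. x \<in> K \<Longrightarrow> \<not> good i \<Longrightarrow> bk c x i \<and> fr c x i \<and> \<not> blk c x i \<and> \<not> blk c x (i - 1)"
  defines "a \<equiv> \<lambda>x i. adj x (c i) \<and> good i"
  defines "H \<equiv> {i\<in>{0..<q}. 2 \<le> card {x\<in>K. a x i}}"
  shows "(\<Sum>x\<in>K. card {i\<in>{0..<q}. a x i}) + 3 * card H + card {i\<in>{0..<q}. \<not> good i} \<le> card K * card H + nat q"
proof -
  have q3: "3 \<le> q" using cyc_ge3[OF c] .
  have c2: "cyc (int k - 2) c" using c q by simp
  have KY: "x \<in> V - range c" if "x \<in> K" for x using that K(2) by blast
  have yn: "x \<noteq> c i" "c i \<noteq> x" if "x \<in> K" for x i using KY[OF that] by auto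
  have C: False if "x \<in> K" "y \<in> K" "x \<noteq> y" "bk c x i" "fr c y j" "j = i + 1 \<or> j = i + 2" "\<not> tri x y (c i)" "\<not> tri x y (c j)" for x y i j
    using no_cyc_edge_detour[OF c q r KY[OF that(1)] KY[OF that(2)] K(3)[OF that(1-3)] that(4-8)] .
  have e1: "i - 1 + 1 = i" "i - 1 + 2 = i + 1" "i + 1 + 1 = i + 2" for i :: int by simp_all
  \<comment> \<open>With such a triple, \<open>x\<close> could enter one step away and form a detour
    with \<open>y\<close>. If the entry of \<open>y\<close> at \<open>i\<close> is blocked too, it
    moves one step to the opposite side, and the detour still skips only one vertex.\<close>
  have free: "\<not> tri x (c i) (c (i+1)) \<and> \<not> tri x (c i) (c (i-1))" if xy: "x \<in> K" "y \<in> K" "x \<noteq> y" "a x i" "a y i" for x y i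
  proof (intro conjI notI)
    have g: "good i" "adj y (c i)" using xy by (auto simp: a_def)
    have tyx: "\<not> tri y x (c i)" "\<not> tri x y (c i)" using tg xy g by auto
    {
      assume t: "tri x (c i) (c (i+1))"
      then have f: "fr c x (i+1)" using blk_fr[OF c] unfolding blk_def by blast
      have n1: "\<not> tri y x (c (i+1))" using tri_share(2)[OF _ t, of y x "c (i+1)"] tri_share(3)[OF _ t, of y x "c (i+1)"] xy yn by auto
      show False
      proof (cases "bk c y i")
        case True
        show False by (rule C[of y x i "i+1"]) (use xy True f n1 tyx in auto)
      next
        case False
        then have t2: "tri y (c i) (c (i-1))" using g by (auto simp: bk_def)
        then have "blk c y (i-1)" unfolding blk_def using triD(2) e1 by metis
        then have b: "bk c y (i-1)" using blk_bk[OF c] by blast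
        have n2: "\<not> tri y x (c (i-1))" using tri_share(2)[OF _ t2, of y x "c (i-1)"] xy yn by auto
        show False by (rule C[of y x "i-1" "i+1"]) (use xy b f n1 n2 in auto)
      qed
    }
    {
      assume t: "tri x (c i) (c (i-1))"
      then have "blk c x (i-1)" unfolding blk_def using triD(2) e1 by metis
      then have b: "bk c x (i-1)" using blk_bk[OF c] by blast
      have n1: "\<not> tri x y (c (i-1))" using tri_share(2)[OF _ t, of x y "c (i-1)"] xy yn by auto
      show False
      proof (cases "fr c y i")
        case True
        show False by (rule C[of x y "i-1" i]) (use xy True b n1 tyx in auto)
      next
        case False
        then have t2: "tri y (c i) (c (i+1))" using g by (auto simp: fr_def)
        then have f: "fr c y (i+1)" using blk_fr[OF c] unfolding blk_def by blast
        have n2: "\<not> tri x y (c (i+1))" using tri_share(3)[OF _ t2, of x y "c (i+1)"] xy yn by auto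
        show False by (rule C[of x y "i-1" "i+1"]) (use xy b f n1 n2 in auto)
      qed
    }
  qed
  define h where "h i \<longleftrightarrow> 2 \<le> card {x\<in>K. a x i}" for i
  have hE: "\<exists>x y. x \<in> K \<and> y \<in> K \<and> x \<noteq> y \<and> a x i \<and> a y i" if "h i" for i
  proof (rule ccontr)
    assume n: "\<not> ?thesis"
    then have "card {x\<in>K. a x i} \<le> Suc 0" using K(1) by (subst card_le_Suc0_iff_eq) auto
    then show False using that unfolding h_def by simp
  qed
  have hO: "\<exists>x\<in>K. x \<noteq> v \<and> bk c x i \<and> fr c x i \<and> good i" if hi: "h i" for i v
  proof -
    obtain x y where xy: "x \<in> K" "y \<in> K" "x \<noteq> y" "a x i" "a y i" using hE[OF hi] by blast
    have "bk c x i \<and> fr c x i \<and> good i" "bk c y i \<and> fr c y i \<and> good i"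
      using free[OF xy] free[OF xy(2,1) xy(3)[symmetric] xy(5,4)] xy(4,5) by (auto simp: a_def bk_def fr_def)
    then show ?thesis using xy(1-3) by (cases "x = v") auto
  qed
  have zp: "\<not> a v (i+1)" if hv: "h i" "v \<in> K" for i v
  proof
    assume av: "a v (i+1)"
    obtain x where x: "x \<in> K" "x \<noteq> v" "bk c x i" "good i" using hO[OF hv(1)] by blast
    have g: "\<not> tri x v (c i)" "\<not> tri x v (c (i+1))" using tg x hv av by (auto simp: a_def)
    show False
    proof (cases "fr c v (i+1)")
      case True
      show False by (rule C[of x v i "i+1"]) (use x hv True g in auto)
    next
      case False
      then have t2: "tri v (c (i+1)) (c (i+2))" using av by (auto simp: fr_def a_def e1)
      then have f: "fr c v (i+2)" using blk_fr[OF c, of v "i+1"] unfolding blk_def by (simp add: e1)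
      have n2: "\<not> tri x v (c (i+2))" using tri_share(3)[OF _ t2, of x v "c (i+2)"] x hv yn by auto
      show False by (rule C[of x v i "i+2"]) (use x hv f g n2 in auto)
    qed
  qed
  have zm: "\<not> a v (i-1)" if hv: "h i" "v \<in> K" for i v
  proof
    assume av: "a v (i-1)"
    obtain x where x: "x \<in> K" "x \<noteq> v" "fr c x i" "good i" using hO[OF hv(1)] by blast
    have g: "\<not> tri v x (c i)" "\<not> tri v x (c (i-1))" using tg x hv av by (auto simp: a_def)
    show False
    proof (cases "bk c v (i-1)")
      case True
      show False by (rule C[of v x "i-1" i]) (use x hv True g in auto)
    next
      case False
      then have t2: "tri v (c (i-1)) (c (i-2))" using av by (auto simp: bk_def a_def)
      have "i - 2 + 1 = i - 1" by simp
      then have "blk c v (i-2)" unfolding blk_def using triD(2)[OF t2] by metis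
      then have f: "bk c v (i-2)" using blk_bk[OF c] by blast
      have n2: "\<not> tri v x (c (i-2))" using tri_share(2)[OF _ t2, of v x "c (i-2)"] x hv yn by auto
      show False by (rule C[of v x "i-2" i]) (use x hv f g n2 in auto)
    qed
  qed
  have h2: "\<not> (h (i-1) \<and> h (i+1))" for i
  proof
    assume hh: "h (i-1) \<and> h (i+1)"
    obtain x where x: "x \<in> K" "bk c x (i-1)" "good (i-1)" using hO[of "i-1"] hh by blast
    obtain y where y: "y \<in> K" "y \<noteq> x" "fr c y (i+1)" "good (i+1)" using hO[of "i+1" x] hh by blast
    show False by (rule C[of x y "i-1" "i+1"]) (use x y tg in auto)
  qed
  have hb: "good i" if "h (i-1) \<or> h (i+1)" for i
  proof (rule ccontr)
    assume ng: "\<not> good i"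
    from that show False
    proof
      assume "h (i-1)"
      then obtain x where x: "x \<in> K" "bk c x (i-1)" using hO by blast
      then have "blk c x (i-1)" using cyc_k2_insert[OF c2 r KY, of x "i-1"] bad[OF x(1) ng] by simp
      then show False using bad[OF x(1) ng] by simp
    next
      assume "h (i+1)"
      then obtain x where x: "x \<in> K" "fr c x (i+1)" using hO by blast
      then have "blk c x i" using cyc_k2_insert[OF c2 r KY, of x i] bad[OF x(1) ng] by simp
      then show False using bad[OF x(1) ng] by simp
    qed
  qed
  have aper: "a x (i + q) = a x i" for x i using cycD(1)[OF c] per by (simp add: a_def)
  then have hper: "h (i + q) = h i" for i unfolding h_def by simp
  let ?I = "{0..<q}"
  let ?Z = "{i\<in>?I. {x\<in>K. a x i} = {}}"
  have "card {i\<in>?I. h (i + 1)} = card H" "card {i\<in>?I. h (i + (-1))} = card H"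
    using card_periodic_shift[of h q 1, OF hper] card_periodic_shift[of h q "-1", OF hper] q3
    unfolding H_def h_def[symmetric] by simp_all
  moreover have "{i\<in>?I. h (i + 1)} \<inter> {i\<in>?I. h (i + (-1))} = {}" using h2 by auto
  moreover have "({i\<in>?I. h (i + 1)} \<union> {i\<in>?I. h (i + (-1))}) \<inter> {i\<in>?I. \<not> good i} = {}" using hb by auto
  ultimately have "card ({i\<in>?I. h (i + 1)} \<union> {i\<in>?I. h (i + (-1))} \<union> {i\<in>?I. \<not> good i}) = 2 * card H + card {i\<in>?I. \<not> good i}"
    by (simp add: card_Un_disjoint)
  moreover have "{i\<in>?I. h (i + 1)} \<union> {i\<in>?I. h (i + (-1))} \<union> {i\<in>?I. \<not> good i} \<subseteq> ?Z"
  proof -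
    have "{x\<in>K. a x i} = {}" if "h (i + 1)" for i using zm[OF that] by auto
    moreover have "{x\<in>K. a x i} = {}" if "h (i - 1)" for i using zp[OF that] by auto
    moreover have "{x\<in>K. a x i} = {}" if "\<not> good i" for i using that by (auto simp: a_def)
    ultimately show ?thesis by auto
  qed
  ultimately have Z: "2 * card H + card {i\<in>?I. \<not> good i} \<le> card ?Z"
    using card_mono[of ?Z "{i\<in>?I. h (i + 1)} \<union> {i\<in>?I. h (i + (-1))} \<union> {i\<in>?I. \<not> good i}"] by simp
  have "(\<Sum>x\<in>K. card {i\<in>?I. a x i}) = (\<Sum>i\<in>?I. card {x\<in>K. a x i})"
    by (rule sum_card_swap) (use K in auto)
  \<comment> \<open>A shared position contributes at most \<open>card K\<close>, any other at most
    1, an empty one 0. By \<open>h2\<close> the empty neighbours of different shared positions are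
    distinct, so at least \<open>2 * card H\<close> positions are empty besides the bad
    ones.\<close>
  moreover have "(\<Sum>i\<in>?I. card {x\<in>K. a x i} + of_bool ({x\<in>K. a x i} = {}) + of_bool (h i)) \<le> (\<Sum>i\<in>?I. card K * of_bool (h i) + 1)"
  proof (rule sum_mono)
    fix i
    have "card {x\<in>K. a x i} \<le> card K" using K(1) by (auto intro: card_mono)
    moreover have "card {x\<in>K. a x i} = 0 \<longleftrightarrow> {x\<in>K. a x i} = {}" by (rule card_0_eq) (use K(1) in simp)
    ultimately show "card {x\<in>K. a x i} + of_bool ({x\<in>K. a x i} = {}) + of_bool (h i) \<le> card K * of_bool (h i) + 1"
      unfolding h_def by (cases "card {x\<in>K. a x i} = 0"; cases "card {x\<in>K. a x i} \<ge> 2") (auto simp del: Collect_empty_eq)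
  qed
  moreover have "(\<Sum>i\<in>?I. of_bool ({x\<in>K. a x i} = {})) = card ?Z" by (simp add: Int_def)
  moreover have "(\<Sum>i\<in>?I. of_bool (h i)) = card H" by (simp add: Int_def H_def h_def)
  moreover have "(\<Sum>i\<in>?I. card K * of_bool (h i) + 1) = card K * card H + nat q"
  proof -
    have "(\<Sum>i\<in>?I. card K * of_bool (h i) + 1) = card K * (\<Sum>i\<in>?I. of_bool (h i)) + nat q"
      unfolding sum.distrib sum_distrib_left by simp
    then show ?thesis using calculation(4) by simp
  qed
  ultimately show ?thesis using Z unfolding sum.distrib by linarith
qed

text \<open>By \<open>gate\<close> and \<open>three_path\<close>, a second outside neighbour of
  \<open>u\<close> completes \<open>u w\<close> to a triple. So the components off the cycle are
  single vertices, edges and triples.\<close>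

lemma nb_outside:
  assumes c: "cyc (int k - 2) c" and r: "range c \<subseteq> V"
    and Y: "u \<in> V - range c" "w \<in> V - range c" and a: "adj u w"
  shows "nb (V - range c) u = insert w {z\<in>V - range c. tri u w z}"
proof (intro equalityI subsetI)
  fix v assume v: "v \<in> nb (V - range c) u"
  obtain i where i: "adj w (c i)" "\<not> tri u w (c i)" using gate[OF c r Y a] by blast
  have "v \<noteq> w \<Longrightarrow> tri v u w"
    using three_path[OF c r Y _ a _ _ i] v adj_sym by (auto simp: nb_def)
  then show "v \<in> insert w {z\<in>V - range c. tri u w z}" using v triD(3) by (auto simp: nb_def)
next
  fix v assume "v \<in> insert w {z\<in>V - range c. tri u w z}"
  then show "v \<in> nb (V - range c) u" using Y a tri_adjs(3) by (auto simp: nb_def)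
qed

lemma deg_split:
  assumes c: "cyc q c" and r: "range c \<subseteq> V"
  shows "deg u = card {i\<in>{0..<q}. adj u (c i)} + card (nb (V - range c) u)"
proof -
  have "V = range c \<union> (V - range c)" using r by blast
  then show ?thesis using nb_Un_card[of "range c" "V - range c" u] finV cyc_card(1)[OF c] card_nb_cyc[OF c] by simp
qed

text \<open>The clique bound allows at most \<open>q\<close> attachments of an outside edge in no
  triple, or of a triple off the cycle, too few for the degree bounds. In the remaining case the
  third vertex \<open>c \<zeta>\<close> lies on the cycle and both bounds meet, so every other
  position is joined to exactly one end.\<close>

lemma pair_struct:
  assumes c: "cyc q c" and q: "q = int k - 2" and r: "range c \<subseteq> V"
    and Y: "u \<in> V - range c" "w \<in> V - range c" and a: "adj u w"
  shows "\<exists>\<zeta>. tri u w (c \<zeta>) \<and> (\<forall>i. c i \<noteq> c \<zeta> \<longrightarrow> (adj u (c i) \<longleftrightarrow> \<not> adj w (c i)))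
    \<and> nb (V - range c) u = {w} \<and> card (nb (range c) u) + card (nb (range c) w) = nat q + 1"
proof -
  have c2: "cyc (int k - 2) c" using c q by simp
  have q3: "3 \<le> q" using cyc_ge3[OF c] .
  have kq: "int (k - 1) = q + 1" using q k4 by simp
  have uw: "u \<noteq> w" "adj w u" using a adj_irrefl adj_sym by auto
  have cV: "c i \<in> V" for i using r by auto
  let ?I = "{0..<q}"
  let ?d = "\<lambda>x. card {i\<in>?I. adj x (c i)}"
  consider (A) "\<And>z. z \<in> V \<Longrightarrow> \<not> tri u w z" | (B) z where "z \<in> V - range c" "tri u w z" | (C) \<zeta> where "tri u w (c \<zeta>)"
    by blast
  then show ?thesis
  proof cases
    case A
    have "(\<Sum>x\<in>{u,w}. card {i\<in>?I. adj x (c i) \<and> True}) + 3 * card {i\<in>?I. 2 \<le> card {x\<in>{u,w}. adj x (c i) \<and> True}} + card {i\<in>?I. \<not> True}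
       \<le> card {u,w} * card {i\<in>?I. 2 \<le> card {x\<in>{u,w}. adj x (c i) \<and> True}} + nat q"
    proof (rule clique_attach_bound[OF c q r, where good = "\<lambda>_. True"])
      show "\<And>x y i. x \<in> {u, w} \<Longrightarrow> y \<in> {u, w} \<Longrightarrow> True \<Longrightarrow> \<not> tri x y (c i)"
        using A[OF cV] triD(1) tri_neq(1) by blast
    qed (use Y uw a in auto)
    then have le: "?d u + ?d w \<le> nat q" using uw by simp
    have "nb (V - range c) u = {w}" "nb (V - range c) w = {u}"
      unfolding nb_outside[OF c2 r Y a] nb_outside[OF c2 r Y(2,1) uw(2)] using A triD(1) by blast+
    then have "deg u = ?d u + 1" "deg w = ?d w + 1"
      using deg_split[OF c r] by simp_all
    then show ?thesis using deg_pair_gt[of u w] Y uw a le kq q3 by simp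
  next
    case B
    note ad = tri_adjs[OF B(2)]
    note ne = tri_neq[OF B(2)]
    have only: "\<not> tri u w (c i)" "\<not> tri u z (c i)" "\<not> tri w z (c i)" for i
      using tri_unique[OF B(2), of "c i"] tri_unique[OF triD(2)[OF B(2)], of "c i"] tri_unique[OF triD(3)[OF B(2)], of "c i"] B(1) Y by blast+
    have "(\<Sum>x\<in>{u,w,z}. card {i\<in>?I. adj x (c i) \<and> True}) + 3 * card {i\<in>?I. 2 \<le> card {x\<in>{u,w,z}. adj x (c i) \<and> True}} + card {i\<in>?I. \<not> True}
       \<le> card {u,w,z} * card {i\<in>?I. 2 \<le> card {x\<in>{u,w,z}. adj x (c i) \<and> True}} + nat q"
    proof (rule clique_attach_bound[OF c q r, where good = "\<lambda>_. True"])
      show "\<And>x y i. x \<in> {u, w, z} \<Longrightarrow> y \<in> {u, w, z} \<Longrightarrow> True \<Longrightarrow> \<not> tri x y (c i)"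
        using only triD(1)[of w u] triD(1)[of z u] triD(1)[of z w] tri_neq(1) by blast
    qed (use Y B ad in auto)
    then have le: "?d u + ?d w + ?d z \<le> nat q" using ne by simp
    have s: "insert y' {z\<in>V - range c. tri x y' z} = {y', z'}" if "tri x y' z'" "z' \<in> V - range c" for x y' z'
      using that(2) tri_unique[OF that(1)] that(1) by blast
    have "deg u = ?d u + 2" "deg w = ?d w + 2" "deg z = ?d z + 2"
      using deg_split[OF c r, of u] nb_outside[OF c2 r Y a] s[OF B(2,1)]
        deg_split[OF c r, of w] nb_outside[OF c2 r Y(2,1) uw(2)] s[OF triD(1)[OF B(2)] B(1)]
        deg_split[OF c r, of z] nb_outside[OF c2 r B(1) Y(1) ad(4)] s[OF triD(4)[OF B(2)] Y(2)] ne
      by simp_all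
    then show ?thesis using deg_triangle_gt[of u w z] Y B ad le kq q3 by simp
  next
    case C
    have adC: "adj u (c \<zeta>)" "adj w (c \<zeta>)" using tri_adjs[OF C] by auto
    have only: "tri u w (c i) \<longleftrightarrow> c i = c \<zeta>" for i using C tri_unique[OF C, of "c i"] by metis
    \<comment> \<open>The vertex \<open>c \<zeta>\<close> is joined to both ends without permitting
      a detour, because they form a triple; its position is therefore taken out of the
      count.\<close>
    let ?g = "\<lambda>i. c i \<noteq> c \<zeta>"
    let ?a = "\<lambda>x. card {i\<in>?I. adj x (c i) \<and> ?g i}"
    let ?H = "{i\<in>?I. 2 \<le> card {x\<in>{u,w}. adj x (c i) \<and> ?g i}}"
    have "(\<Sum>x\<in>{u,w}. ?a x) + 3 * card ?H + card {i\<in>?I. \<not> ?g i} \<le> card {u,w} * card ?H + nat q"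
    proof (rule clique_attach_bound[OF c q r])
      show "\<And>x y i. x \<in> {u, w} \<Longrightarrow> y \<in> {u, w} \<Longrightarrow> c i \<noteq> c \<zeta> \<Longrightarrow> \<not> tri x y (c i)"
        using only triD(1)[of w u] tri_neq(1) by blast
      show "bk c x i \<and> fr c x i \<and> \<not> blk c x i \<and> \<not> blk c x (i - 1)" if "x \<in> {u, w}" "\<not> c i \<noteq> c \<zeta>" for x i
      proof -
        obtain x' where x': "x' \<in> {u,w}" "tri x x' (c i)" using C triD(1)[OF C] \<open>x \<in> {u, w}\<close> \<open>\<not> c i \<noteq> c \<zeta>\<close> by auto
        have "\<not> tri x (c i) (c j)" for j using tri_unique[OF triD(2)[OF x'(2)]] x'(1) Y by auto
        moreover from this have "\<not> tri x (c j) (c i)" for j using triD(2) by blast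
        moreover have "i - 1 + 1 = i" by simp
        ultimately show ?thesis using tri_adjs(3)[OF x'(2)] unfolding bk_def fr_def blk_def by metis
      qed
    qed (use Y uw a cycD(1)[OF c] in auto)
    moreover have zI: "{i\<in>?I. \<not> ?g i} = {\<zeta> mod q}"
    proof (intro set_eqI)
      fix i
      have "i mod q = i" if "i \<in> ?I" using that by simp
      moreover have "\<zeta> mod q \<in> ?I" using q3 by simp
      ultimately show "i \<in> {i\<in>?I. \<not> ?g i} \<longleftrightarrow> i \<in> {\<zeta> mod q}"
        using cyc_eq_iff[OF c, of i \<zeta>] cyc_mod[OF c, of \<zeta>] by (cases "i \<in> ?I") auto
    qed
    ultimately have le: "?a u + ?a w + card ?H + 1 \<le> nat q" using uw by simp
    have ds: "?d x = ?a x + 1" if "x \<in> {u,w}" for x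
    proof -
      have "{i\<in>?I. adj x (c i)} = insert (\<zeta> mod q) {i\<in>?I. adj x (c i) \<and> ?g i}"
      proof -
        have zi: "i \<in> ?I \<and> c i = c \<zeta> \<longleftrightarrow> i = \<zeta> mod q" for i
        proof -
          have "i \<in> {i\<in>?I. \<not> ?g i} \<longleftrightarrow> i \<in> {\<zeta> mod q}" unfolding zI ..
          then show ?thesis by simp
        qed
        have ax: "adj x (c \<zeta>)" using \<open>x \<in> {u, w}\<close> adC by auto
        show ?thesis
        proof (intro set_eqI)
          fix i show "i \<in> {i\<in>?I. adj x (c i)} \<longleftrightarrow> i \<in> insert (\<zeta> mod q) {i\<in>?I. adj x (c i) \<and> ?g i}"
            using zi[of i] ax by (cases "c i = c \<zeta>") auto
        qed
      qed
      then show ?thesis using cyc_mod[OF c, of \<zeta>] by simp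
    qed
    have nbs: "nb (V - range c) u = {w}" "nb (V - range c) w = {u}"
      unfolding nb_outside[OF c2 r Y a] nb_outside[OF c2 r Y(2,1) uw(2)]
      using tri_unique[OF C] tri_unique[OF triD(1)[OF C]] by blast+
    then have "deg u = ?a u + 2" "deg w = ?a w + 2"
      using deg_split[OF c r] ds by simp_all
    then have ge: "q - 1 \<le> int (?a u) + int (?a w)" using deg_pair_gt[of u w] Y uw a kq q3 by simp
    then have H0: "card ?H = 0" and sum: "int (?a u) + int (?a w) = q - 1" using le q3 by linarith+
    have nb2: "\<not> (adj u (c i) \<and> adj w (c i))" if "i \<in> ?I" "?g i" for i
    proof
      assume "adj u (c i) \<and> adj w (c i)"
      then have "{x\<in>{u,w}. adj x (c i) \<and> ?g i} = {u,w}" using that by auto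
      then have "i \<in> ?H" using that uw by simp
      then show False using H0 by auto
    qed
    have "{i\<in>?I. adj u (c i) \<and> ?g i} \<inter> {i\<in>?I. adj w (c i) \<and> ?g i} = {}" using nb2 by blast
    then have "card ({i\<in>?I. adj u (c i) \<and> ?g i} \<union> {i\<in>?I. adj w (c i) \<and> ?g i}) = ?a u + ?a w"
      by (intro card_Un_disjoint) auto
    then have "card ({i\<in>?I. adj u (c i) \<and> ?g i} \<union> {i\<in>?I. adj w (c i) \<and> ?g i}) = nat (q - 1)"
      using sum by linarith
    moreover have "card {i\<in>?I. ?g i} = nat (q - 1)"
    proof -
      have "{i\<in>?I. ?g i} = ?I - {i\<in>?I. \<not> ?g i}" by auto
      then have "{i\<in>?I. ?g i} = ?I - {\<zeta> mod q}" unfolding zI .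
      moreover have "\<zeta> mod q \<in> ?I" using q3 by simp
      ultimately show ?thesis by (simp add: nat_diff_distrib')
    qed
    moreover have "{i\<in>?I. adj u (c i) \<and> ?g i} \<union> {i\<in>?I. adj w (c i) \<and> ?g i} \<subseteq> {i\<in>?I. ?g i}" by auto
    ultimately have cov: "{i\<in>?I. adj u (c i) \<and> ?g i} \<union> {i\<in>?I. adj w (c i) \<and> ?g i} = {i\<in>?I. ?g i}"
      by (intro card_subset_eq) simp_all
    have "adj u (c i) \<longleftrightarrow> \<not> adj w (c i)" if "c i \<noteq> c \<zeta>" for i
    proof -
      have "i mod q \<in> {i\<in>?I. ?g i}" using that cyc_mod[OF c, of i] q3 by simp
      then have m: "i mod q \<in> ?I" "?g (i mod q)" by auto
      have "i mod q \<in> {i\<in>?I. adj u (c i) \<and> ?g i} \<union> {i\<in>?I. adj w (c i) \<and> ?g i}"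
        unfolding cov using m by simp
      then have "adj u (c (i mod q)) \<or> adj w (c (i mod q))" by blast
      then show ?thesis using nb2[OF m] unfolding cyc_mod[OF c] by blast
    qed
    moreover have "card (nb (range c) u) + card (nb (range c) w) = nat q + 1"
    proof -
      have "?d u = ?a u + 1" "?d w = ?a w + 1" using ds by blast+
      then show ?thesis unfolding card_nb_cyc[OF c] using sum q3 by linarith
    qed
    ultimately show ?thesis using C nbs by blast
  qed
qed

text \<open>If \<open>x\<close> enters backwards at \<open>i\<close> and one end of the outside edge
  forwards at \<open>i + 1\<close>, a path on \<open>k + 1\<close> vertices runs from
  \<open>x\<close> around the cycle and along that edge. Apart from \<open>\<zeta>\<close>, each
  position or its successor admits such a forward entry, so at least \<open>(q - 1) / 2\<close>
  positions are forbidden to \<open>x\<close>.\<close>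

lemma isolated_bk:
  assumes c: "cyc q c" and q: "q = int k - 2" and r: "range c \<subseteq> V"
    and Y: "u \<in> V - range c" "w \<in> V - range c" "x \<in> V - range c" "x \<noteq> u" "x \<noteq> w"
    and t: "tri u w (c \<zeta>)"
    and cov: "\<And>i. c i \<noteq> c \<zeta> \<Longrightarrow> adj u (c i) \<or> adj w (c i)"
  shows "2 * card {i\<in>{0..<q}. bk c x i} \<le> nat q + 1"
proof -
  have q3: "3 \<le> q" using cyc_ge3[OF c] .
  have uw: "u \<noteq> w" "adj u w" "adj w u" using tri_neq[OF t] tri_adjs[OF t] by auto
  have path: "\<not> fr c u' (i+1)" if b: "bk c x i" and g: "c (i+1) \<noteq> c \<zeta>" and u': "(u' = u \<and> w' = w) \<or> (u' = w \<and> w' = u)" for i u' w'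
  proof
    assume f: "fr c u' (i+1)"
    let ?p = "[x] @ rev (map c [i+1-q..i]) @ [u', w']"
    have cq: "c (i + 1 - q) = c (i + 1)" "c (i + 2 - q) = c (i + 2)"
      using cycD(1)[OF c, of "i+1-q"] cycD(1)[OF c, of "i+2-q"] by simp_all
    have e: "i + 1 - q + 1 = i + 2 - q" "i + 1 + 1 = i + 2" by simp_all
    have f': "adj (c (i+1)) u'" "\<not> tri (c (i+2)) (c (i+1)) u'"
      using f triD(5) unfolding fr_def e by (blast intro: adj_sym)+
    have b': "adj x (c i)" "\<not> tri x (c i) (c (i - 1))" using b unfolding bk_def by auto
    have "\<not> tri u w (c (i+1))" "\<not> tri w u (c (i+1))" using tri_unique[OF t] tri_unique[OF triD(1)[OF t]] g by metis+
    then have n: "\<not> tri (c (i+1)) u' w'" using u' triD(3) by blast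
    have a: "adj u' w'" using u' uw by auto
    have "walk ?p" using f' b' n a q3 cyc_walk[OF c] cq by (simp add: walk_simps e)
    moreover have "distinct (map c [i+1-q..i])" by (rule cyc_distinct_map[OF c, of _ "i+1-q" i]) auto
    then have "distinct ?p" using Y u' uw by auto
    moreover have "set ?p \<subseteq> V" using Y u' r by auto
    ultimately have "length ?p \<le> k" by (rule path_bound)
    then show False using q q3 by simp
  qed
  let ?I = "{0..<q}"
  define G where "G i \<longleftrightarrow> c i \<noteq> c \<zeta> \<and> (fr c u i \<or> fr c w i)" for i
  have per: "G (i + q) = G i" for i unfolding G_def using cyc_periodic(1)[OF c] cycD(1)[OF c] by simp
  have "card {i\<in>?I. bk c x i} \<le> card {i\<in>?I. \<not> G (i + 1)}"
    using path by (intro card_mono) (auto simp: G_def)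
  moreover have "card {i\<in>?I. \<not> G (i + 1)} + card {i\<in>?I. G (i + 1)} = nat q"
  proof -
    have "{i\<in>?I. \<not> G (i + 1)} \<union> {i\<in>?I. G (i + 1)} = ?I" "{i\<in>?I. \<not> G (i + 1)} \<inter> {i\<in>?I. G (i + 1)} = {}" by auto
    then show ?thesis using card_Un_disjoint[of "{i\<in>?I. \<not> G (i + 1)}" "{i\<in>?I. G (i + 1)}"] by simp
  qed
  moreover have sh: "card {i\<in>?I. G (i + 1)} = card {i\<in>?I. G i}"
    using card_periodic_shift[of G q 1, OF per] q3 by simp
  moreover have "nat q \<le> 2 * card {i\<in>?I. G i} + 1"
  proof -
    have "?I \<subseteq> insert (\<zeta> mod q) ({i\<in>?I. G i} \<union> {i\<in>?I. G (i+1)})"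
    proof
      fix i assume i: "i \<in> ?I"
      show "i \<in> insert (\<zeta> mod q) ({i\<in>?I. G i} \<union> {i\<in>?I. G (i+1)})"
      proof (cases "c i = c \<zeta>")
        case True
        then show ?thesis using cyc_eq_iff[OF c, of i \<zeta>] i by auto
      next
        case False
        show ?thesis
        proof (cases "G i")
          case nG: False
          then obtain z where z: "z = u \<or> z = w" "tri z (c i) (c (i+1))" using False cov[OF False] unfolding G_def fr_def by blast
          then have "fr c z (i+1)" using blk_fr[OF c, of z i] by (simp add: blk_def)
          moreover have "c (i+1) \<noteq> c \<zeta>"
          proof
            assume e: "c (i+1) = c \<zeta>"
            from tri_share(2)[OF z(2) t] show False using z(1) e Y \<open>c i \<noteq> c \<zeta>\<close> by auto
          qed
          ultimately show ?thesis using i z(1) by (auto simp: G_def)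
        qed (use i in auto)
      qed
    qed
    then have "card ?I \<le> card (insert (\<zeta> mod q) ({i\<in>?I. G i} \<union> {i\<in>?I. G (i+1)}))" by (rule card_mono[rotated]) simp
    also have "\<dots> \<le> Suc (card ({i\<in>?I. G i} \<union> {i\<in>?I. G (i+1)}))" by (simp add: card_insert_if)
    also have "\<dots> \<le> Suc (card {i\<in>?I. G i} + card {i\<in>?I. G (i+1)})" using card_Un_le by simp
    finally show ?thesis using sh by simp
  qed
  ultimately show ?thesis by linarith
qed

lemma cyc_k2_count:
  assumes c: "cyc q c" and q: "q = int k - 2" and r: "range c \<subseteq> V"
  shows "(q + 1) * int (card (V - range c)) + 2 * q + (q * (q - 1) - int (E2 (range c)))
     < 2 * int (\<Sum>y\<in>V - range c. card (nb (range c) y)) + int (E2 (V - range c))"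
    and "int (E2 (range c)) \<le> q * (q - 1)" and "3 \<le> card (V - range c)"
proof -
  have q3: "3 \<le> q" using cyc_ge3[OF c] .
  have kq: "int (k - 1) = q + 1" using q k4 by simp
  have cV: "int (card V) = q + int (card (V - range c))" by (rule card_split[OF c r])
  then show "3 \<le> card (V - range c)" using card_V_core q by simp
  have "int ((k - 1) * card V) < int (E2 V)" using big by (simp only: of_nat_less_iff)
  then have "(q + 1) * (q + int (card (V - range c))) < int (E2 V)" unfolding of_nat_mult kq cV .
  moreover have "int (E2 V) = int (E2 (range c)) + int (E2 (V - range c)) + 2 * int (\<Sum>y\<in>V - range c. card (nb (range c) y))"
    using E2_split[OF c r] by simp
  ultimately show "(q + 1) * int (card (V - range c)) + 2 * q + (q * (q - 1) - int (E2 (range c)))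
     < 2 * int (\<Sum>y\<in>V - range c. card (nb (range c) y)) + int (E2 (V - range c))"
    by (simp add: algebra_simps)
  have "int (E2 (range c)) \<le> int (card (range c) * (card (range c) - 1))"
    using E2_le[OF cyc_card(1)[OF c]] by (simp only: of_nat_le_iff)
  then show "int (E2 (range c)) \<le> q * (q - 1)" using cyc_card(2)[OF c] q3 by (simp add: of_nat_diff)
qed

lemma sum_blk_le:
  assumes c: "cyc q c"
  shows "(\<Sum>y\<in>V - range c. card {i\<in>{0..<q}. blk c y i}) \<le> nat q"
proof -
  have "card {i\<in>{0..<q}. \<exists>y\<in>V - range c. blk c y i} \<le> card {0..<q}" by (rule card_mono) auto
  then show ?thesis using sum_blk[of "V - range c" q c] finV by simp
qed

text \<open>One outside edge, rich in entries by \<open>pair_struct\<close>, leaves few entries to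
  each isolated outside vertex. The other outside vertices are matched in pairs, and each pair has
  too few attachments as well.\<close>

lemma cyc_k2_indep:
  assumes c: "cyc q c" and q: "q = int k - 2" and r: "range c \<subseteq> V"
    and uw: "u \<in> V - range c" "w \<in> V - range c"
  shows "\<not> adj u w"
proof
  assume a: "adj u w"
  have q3: "3 \<le> q" using cyc_ge3[OF c] .
  have c2: "cyc (int k - 2) c" using c q by simp
  define Y where "Y = V - range c"
  have fY: "finite Y" using finV by (simp add: Y_def)
  define b where "b y = card {i\<in>{0..<q}. blk c y i}" for y
  define d where "d y = card (nb (range c) y)" for y
  \<comment> \<open>The share of \<open>y\<close> in the inequality of \<open>cyc_k2_count\<close>,
    with a charge of 2 for each edge it blocks. At most \<open>q\<close> edges are blocked, which
    pays for the term \<open>2 * q\<close>, so a total of at most 0 is a contradiction.\<close>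
  define h where "h y = 2 * int (d y) + int (card (nb Y y)) - (q + 1) - 2 * int (b y)" for y
  obtain \<zeta> where z: "tri u w (c \<zeta>)" "\<And>i. c i \<noteq> c \<zeta> \<Longrightarrow> adj u (c i) \<or> adj w (c i)"
    using pair_struct[OF c q r uw a] by blast
  let ?J = "{y\<in>Y. nb Y y = {}}"
  have iso: "h y \<le> 0" if "y \<in> ?J" for y
  proof -
    have y: "y \<in> V - range c" "y \<noteq> u" "y \<noteq> w" using that a uw adj_sym by (auto simp: Y_def nb_def)
    have b1: "2 * card {i\<in>{0..<q}. bk c y i} \<le> nat q + 1"
      by (rule isolated_bk[OF c q r uw y z])
    let ?c = "\<lambda>i. c (- i)"
    have rr: "range ?c = range c" by (rule range_uminus)
    have "2 * card {i\<in>{0..<q}. bk ?c y i} \<le> nat q + 1"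
      by (rule isolated_bk[OF cyc_uminus[OF c] q, of u w y "- \<zeta>"]) (use uw y z rr r in auto)
    moreover have "card {i\<in>{0..<q}. bk ?c y i} = card {i\<in>{0..<q}. fr c y (i + 1)}"
      unfolding bk_uminus using card_periodic_uminus[of "fr c y" q] card_periodic_shift[of "fr c y" q 1] cyc_periodic(1)[OF c] q3 by simp
    ultimately have "2 * d y \<le> nat q + 1 + 2 * b y"
      using b1 card_fr[OF c, of y] card_bk[OF c, of y] unfolding b_def d_def by linarith
    then show ?thesis using that q3 unfolding h_def by simp
  qed
  define mate where "mate y = the_elem (nb Y y)" for y
  let ?P = "{y\<in>Y. nb Y y \<noteq> {}}"
  have mate: "nb Y y = {mate y}" "mate y \<in> ?P" "mate (mate y) = y" "h y + h (mate y) \<le> 0" if y: "y \<in> ?P" for y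
  proof -
    obtain x where x: "x \<in> Y" "adj y x" using y by (auto simp: nb_def)
    have yx: "y \<in> V - range c" "x \<in> V - range c" using x y by (auto simp: Y_def)
    have xy: "adj x y" using x adj_sym by simp
    obtain \<xi> where s: "tri y x (c \<xi>)" "\<And>i. c i \<noteq> c \<xi> \<Longrightarrow> adj y (c i) \<or> adj x (c i)"
        "nb Y y = {x}" "d y + d x = nat q + 1"
      using pair_struct[OF c q r yx x(2)] unfolding Y_def d_def by blast
    have s2: "nb Y x = {y}" using pair_struct[OF c q r yx(2,1) xy] unfolding Y_def by blast
    have m: "mate y = x" "mate x = y" using s(3) s2 by (simp_all add: mate_def)
    \<comment> \<open>The end adjacent to \<open>c (\<xi> + 1)\<close> enters backwards at
      \<open>\<xi>\<close>, where its triple contains the other end. A forward entry at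
      \<open>\<xi> + 1\<close> would allow its insertion, so it must block the edge after
      \<open>c (\<xi> + 1)\<close>.\<close>
    have "1 \<le> b y + b x"
    proof -
      have c1: "c (\<xi> + 1) \<noteq> c \<xi>" using cyc_neq[OF c, of \<xi> "\<xi>+1"] q3 by auto
      then obtain v where v: "v = y \<or> v = x" "adj v (c (\<xi> + 1))" using s(2) by blast
      obtain v' where v': "v' = y \<or> v' = x" "tri v v' (c \<xi>)" using v(1) s(1) triD(1) by blast
      have vY: "v \<in> V - range c" using v yx by auto
      have nt: "\<not> tri v (c \<xi>) (c j)" for j using tri_unique[OF triD(2)[OF v'(2)]] v'(1) yx by auto
      have "bk c v \<xi>" "\<not> blk c v \<xi>" using nt tri_adjs(3)[OF v'(2)] unfolding bk_def blk_def by auto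
      then have "\<not> fr c v (\<xi> + 1)" using cyc_k2_insert[OF c2 r vY] by blast
      then have "blk c v (\<xi> + 1)" using v(2) unfolding fr_def blk_def by simp
      moreover have "blk c v ((\<xi> + 1) mod q) = blk c v (\<xi> + 1)"
      proof -
        have "c ((\<xi> + 1) mod q + 1) = c (\<xi> + 1 + 1)"
          unfolding cyc_eq_iff[OF c] by (simp add: mod_simps)
        then show ?thesis unfolding blk_def cyc_mod[OF c] by simp
      qed
      ultimately have "(\<xi> + 1) mod q \<in> {i\<in>{0..<q}. blk c v i}" using q3 by simp
      then have "b v \<noteq> 0" unfolding b_def by (subst card_0_eq) auto
      then show ?thesis using v(1) by auto
    qed
    moreover have "int (d y) + int (d x) = q + 1" using s(4) q3 by simp
    ultimately have "h y + h x \<le> 0" unfolding h_def s(3) s2 by simp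
    then show "nb Y y = {mate y}" "mate y \<in> ?P" "mate (mate y) = y" "h y + h (mate y) \<le> 0"
      using m s(3) s2 x by auto
  qed
  have "bij_betw mate ?P ?P"
    by (rule bij_betw_byWitness[where f' = mate]) (use mate in auto)
  then have "(\<Sum>y\<in>?P. h (mate y)) = (\<Sum>y\<in>?P. h y)" by (rule sum.reindex_bij_betw)
  moreover have "(\<Sum>y\<in>?P. h y + h (mate y)) \<le> 0" by (rule sum_nonpos) (use mate in blast)
  ultimately have "(\<Sum>y\<in>?P. h y) \<le> 0" by (simp add: sum.distrib)
  moreover have "(\<Sum>y\<in>?J. h y) \<le> 0" by (rule sum_nonpos) (use iso in blast)
  moreover have "(\<Sum>y\<in>Y. h y) = (\<Sum>y\<in>?P. h y) + (\<Sum>y\<in>?J. h y)"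
  proof -
    have "Y = ?P \<union> ?J" "?P \<inter> ?J = {}" by auto
    then show ?thesis using fY sum.union_disjoint[of ?P ?J h] by simp
  qed
  ultimately have "(\<Sum>y\<in>Y. h y) \<le> 0" by linarith
  moreover have "(\<Sum>y\<in>Y. h y) = 2 * int (\<Sum>y\<in>Y. d y) + int (E2 Y) - (q + 1) * int (card Y) - 2 * int (\<Sum>y\<in>Y. b y)"
    unfolding h_def E2_def by (simp add: sum.distrib sum_subtractf sum_distrib_left algebra_simps)
  moreover have "(\<Sum>y\<in>Y. b y) \<le> nat q" unfolding Y_def b_def by (rule sum_blk_le[OF c])
  then have "int (\<Sum>y\<in>Y. b y) \<le> q" using q3 by linarith
  ultimately show False using cyc_k2_count(1,2)[OF c q r] unfolding Y_def[symmetric] d_def[symmetric] by linarith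
qed

section \<open>Crossing attachments of an independent complement\<close>

text \<open>The walk \<open>y, c (i + 1), ..., c j, x, c i, c (i - 1), ..., c (j + 1)\<close> has
  \<open>k\<close> vertices. It extends by \<open>z\<close> if \<open>y \<noteq> z\<close>, and if
  \<open>y = z\<close> it closes to a cycle unless the closing triple interferes.\<close>

lemma cross_lt:
  assumes c: "cyc q c" and q: "q = int k - 2" and r: "range c \<subseteq> V"
    and Y: "x \<in> V - range c" "y \<in> V - range c" "z \<in> V - range c" "y \<noteq> x" "z \<noteq> x"
    and b: "bk c x i" "bk c x j" and f: "fr c y (i + 1)" "fr c z (j + 1)"
    and ij: "i < j" "j < i + q" and nt: "\<not> tri x (c i) (c j)"
  shows "y = z \<and> tri y (c (i + 1)) (c (j + 1))"
proof (rule ccontr)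
  assume n: "\<not> ?thesis"
  have q3: "3 \<le> q" using cyc_ge3[OF c] .
  have ind: "\<not> adj u v" if "u \<in> V - range c" "v \<in> V - range c" for u v by (rule cyc_k2_indep[OF c q r that])
  have ntri: "\<not> tri u v s" "\<not> tri u s v" if "u \<in> V - range c" "v \<in> V - range c" for u v s
    using ind[OF that] tri_adjs(1,3) by blast+
  have cq: "c (i + q) = c i" "c (i + q - 1) = c (i - 1)"
    using cycD(1)[OF c, of i] cycD(1)[OF c, of "i-1"] by (simp_all add: algebra_simps)
  have e: "i + 1 + 1 = i + 2" "j + 1 + 1 = j + 2" by simp_all
  have f': "adj y (c (i+1))" "\<not> tri y (c (i+1)) (c (i+2))" "adj (c (j+1)) z" "\<not> tri (c (j+2)) (c (j+1)) z"
    using f triD(5) unfolding fr_def e by (blast intro: adj_sym)+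
  have b': "adj x (c i)" "\<not> tri x (c i) (c (i-1))" "adj (c j) x" "\<not> tri (c (j-1)) (c j) x" "\<not> tri (c j) x (c i)"
    using b nt triD unfolding bk_def by (blast intro: adj_sym)+
  have jc: "(i + 1 = j \<or> i + 1 < j) \<and> (j + 1 = i + q \<or> j + 1 < i + q)" using ij by auto
  let ?L = "[i+1..j] @ rev [j+1..i+q]"
  have dl: "distinct ?L" "set ?L \<subseteq> {i+1..i+q}" using ij by auto
  then have dc: "distinct (map c ?L)" by (rule cyc_distinct_map[OF c]) simp
  have dc': "distinct (map c [i+1..j] @ rev (map c [j+1..i+q]))" using dc by (simp add: rev_map)
  have nin: "v \<notin> set (map c [i+1..j] @ rev (map c [j+1..i+q]))" if "v \<in> V - range c" for v using that by auto
  let ?q = "[y] @ map c [i+1..j] @ [x] @ rev (map c [j+1..i+q])"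
  have wq: "walk ?q"
    using jc f' b' cq ij ntri[OF Y(2) Y(1)] cyc_walk[OF c]
    by (elim conjE disjE) (simp_all add: walk_simps e)
  have dq: "distinct ?q" using dc' nin[OF Y(1)] nin[OF Y(2)] Y(4) by auto
  have sq: "set ?q \<subseteq> V" using Y r by auto
  have lq: "int (length ?q) = int k" using ij q by simp
  show False
  proof (cases "y = z")
    case True
    then have t: "\<not> tri y (c (i+1)) (c (j+1))" using n by simp
    have "\<exists>c'. cyc (int (length ?q)) c' \<and> range c' = set ?q"
    proof (rule cycI)
      show "3 \<le> length ?q" using lq k4 by linarith
      show "adj (last ?q) (hd ?q)" using f' True ij by (simp add: last_rev)
      have "tri (c (j+1)) y (c (i+1)) \<Longrightarrow> tri y (c (i+1)) (c (j+1))" by (rule triD(3))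
      then show "\<not> tri (last ?q) (hd ?q) (hd (tl ?q))" using t ij by (auto simp: last_rev)
      show "\<not> tri (last (butlast ?q)) (last ?q) (hd ?q)"
        using jc f' True ij ntri[OF Y(1) Y(2)] by (elim conjE disjE) (auto simp: last_rev butlast_append butlast_rev e)
    qed (use wq dq in simp_all)
    then show False using no_cyc_k sq lq by metis
  next
    case False
    have "walk (?q @ [z])"
    proof -
      have "\<not> tri (last (butlast ?q)) (last ?q) z"
        using jc f' ij ntri[OF Y(1) Y(3)] by (elim conjE disjE) (auto simp: last_rev butlast_append butlast_rev e)
      moreover have "adj (last ?q) z" using f' ij by (simp add: last_rev)
      ultimately show ?thesis using wq by (subst walk_append) simp_all
    qed
    moreover have "distinct (?q @ [z])" using dq nin[OF Y(3)] Y(5) False by auto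
    moreover have "set (?q @ [z]) \<subseteq> V" using sq Y by simp
    ultimately have "length (?q @ [z]) \<le> k" by (rule path_bound)
    moreover have "length (?q @ [z]) = length ?q + 1" by (simp only: length_append list.size)
    ultimately show False using lq by linarith
  qed
qed

lemma cross:
  assumes c: "cyc q c" and q: "q = int k - 2" and r: "range c \<subseteq> V"
    and Y: "x \<in> V - range c" "y \<in> V - range c" "z \<in> V - range c" "y \<noteq> x" "z \<noteq> x"
    and b: "bk c x i" "bk c x j" and f: "fr c y (i + 1)" "fr c z (j + 1)"
    and ij: "i \<in> {0..<q}" "j \<in> {0..<q}" "i \<noteq> j"
  shows "tri x (c i) (c j) \<or> y = z \<and> tri y (c (i + 1)) (c (j + 1))"
proof (cases "i < j")
  case True
  then show ?thesis using cross_lt[OF c q r Y b f] ij by auto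
next
  case False
  then show ?thesis using cross_lt[OF c q r Y(1,3,2,5,4) b(2,1) f(2,1)] ij triD(2) by auto
qed

text \<open>Three such positions form three pairs, each giving a triple at \<open>x\<close> or, one
  step further, a triple at a common \<open>y\<close>. The triples at one vertex have disjoint
  remaining pairs, so each kind accounts for at most one of the three.\<close>

lemma card_cross_bk:
  assumes c: "cyc q c" and q: "q = int k - 2" and r: "range c \<subseteq> V" and x: "x \<in> V - range c"
  shows "card {i\<in>{0..<q}. bk c x i \<and> (\<exists>y\<in>V - range c. y \<noteq> x \<and> fr c y (i + 1))} \<le> 2" (is "card ?A \<le> 2")
proof (rule ccontr)
  assume "\<not> card ?A \<le> 2"
  then have "3 \<le> card ?A" by simp
  then obtain T where T: "T \<subseteq> ?A" "card T = 3" by (meson obtain_subset_with_card_n)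
  then obtain i1 i2 i3 where i: "T = {i1, i2, i3}" "i1 \<noteq> i2" "i1 \<noteq> i3" "i2 \<noteq> i3" by (auto simp: card_3_iff)
  then have m: "i1 \<in> ?A" "i2 \<in> ?A" "i3 \<in> ?A" using T(1) by auto
  then obtain y1 y2 y3 where y: "y1 \<in> V - range c" "y1 \<noteq> x" "fr c y1 (i1 + 1)" "y2 \<in> V - range c" "y2 \<noteq> x" "fr c y2 (i2 + 1)"
     "y3 \<in> V - range c" "y3 \<noteq> x" "fr c y3 (i3 + 1)" by blast
  have I: "i1 \<in> {0..<q}" "i2 \<in> {0..<q}" "i3 \<in> {0..<q}" "bk c x i1" "bk c x i2" "bk c x i3" using m by auto
  have ne: "c i1 \<noteq> c i2" "c i1 \<noteq> c i3" "c i2 \<noteq> c i3"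
    using i(2-4) I(1-3) inj_onD[OF cyc_inj_on[OF c, of "q-1" 0]] by auto
  have ne': "c (i1+1) \<noteq> c (i2+1)" "c (i1+1) \<noteq> c (i3+1)" "c (i2+1) \<noteq> c (i3+1)"
    using i(2-4) I(1-3) inj_onD[OF cyc_inj_on[OF c, of "q" 1], of "_+1" "_+1"] by auto
  have p12: "tri x (c i1) (c i2) \<or> y1 = y2 \<and> tri y1 (c (i1 + 1)) (c (i2 + 1))"
    by (rule cross[OF c q r x y(1,4,2,5) I(4,5) y(3,6) I(1,2) i(2)])
  have p13: "tri x (c i1) (c i3) \<or> y1 = y3 \<and> tri y1 (c (i1 + 1)) (c (i3 + 1))"
    by (rule cross[OF c q r x y(1,7,2,8) I(4,6) y(3,9) I(1,3) i(3)])
  have p23: "tri x (c i2) (c i3) \<or> y2 = y3 \<and> tri y2 (c (i2 + 1)) (c (i3 + 1))"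
    by (rule cross[OF c q r x y(4,7,5,8) I(5,6) y(6,9) I(2,3) i(4)])
  have u: "\<not> (tri x (c i1) (c i2) \<and> tri x (c i1) (c i3))" "\<not> (tri x (c i1) (c i2) \<and> tri x (c i2) (c i3))"
      "\<not> (tri x (c i1) (c i3) \<and> tri x (c i2) (c i3))"
    using tri_unique[of x "c i1" "c i2" "c i3"] tri_unique[of x "c i2" "c i1" "c i3"] triD(2)[of x "c i1" "c i2"]
      tri_unique2[of x "c i1" "c i3" "c i2"] ne by auto
  have v: "\<not> (tri y (c (i1+1)) (c (i2+1)) \<and> tri y (c (i1+1)) (c (i3+1)))" "\<not> (tri y (c (i1+1)) (c (i2+1)) \<and> tri y (c (i2+1)) (c (i3+1)))"
      "\<not> (tri y (c (i1+1)) (c (i3+1)) \<and> tri y (c (i2+1)) (c (i3+1)))" for y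
    using tri_unique[of y "c (i1+1)" "c (i2+1)" "c (i3+1)"] tri_unique[of y "c (i2+1)" "c (i1+1)" "c (i3+1)"] triD(2)[of y "c (i1+1)" "c (i2+1)"]
      tri_unique2[of y "c (i1+1)" "c (i3+1)" "c (i2+1)"] ne' by auto
  show False using p12 p13 p23 u v[of y1] v[of y2] by auto
qed

lemma card_cross_fr:
  assumes c: "cyc q c" and q: "q = int k - 2" and r: "range c \<subseteq> V" and x: "x \<in> V - range c"
  shows "card {i\<in>{0..<q}. fr c x (i + 1) \<and> (\<exists>y\<in>V - range c. y \<noteq> x \<and> bk c y i)} \<le> 2"
proof -
  let ?c = "\<lambda>i. c (- i)"
  define P where "P i \<longleftrightarrow> fr c x (i + 1) \<and> (\<exists>y\<in>V - range c. y \<noteq> x \<and> bk c y i)" for i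
  have q3: "3 \<le> q" using cyc_ge3[OF c] .
  have rr: "range ?c = range c" by (rule range_uminus)
  have per: "P (i + q) = P i" for i
    unfolding P_def using cyc_periodic(2)[OF c, of _ i] cyc_periodic(1)[OF c, of x "i + 1"] by (simp add: algebra_simps)
  have "card {i\<in>{0..<q}. bk ?c x i \<and> (\<exists>y\<in>V - range ?c. y \<noteq> x \<and> fr ?c y (i + 1))} \<le> 2"
    by (rule card_cross_bk[OF cyc_uminus[OF c] q]) (use r x rr in auto)
  moreover have "bk ?c x i \<and> (\<exists>y\<in>V - range ?c. y \<noteq> x \<and> fr ?c y (i + 1)) \<longleftrightarrow> P (- (i + 1))" for i
  proof -
    have "- (i + 1) + 1 = - i" by simp
    then show ?thesis unfolding P_def rr bk_uminus fr_uminus by metis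
  qed
  ultimately have "card {i\<in>{0..<q}. P (- (i + 1))} \<le> 2" by simp
  moreover have "card {i\<in>{0..<q}. P (- (i + 1))} = card {i\<in>{0..<q}. P (- i)}"
    by (rule card_periodic_shift[of "\<lambda>i. P (- i)" q 1]) (use per[of "- _ - q"] q3 in \<open>simp_all add: algebra_simps\<close>)
  moreover have "card {i\<in>{0..<q}. P (- i)} = card {i\<in>{0..<q}. P i}"
    by (rule card_periodic_uminus) (use per q3 in simp_all)
  ultimately show ?thesis unfolding P_def by simp
qed

text \<open>
  A chord from \<open>c\<^sub>1\<close> to the successor of a position in \<open>bk c y\<close> would give a 2-opt exchange inserting \<open>y\<close> into
  the cycle, so each such position costs a missing chord.
\<close>

lemma two_opt:
  assumes c: "cyc q c" and q: "q = int k - 2" and r: "range c \<subseteq> V"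
    and y: "y \<in> V - range c" "blk c y 0"
    and all: "\<And>i. \<exists>z\<in>V - range c. blk c z i"
  shows "2 * card {i\<in>{0..<q}. bk c y i} \<le> card (missing (range c)) + 4"
proof -
  have q3: "3 \<le> q" using cyc_ge3[OF c] .
  have cq: "c q = c 0" "c (q - 1) = c (-1)" using cycD(1)[OF c, of 0] cycD(1)[OF c, of "-1"] by simp_all
  \<comment> \<open>By \<open>all\<close>, the third vertex of every cycle edge is off the
    cycle.\<close>
  have nochord: "\<not> tri (c a) (c i) (c (i + 1))" for a i
  proof
    assume t: "tri (c a) (c i) (c (i + 1))"
    obtain z where z: "z \<in> V - range c" "tri z (c i) (c (i + 1))" using all[of i] unfolding blk_def by blast
    then show False using tri_unique1[OF t z(2)] by auto
  qed
  have t0: "tri y (c 0) (c 1)" using y(2) by (simp add: blk_def)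
  have b0: "bk c y 0" by (rule blk_bk[OF c y(2)])
  have miss: "\<not> adj (c 1) (c (h + 1))" if h: "h \<in> {0..<q}" "bk c y h" "h \<noteq> 0" "h \<noteq> q - 1" for h
  proof
    assume a: "adj (c 1) (c (h + 1))"
    have "h \<noteq> 1"
    proof
      assume "h = 1"
      then show False using h(2) triD(2)[OF t0] by (simp add: bk_def)
    qed
    then have hh: "2 \<le> h" "h \<le> q - 2" using h by auto
    let ?q = "map c [h+1..q] @ [y] @ rev (map c [1..h])"
    have ch: "c h \<noteq> c 1" using cyc_neq[OF c, of 1 h] hh by auto
    have f: "adj (c 0) y" "\<not> tri (c (-1)) (c 0) y" "adj y (c h)" "\<not> tri y (c h) (c (h - 1))" "\<not> tri (c 0) y (c h)"
    proof -
      have b: "adj y (c 0)" "\<not> tri y (c 0) (c (0 - 1))" "adj y (c h)" "\<not> tri y (c h) (c (h - 1))"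
        using b0 h(2) unfolding bk_def by auto
      then show "adj (c 0) y" "adj y (c h)" "\<not> tri y (c h) (c (h - 1))" by (auto intro: adj_sym)
      show "\<not> tri (c (-1)) (c 0) y" using b(2) triD(5)[of "c (-1)" "c 0" y] by auto
      show "\<not> tri (c 0) y (c h)" using tri_unique[OF t0, of "c h"] triD(1)[of "c 0" y "c h"] ch by auto
    qed
    have g: "adj (c 1) (c (h+1))" "\<not> tri (c 2) (c 1) (c (h+1))" "\<not> tri (c 1) (c (h+1)) (c (h+2))"
    proof -
      show "adj (c 1) (c (h+1))" by (rule a)
      have e: "h + 1 + 1 = h + 2" by simp
      show "\<not> tri (c 2) (c 1) (c (h+1))" using nochord[of "h+1" 1] triD(5)[of "c 2" "c 1" "c (h+1)"] by auto
      show "\<not> tri (c 1) (c (h+1)) (c (h+2))" using nochord[of 1 "h+1"] unfolding e .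
    qed
    have w: "walk ?q" using f g hh cq cyc_walk[OF c] by (simp add: walk_simps)
    let ?L = "[h+1..q] @ rev [1..h]"
    have "distinct ?L" "set ?L \<subseteq> {1..q}" using hh by auto
    then have "distinct (map c ?L)" by (rule cyc_distinct_map[OF c]) simp
    then have d: "distinct ?q" using y(1) by (auto simp: rev_map)
    have "\<exists>c'. cyc (int (length ?q)) c' \<and> range c' = set ?q"
      by (rule cycI) (use w d g g(3)[unfolded add.commute[of h 2]] hh in \<open>auto simp: last_rev butlast_append butlast_rev hd_append\<close>)
    moreover have "set ?q \<subseteq> V" using y r by auto
    moreover have "int (length ?q) = int k - 1" using hh q by simp
    ultimately show False using no_cyc_k1 by metis
  qed
  let ?B = "{i\<in>{0..<q}. bk c y i}"
  let ?M = "missing (range c)"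
  \<comment> \<open>At 0 and \<open>q - 1\<close> the chord would degenerate to \<open>c 1\<close>
    itself or to the cycle edge between \<open>c 0\<close> and \<open>c 1\<close>. These two
    positions, counted twice, are the 4 in the bound.\<close>
  let ?B' = "?B - {0, q - 1}"
  have fM: "finite ?M" by (rule finite_subset[of _ "range c \<times> range c"]) (use cyc_card[OF c] in auto)
  let ?f = "\<lambda>h. (c 1, c (h + 1))" and ?g = "\<lambda>h. (c (h + 1), c 1)"
  have inj: "inj_on (\<lambda>h. c (h + 1)) ?B'"
  proof (rule inj_onI)
    fix a b assume ab: "a \<in> ?B'" "b \<in> ?B'" "c (a + 1) = c (b + 1)"
    then show "a = b" using inj_onD[OF cyc_inj_on[OF c, of q 1], of "a+1" "b+1"] by auto
  qed
  have ne: "c (h + 1) \<noteq> c 1" if "h \<in> ?B'" for h using cyc_neq[OF c, of 1 "h+1"] that by auto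
  have cf: "card (?f ` ?B') = card ?B'" "card (?g ` ?B') = card ?B'"
  proof -
    have "inj_on ?f ?B'" "inj_on ?g ?B'" using inj unfolding inj_on_def by blast+
    then show "card (?f ` ?B') = card ?B'" "card (?g ` ?B') = card ?B'" by (simp_all only: card_image)
  qed
  have "?f ` ?B' \<inter> ?g ` ?B' = {}" using ne by force
  then have "card (?f ` ?B' \<union> ?g ` ?B') = 2 * card ?B'" using cf by (subst card_Un_disjoint) auto
  moreover have "?f ` ?B' \<union> ?g ` ?B' \<subseteq> ?M"
  proof -
    have "\<not> adj (c 1) (c (h + 1))" "\<not> adj (c (h + 1)) (c 1)" if "h \<in> ?B'" for h
      using miss[of h] that adj_sym by auto
    then show ?thesis using ne by fastforce
  qed
  ultimately have "2 * card ?B' \<le> card ?M" using card_mono[OF fM, of "?f ` ?B' \<union> ?g ` ?B'"] by simp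
  moreover have "card ?B \<le> card ?B' + 2"
  proof -
    have "card ?B \<le> card (?B' \<union> {0, q - 1})" by (rule card_mono) auto
    also have "\<dots> \<le> card ?B' + card {0, q - 1}" by (rule card_Un_le)
    also have "\<dots> \<le> card ?B' + 2" by (simp add: card_insert_le_m1)
    finally show ?thesis .
  qed
  ultimately show ?thesis by linarith
qed

text \<open>At an unblocked position forward and backward entries are disjoint and score at most
  \<open>N\<close>; a blocked one scores 2 plus a surplus, summed in \<open>T\<close>. The crossing
  lemmas limit \<open>T\<close> to 4 per outside vertex, which settles \<open>N \<ge> 5\<close>.
  Smaller \<open>N\<close> needs parity and, when every cycle edge is blocked,
  \<open>two_opt\<close>.\<close>

lemma no_cyc_k2:
  assumes c2: "cyc (int k - 2) c" and r: "range c \<subseteq> V"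
  shows False
proof -
  define q where "q = int k - 2"
  have c: "cyc q c" using c2 q_def by simp
  have q3: "3 \<le> q" using cyc_ge3[OF c] .
  have kq: "int (k - 1) = q + 1" using q_def k4 by simp
  define Y where "Y = V - range c"
  define N where "N = card Y"
  have fY: "finite Y" using finV by (simp add: Y_def)
  let ?I = "{0..<q}"
  define d where "d y = card (nb (range c) y)" for y
  define b where "b y = card {i\<in>?I. blk c y i}" for y
  define P where "P i \<longleftrightarrow> (\<exists>y\<in>Y. blk c y i)" for i
  define \<beta> where "\<beta> = card {i\<in>?I. P i}"
  define \<mu> where "\<mu> = card (missing (range c))"
  define Fs where "Fs i = {y\<in>Y. fr c y (i + 1)}" for i
  define Bs where "Bs i = {y\<in>Y. bk c y i}" for i
  have fFB: "finite (Fs i)" "finite (Bs i)" "Fs i \<subseteq> Y" "Bs i \<subseteq> Y" for i using fY by (auto simp: Fs_def Bs_def)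
  have N3: "3 \<le> N" using cyc_k2_count(3)[OF c q_def r] by (simp add: N_def Y_def)
  have ind: "\<not> adj x y" if "x \<in> Y" "y \<in> Y" for x y using cyc_k2_indep[OF c q_def r] that by (simp add: Y_def)
  have E0: "E2 Y = 0" by (rule E2_indep) (rule ind)
  have dg: "deg y = d y" if "y \<in> Y" for y
  proof -
    have "nb V y = nb (range c) y" using ind[OF that] r by (auto simp: nb_def Y_def)
    then show ?thesis by (simp add: d_def)
  qed
  have mu: "int (E2 (range c)) + int \<mu> = q * (q - 1)"
  proof -
    have "E2 (range c) + \<mu> = card (range c) * (card (range c) - 1)"
      unfolding \<mu>_def by (rule E2_missing) (rule cyc_card[OF c])
    then have "int (E2 (range c)) + int \<mu> = int (card (range c)) * int (card (range c) - 1)"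
      by (metis of_nat_add of_nat_mult)
    then show ?thesis using cyc_card[OF c] q3 by (simp add: of_nat_diff)
  qed
  define D where "D = int (\<Sum>y\<in>Y. d y)"
  have big: "(q + 1) * int N + 2 * q + int \<mu> < 2 * D"
    using cyc_k2_count(1)[OF c q_def r] mu E0 unfolding D_def d_def N_def Y_def by simp
  have sb: "(\<Sum>y\<in>Y. b y) = \<beta>" unfolding b_def \<beta>_def P_def by (rule sum_blk[OF fY])
  have bq: "int \<beta> \<le> q"
  proof -
    have "\<beta> \<le> card ?I" unfolding \<beta>_def by (rule card_mono) auto
    then show ?thesis using q3 by simp
  qed
  have ins: "blk c y i" if "y \<in> Fs i" "y \<in> Bs i" for y i
    using cyc_k2_insert[OF c2 r, of y i] that by (simp add: Fs_def Bs_def Y_def)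
  have fb: "card {i\<in>?I. fr c y (i + 1)} + b y = d y" "card {i\<in>?I. bk c y i} + b y = d y" for y
    using card_fr[OF c] card_bk[OF c] by (simp_all add: b_def d_def)
  have db: "2 * int (d y) \<le> q + 3 * int (b y)" if y: "y \<in> Y" for y
  proof -
    let ?A = "{i\<in>?I. fr c y (i + 1)}" and ?B = "{i\<in>?I. bk c y i}"
    have "?A \<inter> ?B \<subseteq> {i\<in>?I. blk c y i}" using ins[of y] y by (auto simp: Fs_def Bs_def)
    then have "card (?A \<inter> ?B) \<le> b y" unfolding b_def by (rule card_mono[rotated]) simp
    moreover have "card (?A \<union> ?B) \<le> card ?I" by (rule card_mono) auto
    moreover have "card ?A + card ?B = card (?A \<union> ?B) + card (?A \<inter> ?B)" by (rule card_Un_Int) auto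
    ultimately have "card ?A + card ?B \<le> nat q + b y" by simp
    then show ?thesis using fb[of y] q3 by linarith
  qed
  \<comment> \<open>The degree bound puts \<open>2 * d y\<close> above \<open>q + 1\<close>, more
    than \<open>db\<close> allows to a vertex that blocks no edge.\<close>
  have b1: "1 \<le> b y" if y: "y \<in> Y" for y
  proof -
    have "k - 1 < 2 * d y" using deg_gt[of y] y dg[OF y] by (simp add: Y_def)
    then have "q + 1 < 2 * int (d y)" using kq by linarith
    then show ?thesis using db[OF y] by linarith
  qed
  have Nb: "N \<le> \<beta>"
    using sum_mono[of Y "\<lambda>_. 1" b] b1 unfolding sb N_def by simp
  define t where "t i = card {y\<in>Y. fr c y (i + 1) \<and> (\<exists>z\<in>Y. z \<noteq> y \<and> bk c z i)} + card {y\<in>Y. bk c y i \<and> (\<exists>z\<in>Y. z \<noteq> y \<and> fr c z (i + 1))}" for i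
  have s: "card (Fs i) + card (Bs i) \<le> (if P i then 2 + min (N - 1) (t i) else N)" for i
  proof (cases "P i")
    case False
    have "Fs i \<inter> Bs i = {}" using ins False by (auto simp: P_def Fs_def)
    then have "card (Fs i) + card (Bs i) = card (Fs i \<union> Bs i)" using fFB by (simp add: card_Un_disjoint)
    also have "\<dots> \<le> N" unfolding N_def using fFB(3,4)[of i] fY by (intro card_mono) auto
    finally show ?thesis using False by simp
  next
    case True
    then obtain y where y: "y \<in> Y" "blk c y i" by (auto simp: P_def)
    have yFB: "y \<in> Fs i" "y \<in> Bs i" using blk_fr[OF c y(2)] blk_bk[OF c y(2)] y(1) by (auto simp: Fs_def Bs_def)
    have "Fs i \<inter> Bs i \<subseteq> {y}" using ins[of _ i] blk_unique y(2) by blast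
    then have di: "(Fs i - {y}) \<inter> (Bs i - {y}) = {}" by auto
    have c1: "card (Fs i) + card (Bs i) = 2 + (card (Fs i - {y}) + card (Bs i - {y}))"
      using card_Suc_Diff1[OF fFB(1) yFB(1)] card_Suc_Diff1[OF fFB(2) yFB(2)] by simp
    have "card (Fs i - {y}) + card (Bs i - {y}) = card ((Fs i - {y}) \<union> (Bs i - {y}))"
      using fFB di by (simp add: card_Un_disjoint)
    also have "\<dots> \<le> card (Y - {y})" using fFB(3,4)[of i] fY by (intro card_mono) auto
    also have "\<dots> = N - 1" using y fY by (simp add: N_def)
    finally have c2: "card (Fs i - {y}) + card (Bs i - {y}) \<le> N - 1" .
    have "card (Fs i - {y}) \<le> card {y\<in>Y. fr c y (i + 1) \<and> (\<exists>z\<in>Y. z \<noteq> y \<and> bk c z i)}"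
    proof (rule card_mono)
      have "bk c y i" using yFB by (simp add: Bs_def)
      then show "Fs i - {y} \<subseteq> {y\<in>Y. fr c y (i + 1) \<and> (\<exists>z\<in>Y. z \<noteq> y \<and> bk c z i)}"
        using y(1) unfolding Fs_def by (auto intro!: bexI[of _ y])
    qed (use fY in simp)
    moreover have "card (Bs i - {y}) \<le> card {y\<in>Y. bk c y i \<and> (\<exists>z\<in>Y. z \<noteq> y \<and> fr c z (i + 1))}"
    proof (rule card_mono)
      have "fr c y (i + 1)" using yFB by (simp add: Fs_def)
      then show "Bs i - {y} \<subseteq> {y\<in>Y. bk c y i \<and> (\<exists>z\<in>Y. z \<noteq> y \<and> fr c z (i + 1))}"
        using y(1) unfolding Bs_def by (auto intro!: bexI[of _ y])
    qed (use fY in simp)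
    ultimately have "card (Fs i - {y}) + card (Bs i - {y}) \<le> t i" unfolding t_def by linarith
    then show ?thesis using True c1 c2 by simp
  qed
  define T where "T = (\<Sum>i\<in>{i\<in>?I. P i}. min (N - 1) (t i))"
  have T1: "T \<le> (N - 1) * \<beta>"
    using sum_bounded_above[of "{i\<in>?I. P i}" "\<lambda>i. min (N - 1) (t i)" "N - 1"] unfolding T_def \<beta>_def by (simp add: mult.commute)
  have T2: "T \<le> 4 * N"
  proof -
    have "T \<le> (\<Sum>i\<in>{i\<in>?I. P i}. t i)" unfolding T_def by (rule sum_mono) simp
    also have "\<dots> \<le> (\<Sum>i\<in>?I. t i)" by (rule sum_mono2) auto
    also have "\<dots> = (\<Sum>y\<in>Y. card {i\<in>?I. fr c y (i + 1) \<and> (\<exists>z\<in>Y. z \<noteq> y \<and> bk c z i)}) + (\<Sum>y\<in>Y. card {i\<in>?I. bk c y i \<and> (\<exists>z\<in>Y. z \<noteq> y \<and> fr c z (i + 1))})"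
      unfolding t_def sum.distrib using sum_card_swap[OF fY, of ?I] by simp
    also have "\<dots> \<le> (\<Sum>y\<in>Y. 2) + (\<Sum>y\<in>Y. 2)"
      unfolding Y_def by (intro add_mono sum_mono card_cross_fr[OF c q_def r] card_cross_bk[OF c q_def r])
    also have "\<dots> = 4 * N" by (simp add: N_def)
    finally show ?thesis .
  qed
  have cnt: "2 * D \<le> int N * (q - int \<beta>) + 4 * int \<beta> + int T"
  proof -
    have "2 * (\<Sum>y\<in>Y. d y) = (\<Sum>y\<in>Y. card {i\<in>?I. fr c y (i + 1)} + card {i\<in>?I. bk c y i} + 2 * b y)"
      unfolding sum_distrib_left
    proof (rule sum.cong[OF refl])
      fix y show "2 * d y = card {i\<in>?I. fr c y (i + 1)} + card {i\<in>?I. bk c y i} + 2 * b y" using fb[of y] by linarith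
    qed
    also have "\<dots> = (\<Sum>y\<in>Y. card {i\<in>?I. fr c y (i + 1)}) + (\<Sum>y\<in>Y. card {i\<in>?I. bk c y i}) + 2 * \<beta>"
      unfolding sb[symmetric] by (simp add: sum.distrib sum_distrib_left)
    also have "\<dots> = (\<Sum>i\<in>?I. card (Fs i) + card (Bs i)) + 2 * \<beta>"
      unfolding Fs_def Bs_def using sum_card_swap[OF fY, of ?I] by (simp add: sum.distrib)
    also have "\<dots> \<le> (\<Sum>i\<in>?I. if P i then 2 + min (N - 1) (t i) else N) + 2 * \<beta>"
      using s by (intro add_right_mono sum_mono)
    also have "(\<Sum>i\<in>?I. if P i then 2 + min (N - 1) (t i) else N) = 2 * \<beta> + T + N * card {i\<in>?I. \<not> P i}"
    proof -
      have e: "?I \<inter> {i. P i} = {i\<in>?I. P i}" "?I \<inter> - {i. P i} = {i\<in>?I. \<not> P i}" by auto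
      show ?thesis unfolding sum.If_cases[OF finite_atLeastLessThan_int] e sum.distrib T_def \<beta>_def
        by (simp add: mult.commute)
    qed
    finally have f: "2 * (\<Sum>y\<in>Y. d y) \<le> 2 * \<beta> + T + N * card {i\<in>?I. \<not> P i} + 2 * \<beta>" .
    have "card {i\<in>?I. \<not> P i} + \<beta> = nat q"
    proof -
      have "{i\<in>?I. \<not> P i} \<union> {i\<in>?I. P i} = ?I" "{i\<in>?I. \<not> P i} \<inter> {i\<in>?I. P i} = {}" by auto
      then show ?thesis using card_Un_disjoint[of "{i\<in>?I. \<not> P i}" "{i\<in>?I. P i}"] unfolding \<beta>_def by simp
    qed
    then have "int (card {i\<in>?I. \<not> P i}) = q - int \<beta>" using q3 by linarith
    moreover have "2 * int (\<Sum>y\<in>Y. d y) \<le> 2 * int \<beta> + int T + int N * int (card {i\<in>?I. \<not> P i}) + 2 * int \<beta>"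
      using f by (metis (no_types, lifting) of_nat_add of_nat_le_iff of_nat_mult of_nat_numeral)
    ultimately show ?thesis unfolding D_def by simp
  qed
  consider "5 \<le> N" | "N = 4" | "N = 3" using N3 by linarith
  then show False
  proof cases
    case 1
    define nq where "nq = int N * q"
    define nb where "nb = int N * int \<beta>"
    have "0 \<le> (int N - 5) * int \<beta>" using 1 by simp
    then have "5 * int \<beta> \<le> nb" by (simp add: algebra_simps nb_def)
    moreover have "2 * D \<le> nq - nb + 4 * int \<beta> + int T" using cnt by (simp add: algebra_simps nq_def nb_def)
    moreover have "nq + int N + 2 * q + int \<mu> < 2 * D" using big by (simp add: algebra_simps nq_def)
    ultimately show False using T2 Nb bq by linarith
  next
    case 2
    then have a: "2 * D \<le> 4 * q + int T" using cnt by simp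
    have b: "6 * q + 4 < 2 * D" using big 2 by simp
    have "T \<le> 3 * \<beta>" "T \<le> 16" using T1 T2 2 by simp_all
    then have t: "int T \<le> 3 * q" "int T \<le> 16" using bq by linarith+
    then have "q < 6" "4 < q" using a b by linarith+
    then have "q = 5" by simp
    \<comment> \<open>Only parity excludes this value: \<open>2 * D\<close> would be 35.\<close>
    then have "2 * D \<le> 35" "34 < 2 * D" using a b t by linarith+
    then show False by presburger
  next
    case 3
    have S1: "2 * D \<le> 3 * q + int \<beta> + int T" using cnt 3 by simp
    have S2: "5 * q + 3 + int \<mu> < 2 * D" using big 3 by simp
    have T: "T \<le> 2 * \<beta>" "T \<le> 12" using T1 T2 3 by simp_all
    have beq: "int \<beta> = q"
    proof (rule ccontr)
      assume "int \<beta> \<noteq> q"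
      then have b: "int \<beta> \<le> q - 1" using bq by simp
      then have "6 < q" "q < 8" using S1 S2 T by linarith+
      then have "q = 7" by simp
      then have "2 * D \<le> 39" "38 < 2 * D" using S1 S2 T b by linarith+
      then show False by presburger
    qed
    have all: "\<exists>z\<in>Y. blk c z i" for i
    proof -
      have "card {i\<in>?I. P i} = card ?I" using beq q3 unfolding \<beta>_def by simp
      then have "{i\<in>?I. P i} = ?I" by (intro card_subset_eq) auto
      moreover have "i mod q \<in> ?I" using q3 by simp
      ultimately have "P (i mod q)" by blast
      moreover have "c (i mod q + 1) = c (i + 1)" unfolding cyc_eq_iff[OF c] by (simp add: mod_simps)
      ultimately show ?thesis unfolding P_def blk_def cyc_mod[OF c] by simp
    qed
    have opt: "2 * int (d y) \<le> 2 * int (b y) + int \<mu> + 4" if y: "y \<in> Y" for y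
    proof -
      have "{i\<in>?I. blk c y i} \<noteq> {}" using b1[OF y] unfolding b_def by (metis card.empty not_one_le_zero)
      then obtain g where g: "blk c y g" by blast
      let ?c = "\<lambda>i. c (i + g)"
      have rr: "range ?c = range c" by (rule range_shift)
      have "2 * card {i\<in>?I. bk ?c y i} \<le> card (missing (range ?c)) + 4"
        by (rule two_opt[OF cyc_shift[OF c] q_def]) (use rr r y g all in \<open>auto simp: Y_def blk_shift\<close>)
      moreover have "card {i\<in>?I. bk ?c y i} = card {i\<in>?I. bk c y i}"
        unfolding bk_shift using card_periodic_shift[of "bk c y" q g] cyc_periodic(2)[OF c] q3 by simp
      ultimately have "2 * card {i\<in>?I. bk c y i} \<le> \<mu> + 4" unfolding rr \<mu>_def by simp
      then show ?thesis using fb(2)[of y] by linarith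
    qed
    have "(\<Sum>y\<in>Y. 2 * int (d y)) \<le> (\<Sum>y\<in>Y. 2 * int (b y) + int \<mu> + 4)" by (rule sum_mono) (rule opt)
    then have "2 * D \<le> 2 * int \<beta> + 3 * int \<mu> + 12"
      using 3 unfolding D_def sb[symmetric] N_def by (simp add: sum.distrib sum_distrib_left[symmetric])
    \<comment> \<open>With the count this gives \<open>\<mu> < q - 3\<close>, whereas the exchange
      bound requires \<open>3 * q - 9 < 2 * \<mu>\<close>.\<close>
    moreover have "D \<le> 3 * q"
    proof -
      have "d y \<le> nat q" for y
        unfolding d_def using card_mono[OF cyc_card(1)[OF c], of "nb (range c) y"] cyc_card(2)[OF c] by (auto simp: nb_def)
      then have "(\<Sum>y\<in>Y. d y) \<le> N * nat q" using sum_bounded_above[of Y d "nat q"] by (simp add: N_def)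
      then have "(\<Sum>y\<in>Y. d y) \<le> 3 * nat q" using 3 by simp
      then show ?thesis using q3 unfolding D_def by linarith
    qed
    ultimately show False using S2 beq q3 by linarith
  qed
qed

subsection \<open>Paths on k vertices\<close>

definition pth :: "(int \<Rightarrow> 'a) \<Rightarrow> bool" where
  "pth v \<longleftrightarrow> inj_on v {1..int k} \<and> v ` {1..int k} \<subseteq> V
     \<and> (\<forall>i. 1 \<le> i \<and> i < int k \<longrightarrow> adj (v i) (v (i + 1)))
     \<and> (\<forall>i. 1 \<le> i \<and> i + 1 < int k \<longrightarrow> \<not> tri (v i) (v (i + 1)) (v (i + 2)))"

lemma pthD:
  assumes "pth v"
  shows "1 \<le> i \<Longrightarrow> i \<le> int k \<Longrightarrow> v i \<in> V"
    "1 \<le> i \<Longrightarrow> i < int k \<Longrightarrow> adj (v i) (v (i + 1))"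
    "1 \<le> i \<Longrightarrow> i + 1 < int k \<Longrightarrow> \<not> tri (v i) (v (i + 1)) (v (i + 2))"
    "1 \<le> i \<Longrightarrow> i \<le> int k \<Longrightarrow> 1 \<le> j \<Longrightarrow> j \<le> int k \<Longrightarrow> v i = v j \<longleftrightarrow> i = j"
  using assms unfolding pth_def inj_on_def by auto

definition rv :: "(int \<Rightarrow> 'a) \<Rightarrow> int \<Rightarrow> 'a" where
  "rv v i = v (int k + 1 - i)"

lemma rv_pth: "pth v \<Longrightarrow> pth (rv v)"
proof -
  assume p: "pth v"
  note D = pthD[OF p]
  have "inj_on (\<lambda>i. v (int k + 1 - i)) {1..int k}" unfolding inj_on_def using D(4) by auto
  moreover have "adj (v (int k + 1 - i)) (v (int k + 1 - (i + 1)))" if "1 \<le> i" "i < int k" for i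
  proof -
    have e: "int k + 1 - (i + 1) + 1 = int k + 1 - i" by simp
    have "adj (v (int k + 1 - (i + 1))) (v (int k + 1 - (i + 1) + 1))" by (rule D(2)) (use that in auto)
    then show ?thesis unfolding e by (rule adj_sym)
  qed
  moreover have "\<not> tri (v (int k + 1 - i)) (v (int k + 1 - (i + 1))) (v (int k + 1 - (i + 2)))" if "1 \<le> i" "i + 1 < int k" for i
  proof -
    have e: "int k + 1 - (i + 2) + 1 = int k + 1 - (i + 1)" "int k + 1 - (i + 2) + 2 = int k + 1 - i" by simp_all
    have "\<not> tri (v (int k + 1 - (i + 2))) (v (int k + 1 - (i + 2) + 1)) (v (int k + 1 - (i + 2) + 2))"
      by (rule D(3)) (use that in auto)
    then show ?thesis unfolding e using triD(5) by blast
  qed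
  moreover have "(\<lambda>i. v (int k + 1 - i)) ` {1..int k} \<subseteq> V" using D(1) by auto
  ultimately show ?thesis unfolding pth_def rv_def[abs_def] by blast
qed

lemma pth_walk: "pth v \<Longrightarrow> 1 \<le> a \<Longrightarrow> b \<le> int k \<Longrightarrow> walk (map v [a..b])"
  by (rule walk_map_upto) (use pthD in auto)

lemma pth_distinct_map:
  assumes "pth v" "distinct L" "set L \<subseteq> {1..int k}"
  shows "distinct (map v L)"
  unfolding distinct_map using assms(2) inj_on_subset[of v "{1..int k}" "set L"] assms(1,3) unfolding pth_def by blast

lemma no_long_cycle:
  assumes "distinct xs" "set xs \<subseteq> V" "walk xs" "adj (last xs) (hd xs)"
    "\<not> tri (last (butlast xs)) (last xs) (hd xs)" "\<not> tri (last xs) (hd xs) (hd (tl xs))"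
    "3 \<le> length xs" "k \<le> length xs + 2"
  shows False
proof -
  have "length xs \<le> k" by (rule path_bound) (use assms in auto)
  then have "int (length xs) = int k \<or> int (length xs) = int k - 1 \<or> int (length xs) = int k - 2"
    using assms(8) by linarith
  moreover obtain c where "cyc (int (length xs)) c" "range c = set xs" using cycI[OF assms(1,7,3-6)] by blast
  ultimately show False using no_cyc_k no_cyc_k1 no_cyc_k2 assms(2) by metis
qed

text \<open>The cycle runs up from \<open>v s\<close> to \<open>v t\<close>, jumps to
  \<open>v e\<close>, runs down to \<open>v r\<close> and jumps back. The free indices allow
  vertices next to blocked chords to be dropped, up to two of the \<open>k\<close>.\<close>

lemma join_cycle:
  assumes p: "pth v" and i: "1 \<le> s" "s \<le> t" "t < r" "r \<le> e" "e \<le> int k"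
    and a: "adj (v t) (v e)" "adj (v s) (v r)"
    and l: "s < t \<Longrightarrow> \<not> tri (v s) (v r) (v (s + 1))" "r < e \<Longrightarrow> \<not> tri (v s) (v r) (v (r + 1))"
    and m: "s < t \<Longrightarrow> \<not> tri (v t) (v e) (v (t - 1))" "r < e \<Longrightarrow> \<not> tri (v t) (v e) (v (e - 1))"
    and st: "s = t \<Longrightarrow> \<not> tri (v s) (v r) (v e)" and re: "r = e \<Longrightarrow> \<not> tri (v s) (v r) (v t)"
    and len: "3 \<le> (t - s + 1) + (e - r + 1)" "int k \<le> (t - s + 1) + (e - r + 1) + 2"
  shows False
proof -
  let ?xs = "map v [s..t] @ rev (map v [r..e])"
  have n: "s < t \<Longrightarrow> \<not> tri (v (t - 1)) (v t) (v e)" "r < e \<Longrightarrow> \<not> tri (v t) (v e) (v (e - 1))"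
    "r < e \<Longrightarrow> \<not> tri (v (r + 1)) (v r) (v s)" "s < t \<Longrightarrow> \<not> tri (v r) (v s) (v (s + 1))"
    using m l triD(3)[of "v (t-1)" "v t" "v e"] triD(5)[of "v (r+1)" "v r" "v s"] triD(1)[of "v r" "v s" "v (s+1)"]
    by auto
  have w: "walk ?xs" using i a n(1,2) pth_walk[OF p] by (simp add: walk_simps)
  have "distinct ([s..t] @ rev [r..e])" "set ([s..t] @ rev [r..e]) \<subseteq> {1..int k}" using i by auto
  then have "distinct (map v ([s..t] @ rev [r..e]))" by (rule pth_distinct_map[OF p])
  then have d: "distinct ?xs" by (simp add: rev_map)
  have V: "set ?xs \<subseteq> V" using pthD(1)[OF p] i by auto
  have st': "s = t \<Longrightarrow> \<not> tri (v r) (v s) (v e)" using st triD(1)[of "v r" "v s" "v e"] by blast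
  have re': "r = e \<Longrightarrow> \<not> tri (v t) (v r) (v s)" using re triD(5)[of "v t" "v r" "v s"] by blast
  have ends: "last ?xs = v r" "hd ?xs = v s" using i by (simp_all add: last_rev)
  have l2: "last (butlast ?xs) = (if r = e then v t else v (r + 1))"
    using i by (auto simp: butlast_append butlast_rev last_rev)
  have h2: "hd (tl ?xs) = (if s = t then v e else v (s + 1))"
    using i by (auto simp: hd_append hd_rev)
  have len': "int (length ?xs) = (t - s + 1) + (e - r + 1)" using i by simp
  show False
  proof (rule no_long_cycle[OF d V w])
    show "adj (last ?xs) (hd ?xs)" unfolding ends using a(2) by (rule adj_sym)
    show "\<not> tri (last (butlast ?xs)) (last ?xs) (hd ?xs)" unfolding ends l2 using re' n(3) i by auto
    show "\<not> tri (last ?xs) (hd ?xs) (hd (tl ?xs))" unfolding ends h2 using st' n(4) i by auto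
    show "3 \<le> length ?xs" "k \<le> length ?xs + 2" using len' len by linarith+
  qed
qed

lemma pth_tri_unique:
  assumes p: "pth v" and t: "tri (v a) (v b) (v x)" "tri (v a) (v b) (v y)"
    and i: "1 \<le> x" "x \<le> int k" "1 \<le> y" "y \<le> int k"
  shows "x = y"
  using tri_unique[OF t] pthD(4)[OF p i] by simp

text \<open>If the closing edge lies in a triple with an end edge of the path, the third pair of
  that triple closes the path without its first or last vertex.\<close>

lemma ends_nonadj:
  assumes p: "pth v"
  shows "\<not> adj (v 1) (v (int k))"
proof
  assume a: "adj (v 1) (v (int k))"
  note D = pthD[OF p]
  have e: "int k - 2 + 1 = int k - 1" "int k - 2 + 2 = int k" "int k - 3 + 1 = int k - 2" "int k - 3 + 2 = int k - 1" "int k - 1 + 1 = int k" by simp_all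
  have ad: "adj (v 1) (v 2)" "adj (v (int k - 2)) (v (int k - 1))" "adj (v (int k - 1)) (v (int k))"
    using D(2)[of 1] D(2)[of "int k - 2"] D(2)[of "int k - 1"] k4 by (simp_all add: e)
  have t: "\<not> tri (v (int k - 1)) (v (int k)) (v (int k - 2))" "\<not> tri (v (int k - 2)) (v (int k - 1)) (v (int k - 3))"
    using D(3)[of "int k - 2"] D(3)[of "int k - 3"] triD(4)[of "v (int k - 1)" "v (int k)" "v (int k - 2)"]
      triD(4)[of "v (int k - 2)" "v (int k - 1)" "v (int k - 3)"] k4 by (auto simp: e)
  consider "tri (v 1) (v (int k)) (v 2)" | "tri (v 1) (v (int k)) (v (int k - 1))"
    | "\<not> tri (v 1) (v (int k)) (v 2)" "\<not> tri (v 1) (v (int k)) (v (int k - 1))" by blast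
  then show False
  proof cases
    case 1
    have u: "\<not> tri (v 2) (v (int k)) (v j)" if "1 < j" "j \<le> int k" for j
      using pth_tri_unique[OF p triD(5)[OF 1], of j] that k4 by auto
    show False
      by (rule join_cycle[OF p, of 2 "int k - 1" "int k" "int k"]) (use k4 ad t u tri_adjs(6)[OF 1] in \<open>auto simp: e\<close>)
  next
    case 2
    have u: "\<not> tri (v 1) (v (int k - 1)) (v j)" if "1 \<le> j" "j < int k" for j
      using pth_tri_unique[OF p triD(2)[OF 2], of j] that k4 by auto
    show False
      by (rule join_cycle[OF p, of 1 "int k - 2" "int k - 1" "int k - 1"]) (use k4 ad t u tri_adjs(3)[OF 2] in \<open>auto simp: e\<close>)
  next
    case 3
    show False
      by (rule join_cycle[OF p, of 1 "int k - 1" "int k" "int k"]) (use k4 ad t 3 a in \<open>auto simp: e\<close>)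
  qed
qed

text \<open>Each of the two chords may be blocked on one side (\<open>A\<close> or \<open>B\<close>,
  \<open>C\<close> or \<open>E\<close>). The third pair of the blocking triple then replaces the
  chord and skips one vertex; \<open>s\<close>, \<open>r\<close>, \<open>t\<close>, \<open>e\<close>
  record the choice. At least \<open>k - 2\<close> vertices remain on the cycle.\<close>

lemma no_cross:
  assumes p: "pth v" and i: "1 \<le> i" "i < int k" and a: "adj (v 1) (v (i + 1))" "adj (v (int k)) (v i)"
  shows False
proof -
  note D = pthD[OF p]
  note nonadj = ends_nonadj[OF p]
  have i2: "2 \<le> i" "i \<le> int k - 2"
  proof -
    have "i \<noteq> 1" "i \<noteq> int k - 1" using nonadj a adj_sym by auto
    then show "2 \<le> i" "i \<le> int k - 2" using i by auto
  qed
  define A where "A \<longleftrightarrow> tri (v 1) (v (i + 1)) (v 2)"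
  define B where "B \<longleftrightarrow> tri (v 1) (v (i + 1)) (v (i + 2))"
  define C where "C \<longleftrightarrow> tri (v (int k)) (v i) (v (int k - 1))"
  define E where "E \<longleftrightarrow> tri (v (int k)) (v i) (v (i - 1))"
  have A3: "3 \<le> i" if A
  proof (rule ccontr)
    assume "\<not> 3 \<le> i"
    then have "i = 2" using i2 by simp
    then show False using D(3)[of 1] that k4 triD(2)[of "v 1" "v 3" "v 2"] unfolding A_def by auto
  qed
  have B3: "i + 3 \<le> int k" if B
  proof (rule ccontr)
    assume "\<not> i + 3 \<le> int k"
    then have "i + 2 = int k" using i2 by simp
    then show False using nonadj that tri_adjs(3) unfolding B_def by metis
  qed
  have C3: "i + 3 \<le> int k" if C
  proof (rule ccontr)
    assume "\<not> i + 3 \<le> int k"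
    then have "i = int k - 2" using i2 by simp
    moreover have "int k - 2 + 1 = int k - 1" "int k - 2 + 2 = int k" by simp_all
    ultimately show False using D(3)[of "int k - 2"] that k4 triD(3)[of "v (int k)" "v (int k - 2)" "v (int k - 1)"] unfolding C_def by auto
  qed
  have E3: "3 \<le> i" if E
  proof (rule ccontr)
    assume "\<not> 3 \<le> i"
    then have "i - 1 = 1" using i2 by simp
    then show False using nonadj that tri_adjs(4) unfolding E_def by metis
  qed
  obtain s r :: int where sr: "s = 1 \<and> r = i + 1 \<and> \<not> A \<and> \<not> B \<or> s = 2 \<and> r = i + 1 \<and> A \<or> s = 1 \<and> r = i + 2 \<and> B" by blast
  obtain t e :: int where te: "t = i \<and> e = int k \<and> \<not> C \<and> \<not> E \<or> t = i \<and> e = int k - 1 \<and> C \<or> t = i - 1 \<and> e = int k \<and> E" by blast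
  have aS: "adj (v s) (v r)" using sr a tri_adjs(6)[of "v 1" "v (i+1)" "v 2"] tri_adjs(3)[of "v 1" "v (i+1)" "v (i+2)"]
    unfolding A_def B_def by auto
  have aT: "adj (v t) (v e)" using te adj_sym[OF a(2)] tri_adjs(5)[of "v (int k)" "v i" "v (int k - 1)"] tri_adjs(4)[of "v (int k)" "v i" "v (i - 1)"]
    unfolding C_def E_def by auto
  have L: "s = 2 \<and> r = i + 1 \<and> j = 1 \<or> s = 1 \<and> r = i + 2 \<and> j = i + 1 \<or> s = 1 \<and> r = i + 1 \<and> j \<noteq> 2 \<and> j \<noteq> i + 2"
    if tj: "tri (v s) (v r) (v j)" and j: "1 \<le> j" "j \<le> int k" for j
    using sr
  proof (elim disjE conjE)
    assume s: "s = 2" "r = i + 1" A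
    then have "tri (v 2) (v (i+1)) (v 1)" unfolding A_def by (blast intro: triD(5))
    then have "j = 1" using pth_tri_unique[OF p, of 2 "i+1" j 1] tj j s k4 by simp
    then show ?thesis using s by simp
  next
    assume s: "s = 1" "r = i + 2" B
    then have "tri (v 1) (v (i+2)) (v (i+1))" unfolding B_def by (blast intro: triD(2))
    then have "j = i + 1" using pth_tri_unique[OF p, of 1 "i+2" j "i+1"] tj j s i2 by simp
    then show ?thesis using s by simp
  next
    assume s: "s = 1" "r = i + 1" "\<not> A" "\<not> B"
    then show ?thesis using tj unfolding A_def B_def by auto
  qed
  have R: "t = i \<and> e = int k - 1 \<and> j = int k \<or> t = i - 1 \<and> e = int k \<and> j = i \<or> t = i \<and> e = int k \<and> j \<noteq> int k - 1 \<and> j \<noteq> i - 1"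
    if tj: "tri (v t) (v e) (v j)" and j: "1 \<le> j" "j \<le> int k" for j
    using te
  proof (elim disjE conjE)
    assume s: "t = i" "e = int k - 1" C
    then have "tri (v i) (v (int k - 1)) (v (int k))" unfolding C_def by (blast intro: triD(3))
    then have "j = int k" using pth_tri_unique[OF p, of i "int k - 1" j "int k"] tj j s k4 by simp
    then show ?thesis using s by simp
  next
    assume s: "t = i - 1" "e = int k" E
    then have "tri (v (i - 1)) (v (int k)) (v i)" unfolding E_def by (blast intro: triD(4))
    then have "j = i" using pth_tri_unique[OF p, of "i - 1" "int k" j i] tj j s i2 by simp
    then show ?thesis using s by simp
  next
    assume s: "t = i" "e = int k" "\<not> C" "\<not> E"
    then show ?thesis using tj triD(1)[of "v i" "v (int k)" "v j"] unfolding C_def E_def by auto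
  qed
  have rng: "1 \<le> s" "s \<le> t" "t < r" "r \<le> e" "e \<le> int k" "3 \<le> (t - s + 1) + (e - r + 1)" "int k \<le> (t - s + 1) + (e - r + 1) + 2"
    using sr te i2 A3 B3 C3 E3 k4 by auto
  show False
  proof (rule join_cycle[OF p rng(1-5) aT aS _ _ _ _ _ _ rng(6,7)])
    show "\<not> tri (v s) (v r) (v (s + 1))" if "s < t"
      using L[of "s + 1"] that sr te rng i2 by auto
    show "\<not> tri (v s) (v r) (v (r + 1))" if "r < e"
      using L[of "r + 1"] that sr te rng i2 by auto
    show "\<not> tri (v t) (v e) (v (t - 1))" if "s < t"
      using R[of "t - 1"] that sr te rng i2 by auto
    show "\<not> tri (v t) (v e) (v (e - 1))" if "r < e"
      using R[of "e - 1"] that sr te rng i2 by auto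
    show "\<not> tri (v s) (v r) (v e)" if "s = t"
      using L[of e] that sr te rng i2 A3 B3 C3 E3 by auto
    show "\<not> tri (v s) (v r) (v t)" if "r = e"
      using L[of t] that sr te rng i2 A3 B3 C3 E3 by auto
  qed
qed

section \<open>Neighbourhoods of the two ends of a path on k vertices\<close>

definition out :: "(int \<Rightarrow> 'a) \<Rightarrow> 'a \<Rightarrow> bool" where
  "out v x \<longleftrightarrow> x \<in> V \<and> x \<notin> v ` {1..int k} \<and> tri (v 1) (v 2) x"

text \<open>
  As in the crossing argument for longest paths, \<open>Sset\<close> records the predecessors of the neighbours of the
  first vertex and \<open>Tset\<close> the neighbours of the last one, so that a common index closes a cycle.
\<close>

definition Sset :: "(int \<Rightarrow> 'a) \<Rightarrow> int set" where
  "Sset v = {i\<in>{1..<int k}. adj (v 1) (v (i + 1))}"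

definition Tset :: "(int \<Rightarrow> 'a) \<Rightarrow> int set" where
  "Tset v = {i\<in>{1..<int k}. adj (v (int k)) (v i)}"

lemma rv_rv [simp]: "rv (rv v) = v"
  by (simp add: rv_def fun_eq_iff)

lemma fin_ST [simp]: "finite (Sset v)" "finite (Tset v)"
  unfolding Sset_def Tset_def by simp_all

lemma card_Tset_rv: "card (Tset v) = card (Sset (rv v))"
proof -
  have "Tset v = (\<lambda>i. int k - i) ` Sset (rv v)"
  proof (intro equalityI subsetI)
    fix i assume i: "i \<in> Tset v"
    have "rv v 1 = v (int k)" "rv v (int k - i + 1) = v i" by (simp_all add: rv_def)
    then have "int k - i \<in> Sset (rv v)" using i by (simp add: Sset_def Tset_def)
    then show "i \<in> (\<lambda>i. int k - i) ` Sset (rv v)" by (rule rev_image_eqI) simp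
  next
    fix i assume "i \<in> (\<lambda>i. int k - i) ` Sset (rv v)"
    then show "i \<in> Tset v" by (auto simp: Sset_def Tset_def rv_def)
  qed
  then show ?thesis by (simp add: card_image inj_on_def)
qed

lemma ST_disjoint: "pth v \<Longrightarrow> Sset v \<inter> Tset v = {}"
  using no_cross[of v] unfolding Sset_def Tset_def by auto

lemma ST_card: "pth v \<Longrightarrow> card (Sset v) + card (Tset v) \<le> k - 1"
proof -
  assume p: "pth v"
  have "card (Sset v \<union> Tset v) \<le> card {1..<int k}" by (rule card_mono) (auto simp: Sset_def Tset_def)
  then show ?thesis using ST_disjoint[OF p] by (simp add: card_Un_disjoint)
qed

text \<open>Otherwise \<open>x\<close> would prolong the path.\<close>

lemma nb_end:
  assumes p: "pth v" and x: "x \<in> V" "x \<notin> v ` {1..int k}" "adj x (v 1)"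
  shows "out v x"
proof -
  have "tri x (v 1) (v 2)"
  proof (rule ccontr)
    assume n: "\<not> tri x (v 1) (v 2)"
    let ?p = "x # map v [1..int k]"
    have "walk ?p" using x(3) n k4 pth_walk[OF p, of 1 "int k"] by (subst walk_Cons) auto
    moreover have "distinct (map v [1..int k])" by (rule pth_distinct_map[OF p]) auto
    then have "distinct ?p" using x(2) by simp
    moreover have "set ?p \<subseteq> V" using x(1) pthD(1)[OF p] by auto
    ultimately have "length ?p \<le> k" by (rule path_bound)
    then show False by simp
  qed
  then show ?thesis using x triD(3) by (simp add: out_def)
qed

lemma deg_end:
  assumes p: "pth v"
  shows "deg (v 1) = card (Sset v) + (if \<exists>x. out v x then 1 else 0)"
proof -
  let ?X = "{x. out v x}" and ?P = "v ` ((\<lambda>i. i + 1) ` Sset v)"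
  have "nb V (v 1) = ?P \<union> ?X"
  proof (intro equalityI subsetI)
    fix x assume x: "x \<in> nb V (v 1)"
    show "x \<in> ?P \<union> ?X"
    proof (cases "x \<in> v ` {1..int k}")
      case True
      then obtain j where j: "x = v j" "1 \<le> j" "j \<le> int k" by auto
      have "j \<noteq> 1" using x j adj_irrefl by (auto simp: nb_def)
      then have "j - 1 \<in> Sset v" "x = v (j - 1 + 1)" using x j by (auto simp: Sset_def nb_def)
      then show ?thesis by blast
    next
      case False
      then show ?thesis using nb_end[OF p _ False] x adj_sym by (auto simp: nb_def)
    qed
  next
    fix x assume "x \<in> ?P \<union> ?X"
    then show "x \<in> nb V (v 1)" using pthD(1)[OF p] tri_adjs(3) by (auto simp: Sset_def out_def nb_def)
  qed
  moreover have "?P \<inter> ?X = {}"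
  proof -
    have "?P \<subseteq> v ` {1..int k}" by (auto simp: Sset_def)
    then show ?thesis by (auto simp: out_def)
  qed
  moreover have "card ?P = card (Sset v)"
  proof -
    have "inj_on v ((\<lambda>i. i + 1) ` Sset v)"
      using p unfolding pth_def by (rule_tac inj_on_subset[of v "{1..int k}"]) (auto simp: Sset_def)
    then show ?thesis by (simp add: card_image)
  qed
  moreover have "?X = {} \<or> (\<exists>x. ?X = {x})" using tri_unique unfolding out_def by blast
  then have "card ?X = (if \<exists>x. out v x then 1 else 0)" "finite ?X" by auto
  ultimately show ?thesis using card_Un_disjoint[of ?P ?X] by simp
qed

text \<open>The triple on \<open>x\<close> and \<open>v 2\<close> is completed by
  \<open>v 1\<close>, hence not by \<open>v 3\<close>, so \<open>x\<close> can take the first place;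
  the two vertices exchange roles.\<close>

lemma replace_pth:
  assumes p: "pth v" and x: "out v x"
  shows "pth (v(1 := x))" "out (v(1 := x)) (v 1)"
proof -
  note D = pthD[OF p]
  have xn: "x \<noteq> v i" if "1 \<le> i" "i \<le> int k" for i using x that by (auto simp: out_def)
  have t: "tri (v 1) (v 2) x" using x by (simp add: out_def)
  have "inj_on (v(1 := x)) {1..int k}"
    unfolding inj_on_def using D(4) xn by (auto simp: fun_upd_def) (metis xn)+
  moreover have "(v(1 := x)) ` {1..int k} \<subseteq> V" using D(1) x by (auto simp: out_def)
  moreover have "adj ((v(1 := x)) i) ((v(1 := x)) (i + 1))" if "1 \<le> i" "i < int k" for i
    using D(2)[of i] that tri_adjs(6)[OF t] by auto
  moreover have "\<not> tri ((v(1 := x)) i) ((v(1 := x)) (i + 1)) ((v(1 := x)) (i + 2))" if "1 \<le> i" "i + 1 < int k" for i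
  proof (cases "i = 1")
    case True
    have "\<not> tri x (v 2) (v 3)"
    proof
      assume "tri x (v 2) (v 3)"
      then have "v 3 = v 1" using tri_unique[OF _ triD(5)[OF t]] by blast
      then show False using D(4)[of 3 1] k4 by simp
    qed
    then show ?thesis using True by simp
  qed (use D(3)[of i] that in auto)
  ultimately show "pth (v(1 := x))" unfolding pth_def by blast
  have "v 1 \<notin> (v(1 := x)) ` {1..int k}" using D(4)[of 1] xn[of 1] k4 by (auto simp: image_iff)
  then show "out (v(1 := x)) (v 1)" using D(1)[of 1] k4 triD(5)[OF t] by (simp add: out_def)
qed

lemma replace_Tset:
  assumes p: "pth v" and x: "out v x"
  shows "Tset (v(1 := x)) = Tset v"
proof -
  have "\<not> adj (v 1) (v (int k))" "\<not> adj x (v (int k))"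
    using ends_nonadj[OF p] ends_nonadj[OF replace_pth(1)[OF assms]] k4 by auto
  then have "\<not> adj (v (int k)) (v 1)" "\<not> adj (v (int k)) x" using adj_sym by blast+
  then show ?thesis using k4 by (auto simp: Tset_def)
qed

text \<open>Each of \<open>v 1\<close> and \<open>x\<close> has the other as its only neighbour off
  the path it starts, so each degree is one more than the size of its \<open>Sset\<close>. The bound
  for an adjacent pair gives the sum.\<close>

lemma Sset_pair_ge:
  assumes p: "pth v" and x: "out v x"
  shows "k - 1 \<le> card (Sset v) + card (Sset (v(1 := x)))"
proof -
  have "deg (v 1) = card (Sset v) + 1" using deg_end[OF p] x by auto
  moreover have "deg x = card (Sset (v(1 := x))) + 1"
    using deg_end[OF replace_pth(1)[OF assms]] replace_pth(2)[OF assms] by auto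
  moreover have "adj (v 1) x" "v 1 \<in> V" "x \<in> V" "v 1 \<noteq> x"
    using x tri_adjs(3) tri_neq(2) pthD(1)[OF p, of 1] k4 by (auto simp: out_def)
  ultimately show ?thesis using deg_pair_gt[of "v 1" x] k4 by simp
qed

text \<open>Without such a vertex the degree of \<open>v 1\<close> puts more than
  \<open>(k - 1) / 2\<close> elements into \<open>Sset\<close>. Disjointness from
  \<open>Tset\<close> then leaves too few for the other end, whether alone or together with its
  replacement.\<close>

lemma end_out:
  assumes p: "pth v"
  shows "\<exists>x. out v x"
proof (rule ccontr)
  assume n: "\<nexists>x. out v x"
  let ?w = "rv v"
  have pw: "pth ?w" by (rule rv_pth[OF p])
  have d: "deg (v 1) = card (Sset v)" using deg_end[OF p] n by simp
  have V: "v 1 \<in> V" "?w 1 \<in> V" using pthD(1)[OF p, of 1] pthD(1)[OF pw, of 1] k4 by auto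
  have t1: "k - 1 < 2 * card (Sset v)" using deg_gt[OF V(1)] d by simp
  have Tw: "card (Tset ?w) = card (Sset v)" using card_Tset_rv[of ?w] by simp
  show False
  proof (cases "\<exists>x. out ?w x")
    case False
    then have "deg (?w 1) = card (Sset ?w)" using deg_end[OF pw] by simp
    then have "k - 1 < 2 * card (Sset ?w)" using deg_gt[OF V(2)] by simp
    then show False using t1 ST_card[OF pw] Tw by linarith
  next
    case True
    then obtain x where x: "out ?w x" by blast
    have "card (Sset ?w) + card (Sset v) \<le> k - 1" using ST_card[OF pw] Tw by simp
    moreover have "card (Sset (?w(1 := x))) + card (Sset v) \<le> k - 1"
      using ST_card[OF replace_pth(1)[OF pw x]] replace_Tset[OF pw x] Tw by simp
    ultimately show False using Sset_pair_ge[OF pw x] t1 by linarith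
  qed
qed

text \<open>A common vertex would close \<open>v 2, ..., v (k - 1)\<close> to a cycle on
  \<open>k - 1\<close> vertices.\<close>

lemma out_distinct:
  assumes p: "pth v" and x: "out v x" and y: "out (rv v) y"
  shows "x \<noteq> y"
proof
  assume "x = y"
  note D = pthD[OF p]
  have t: "tri (v 1) (v 2) x" "tri (v (int k)) (v (int k - 1)) x"
    using x y \<open>x = y\<close> by (simp_all add: out_def rv_def)
  have xn: "x \<noteq> v i" if "1 \<le> i" "i \<le> int k" for i using x that by (auto simp: out_def)
  let ?xs = "map v [2..int k - 1] @ [x]"
  have n1: "\<not> tri (v (int k - 2)) (v (int k - 1)) x"
  proof
    assume "tri (v (int k - 2)) (v (int k - 1)) x"
    then have "v (int k - 2) = v (int k)" by (rule tri_unique1[OF _ t(2)])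
    then show False using D(4)[of "int k - 2" "int k"] k4 by simp
  qed
  have n2: "\<not> tri (v (int k - 1)) x (v 2)"
  proof
    assume "tri (v (int k - 1)) x (v 2)"
    then have "v (int k - 1) = v 1" by (rule tri_unique1[OF _ triD(2)[OF t(1)]])
    then show False using D(4)[of "int k - 1" 1] k4 by simp
  qed
  have n3: "\<not> tri x (v 2) (v 3)"
  proof
    assume "tri x (v 2) (v 3)"
    then have "v 3 = v 1" by (rule tri_unique[OF _ triD(5)[OF t(1)]])
    then show False using D(4)[of 3 1] k4 by simp
  qed
  show False
  proof (rule no_long_cycle[of ?xs])
    have "distinct (map v [2..int k - 1])" by (rule pth_distinct_map[OF p]) auto
    moreover have "x \<notin> v ` {2..int k - 1}" using x by (auto simp: out_def)
    ultimately show "distinct ?xs" by simp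
    show "set ?xs \<subseteq> V" using D(1) x by (auto simp: out_def)
    show "walk ?xs" using n1 k4 pth_walk[OF p, of 2 "int k - 1"] tri_adjs(5)[OF t(2)] by (simp add: walk_simps)
    show "adj (last ?xs) (hd ?xs)" using tri_adjs(6)[OF t(1)] k4 by (simp add: hd_append)
    show "\<not> tri (last (butlast ?xs)) (last ?xs) (hd ?xs)" using n2 k4 by (simp add: hd_append butlast_append)
    show "\<not> tri (last ?xs) (hd ?xs) (hd (tl ?xs))" using n3 k4 by (simp add: hd_append)
  qed (use k4 in auto)
qed

text \<open>Each end can be exchanged for its outside partner, and all four combinations are paths.
  Four upper bounds \<open>k - 1\<close> for sums across the path and two lower bounds
  \<open>k - 1\<close> for sums at one end force all sizes to be equal.\<close>

lemma Sset_half: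
  assumes p: "pth v"
  shows "2 * card (Sset v) = k - 1" "Sset v \<union> Tset v = {1..<int k}"
proof -
  let ?w = "rv v"
  have pw: "pth ?w" by (rule rv_pth[OF p])
  obtain x y where x: "out v x" and y: "out ?w y" using end_out[OF p] end_out[OF pw] by blast
  let ?v = "v(1 := x)"
  have pv: "pth ?v" by (rule replace_pth(1)[OF p x])
  have xy: "x \<noteq> y" by (rule out_distinct[OF p x y])
  have k1: "rv v 1 = v (int k)" "rv ?v 1 = v (int k)" "rv v 2 = v (int k - 1)" "rv ?v 2 = v (int k - 1)"
    using k4 by (simp_all add: rv_def)
  have img: "rv u ` {1..int k} = u ` {1..int k}" for u
  proof (intro equalityI subsetI)
    fix z assume "z \<in> u ` {1..int k}"
    then obtain i where i: "i \<in> {1..int k}" "z = u i" by blast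
    then have "int k + 1 - i \<in> {1..int k}" "z = rv u (int k + 1 - i)" by (auto simp: rv_def)
    then show "z \<in> rv u ` {1..int k}" by blast
  qed (auto simp: rv_def)
  \<comment> \<open>Here \<open>x \<noteq> y\<close> is essential: \<open>y\<close> stays off the
    path after \<open>x\<close> has been put on it.\<close>
  have yv: "out (rv ?v) y"
    using y xy unfolding out_def img k1 by auto
  have pz: "pth ((rv ?v)(1 := y))" by (rule replace_pth(1)[OF rv_pth[OF pv] yv])
  have pwy: "pth ((rv v)(1 := y))" by (rule replace_pth(1)[OF pw y])
  have same: "Sset ((rv ?v)(1 := y)) = Sset ((rv v)(1 := y))"
  proof -
    have e: "rv ?v (int k) = x" "rv v (int k) = v 1" by (simp_all add: rv_def)
    have "\<not> adj y x" "\<not> adj y (v 1)" using ends_nonadj[OF pz] ends_nonadj[OF pwy] e k4 by auto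
    moreover have "rv ?v i = rv v i" if "i \<noteq> int k" for i using that by (simp add: rv_def)
    ultimately show ?thesis using e k4 by (auto simp: Sset_def) (metis)+
  qed
  have T1: "card (Tset v) = card (Sset ?w)" by (rule card_Tset_rv)
  have T2: "card (Tset ?w) = card (Sset v)" using card_Tset_rv[of ?w] by simp
  have T3: "card (Tset (rv ?v)) = card (Sset ?v)" using card_Tset_rv[of "rv ?v"] by simp
  have "card (Sset v) + card (Sset ?w) \<le> k - 1" using ST_card[OF p] T1 by simp
  moreover have "card (Sset ?v) + card (Sset ?w) \<le> k - 1" using ST_card[OF pv] replace_Tset[OF p x] T1 by simp
  moreover have "card (Sset (?w(1 := y))) + card (Sset v) \<le> k - 1" using ST_card[OF pwy] replace_Tset[OF pw y] T2 by simp
  moreover have "card (Sset (?w(1 := y))) + card (Sset ?v) \<le> k - 1"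
    using ST_card[OF pz] replace_Tset[OF rv_pth[OF pv] yv] T3 same by simp
  moreover have "k - 1 \<le> card (Sset v) + card (Sset ?v)" by (rule Sset_pair_ge[OF p x])
  moreover have "k - 1 \<le> card (Sset ?w) + card (Sset (?w(1 := y)))" by (rule Sset_pair_ge[OF pw y])
  ultimately have h: "2 * card (Sset v) = k - 1" "card (Sset v) = card (Sset ?w)" by linarith+
  then show "2 * card (Sset v) = k - 1" by simp
  show "Sset v \<union> Tset v = {1..<int k}"
  proof (rule card_subset_eq)
    show "card (Sset v \<union> Tset v) = card {1..<int k}"
      using ST_disjoint[OF p] h T1 by (simp add: card_Un_disjoint)
  qed (auto simp: Sset_def Tset_def)
qed

lemma replace_Sset:
  assumes p: "pth v" and x: "out v x"
  shows "Sset (v(1 := x)) = Sset v"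
proof -
  have pv: "pth (v(1 := x))" by (rule replace_pth(1)[OF assms])
  have "Sset u = {1..<int k} - Tset u" if "pth u" for u
    using Sset_half(2)[OF that] ST_disjoint[OF that] by blast
  then show ?thesis using p pv replace_Tset[OF assms] by simp
qed

lemma Sset_rv: "i \<in> Sset (rv u) \<longleftrightarrow> int k - i \<in> Tset u"
proof -
  have "int k + 1 - (i + 1) = int k - i" by simp
  then show ?thesis by (auto simp: Sset_def Tset_def rv_def)
qed

lemma Tset_rv: "i \<in> Tset (rv u) \<longleftrightarrow> int k - i \<in> Sset u"
  using Sset_rv[of "int k - i" "rv u"] by simp

lemma replace_end:
  assumes p: "pth v" and y: "out (rv v) y"
  shows "pth (v(int k := y))" "Sset (v(int k := y)) = Sset v" "Tset (v(int k := y)) = Tset v"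
proof -
  let ?u = "(rv v)(1 := y)"
  have e: "v(int k := y) = rv ?u" by (auto simp: rv_def fun_eq_iff)
  have pw: "pth (rv v)" by (rule rv_pth[OF p])
  show "pth (v(int k := y))" unfolding e by (rule rv_pth[OF replace_pth(1)[OF pw y]])
  show "Sset (v(int k := y)) = Sset v" unfolding e
    by (rule set_eqI) (simp add: Sset_rv Tset_rv replace_Tset[OF pw y])
  show "Tset (v(int k := y)) = Tset v" unfolding e
    by (rule set_eqI) (simp add: Sset_rv Tset_rv replace_Sset[OF pw y])
qed

text \<open>The two chords close the path without \<open>v j\<close> to a cycle on
  \<open>k - 1\<close> vertices. Triples with the end edges cannot interfere, since their third
  vertices are off the path; the other two obstacles are excluded by \<open>P\<close> and
  \<open>Q\<close>.\<close>

lemma no_jump_aux: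
  assumes p: "pth v" and j: "j \<in> Sset v" "j - 1 \<in> Tset v"
    and P: "\<not> tri (v 1) (v (j + 1)) (v (j + 2))" and Q: "\<not> tri (v (j - 1)) (v (int k)) (v (j - 2))"
  shows False
proof -
  note D = pthD[OF p]
  have a: "adj (v 1) (v (j + 1))" "adj (v (j - 1)) (v (int k))" "2 \<le> j" "j < int k"
    using j adj_sym unfolding Sset_def Tset_def by auto
  have j2: "j \<noteq> 2" "j + 1 \<noteq> int k" using ends_nonadj[OF p] a by auto
  obtain x y where x: "out v x" and y: "out (rv v) y" using end_out[OF p] end_out[OF rv_pth[OF p]] by blast
  have "\<not> tri (v 1) (v (j + 1)) (v 2)"
  proof
    assume t: "tri (v 1) (v (j + 1)) (v 2)"
    have "v (j + 1) = x" by (rule tri_unique[OF triD(2)[OF t]]) (use x in \<open>simp add: out_def\<close>)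
    then show False using x a by (auto simp: out_def)
  qed
  moreover have "\<not> tri (v (j - 1)) (v (int k)) (v (int k - 1))"
  proof
    assume t: "tri (v (j - 1)) (v (int k)) (v (int k - 1))"
    have "v (j - 1) = y" by (rule tri_unique[OF triD(3)[OF t]]) (use y in \<open>simp add: out_def rv_def\<close>)
    then have "y = rv v (int k + 2 - j)" by (simp add: rv_def)
    then show False using y a by (auto simp: out_def)
  qed
  ultimately show False
    by (intro join_cycle[OF p, of 1 "j - 1" "j + 1" "int k"]) (use a j2 P Q k4 in \<open>auto simp: add.commute\<close>)
qed

text \<open>A triple violating \<open>P\<close> or \<open>Q\<close> contains an end of the path.
  Exchanging that end for its outside partner preserves \<open>Sset\<close> and \<open>Tset\<close>
  but destroys the triple.\<close>

lemma no_jump: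
  assumes p: "pth v" and j: "j \<in> Sset v" "j - 1 \<in> Tset v"
  shows False
proof -
  have mid: False if pu: "pth u" and ju: "j \<in> Sset u" "j - 1 \<in> Tset u"
    and P: "\<not> tri (u 1) (u (j + 1)) (u (j + 2))" for u
  proof (cases "tri (u (j - 1)) (u (int k)) (u (j - 2))")
    case False
    then show False using no_jump_aux[OF pu ju P] by simp
  next
    case True
    obtain y where y: "out (rv u) y" using end_out[OF rv_pth[OF pu]] by blast
    let ?w = "u(int k := y)"
    note w = replace_end[OF pu y]
    have jj: "2 \<le> j" "j < int k" using ju by (auto simp: Sset_def Tset_def)
    have "j + 1 \<noteq> int k"
    proof
      assume "j + 1 = int k"
      then have "adj (u 1) (u (int k))" using ju by (auto simp: Sset_def)
      then show False using ends_nonadj[OF pu] by simp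
    qed
    have "y \<noteq> u (int k)"
    proof -
      have "u (int k) = rv u 1" by (simp add: rv_def)
      then show ?thesis using y k4 by (auto simp: out_def)
    qed
    show False
    proof (rule no_jump_aux[OF w(1)])
      show "j \<in> Sset ?w" "j - 1 \<in> Tset ?w" using w ju by simp_all
      show "\<not> tri (?w 1) (?w (j + 1)) (?w (j + 2))"
      proof
        assume t: "tri (?w 1) (?w (j + 1)) (?w (j + 2))"
        show False
        proof (cases "j + 2 = int k")
          case True
          then show False using tri_adjs(3)[OF t] ends_nonadj[OF w(1)] by simp
        next
          case False
          then show False using t P \<open>j + 1 \<noteq> int k\<close> k4 by simp
        qed
      qed
      show "\<not> tri (?w (j - 1)) (?w (int k)) (?w (j - 2))"
      proof
        assume "tri (?w (j - 1)) (?w (int k)) (?w (j - 2))"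
        then have "tri (u (j - 1)) y (u (j - 2))" using jj by simp
        then have "y = u (int k)" by (rule tri_unique2[OF _ True])
        then show False using \<open>y \<noteq> u (int k)\<close> by simp
      qed
    qed
  qed
  show False
  proof (cases "tri (v 1) (v (j + 1)) (v (j + 2))")
    case False
    then show False using mid[OF p j] by simp
  next
    case True
    obtain x where x: "out v x" using end_out[OF p] by blast
    let ?w = "v(1 := x)"
    have jj: "2 \<le> j" using j by (auto simp: Tset_def)
    have "x \<noteq> v 1" using x k4 by (auto simp: out_def)
    show False
    proof (rule mid[OF replace_pth(1)[OF p x]])
      show "j \<in> Sset ?w" "j - 1 \<in> Tset ?w" using j replace_Sset[OF p x] replace_Tset[OF p x] by simp_all
      show "\<not> tri (?w 1) (?w (j + 1)) (?w (j + 2))"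
      proof
        assume "tri (?w 1) (?w (j + 1)) (?w (j + 2))"
        then have "tri x (v (j + 1)) (v (j + 2))" using jj by simp
        then have "x = v 1" by (rule tri_unique1[OF _ True])
        then show False using \<open>x \<noteq> v 1\<close> by simp
      qed
    qed
  qed
qed

text \<open>\<open>Sset\<close> and \<open>Tset\<close> partition the positions, and
  \<open>no_jump\<close> makes \<open>Sset\<close> closed downwards.\<close>

lemma Sset_interval:
  assumes p: "pth v"
  shows "\<exists>s\<ge>1. 2 * s = int k - 1 \<and> Sset v = {1..s}"
proof -
  have one: "1 \<in> Sset v" using pthD(2)[OF p, of 1] k4 by (simp add: Sset_def)
  define s where "s = Max (Sset v)"
  have s: "s \<in> Sset v" unfolding s_def using one by (intro Max_in) auto
  have le: "i \<le> s" if "i \<in> Sset v" for i unfolding s_def using that by simp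
  have "1 \<le> s" "s < int k" using s by (auto simp: Sset_def)
  have down: "1 \<le> i \<longrightarrow> i \<in> Sset v" if "i \<le> s" for i
    using that
  proof (induction i rule: int_le_induct)
    case base
    then show ?case using s by simp
  next
    case (step i)
    show ?case
    proof
      assume i: "1 \<le> i - 1"
      then have "i \<in> Sset v" using step by simp
      then have "i - 1 \<notin> Tset v" using no_jump[OF p] by blast
      then show "i - 1 \<in> Sset v" using Sset_half(2)[OF p] i step(1) \<open>s < int k\<close> by auto
    qed
  qed
  have S: "Sset v = {1..s}"
  proof (intro equalityI subsetI)
    fix i assume i: "i \<in> Sset v"
    then have "1 \<le> i" by (simp add: Sset_def)
    then show "i \<in> {1..s}" using le[OF i] by simp
  next
    fix i assume "i \<in> {1..s}"
    then show "i \<in> Sset v" using down[of i] by simp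
  qed
  then have "int (card (Sset v)) = s" using \<open>1 \<le> s\<close> by simp
  then have "2 * s = int k - 1" using Sset_half(1)[OF p] k4 by linarith
  then show ?thesis using S \<open>1 \<le> s\<close> by blast
qed

section \<open>Rotation of the path at its first half\<close>

text \<open>The first \<open>s\<close> vertices are reversed, and \<open>s \<in> Sset v\<close>
  supplies the new edge from \<open>v 1\<close> to \<open>v (s + 1)\<close>. It forms no triple with
  \<open>v 2\<close>, as the triple on \<open>v 1\<close> and \<open>v 2\<close> leaves the path,
  nor with \<open>v (s + 2)\<close>, which is no neighbour of \<open>v 1\<close>.\<close>

lemma rotate_pth:
  assumes p: "pth v" and s: "2 * s = int k - 1"
  defines "w \<equiv> \<lambda>i. if 1 \<le> i \<and> i \<le> s then v (s + 1 - i) else v i"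
  shows "pth w" "w ` {1..int k} = v ` {1..int k}"
proof -
  note D = pthD[OF p]
  have s2: "2 \<le> s" "s + 1 < int k" using s k4 by auto
  obtain s' where s': "2 * s' = int k - 1" "Sset v = {1..s'}" using Sset_interval[OF p] by blast
  then have "s' = s" using s by linarith
  then have S: "Sset v = {1..s}" using s' by simp
  have "s \<in> Sset v" using S s2 by simp
  then have a: "adj (v 1) (v (s + 1))" by (simp add: Sset_def)
  have na: "\<not> adj (v 1) (v (s + 2))"
  proof
    assume "adj (v 1) (v (s + 2))"
    then have "s + 1 \<in> Sset v" using s2 by (simp add: Sset_def add.assoc)
    then show False using S by simp
  qed
  obtain x where x: "out v x" using end_out[OF p] by blast
  have nt: "\<not> tri (v 2) (v 1) (v (s + 1))"
  proof
    assume t: "tri (v 2) (v 1) (v (s + 1))"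
    have "v (s + 1) = x" by (rule tri_unique[OF triD(1)[OF t]]) (use x in \<open>simp add: out_def\<close>)
    then show False using x s2 by (auto simp: out_def)
  qed
  have w: "w i = v (if 1 \<le> i \<and> i \<le> s then s + 1 - i else i)" for i by (simp add: w_def)
  have "inj_on w {1..int k}"
    unfolding inj_on_def w using D(4) s2 by (auto split: if_splits)
  moreover show img: "w ` {1..int k} = v ` {1..int k}"
  proof (intro equalityI subsetI)
    fix z assume "z \<in> v ` {1..int k}"
    then obtain i where i: "1 \<le> i" "i \<le> int k" "z = v i" by auto
    then have "z = w (if i \<le> s then s + 1 - i else i)" "(if i \<le> s then s + 1 - i else i) \<in> {1..int k}"
      using s2 by (auto simp: w)
    then show "z \<in> w ` {1..int k}" by blast
  qed (use s2 in \<open>auto simp: w\<close>)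
  moreover have "adj (w i) (w (i + 1))" if i: "1 \<le> i" "i < int k" for i
  proof -
    consider "i < s" | "i = s" | "s < i" by linarith
    then show ?thesis
    proof cases
      case 1
      have e: "s - i + 1 = s + 1 - i" "s + 1 - (i + 1) = s - i" by simp_all
      have "adj (v (s - i)) (v (s + 1 - i))" using D(2)[of "s - i"] 1 i s2 unfolding e by simp
      from adj_sym[OF this] show ?thesis using 1 i by (simp add: w)
    qed (use a D(2)[of i] i s2 in \<open>auto simp: w\<close>)
  qed
  moreover have "\<not> tri (w i) (w (i + 1)) (w (i + 2))" if i: "1 \<le> i" "i + 1 < int k" for i
  proof -
    consider "i + 1 < s" | "i + 1 = s" | "i = s" | "s < i" by linarith
    then show ?thesis
    proof cases
      case 1
      have e: "s - i - 1 + 1 = s - i" "s - i - 1 + 2 = s + 1 - i" "s + 1 - (i + 1) = s - i" "s + 1 - (i + 2) = s - i - 1" by simp_all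
      have "\<not> tri (v (s - i - 1)) (v (s - i)) (v (s + 1 - i))"
        using D(3)[of "s - i - 1"] 1 i s2 unfolding e(1,2) by simp
      then have "\<not> tri (v (s + 1 - i)) (v (s - i)) (v (s - i - 1))" using triD(5)[of "v (s + 1 - i)"] by blast
      then show ?thesis using 1 i by (simp add: w e)
    next
      case 2
      then have e: "s + 1 - i = 2" "s + 1 - (i + 1) = 1" "i + 2 = s + 1" by simp_all
      have "w i = v 2" "w (i + 1) = v 1" "w (i + 2) = v (s + 1)" using 2 i unfolding w e by simp_all
      then show ?thesis using nt by simp
    next
      case 3
      have "\<not> tri (v 1) (v (s + 1)) (v (s + 2))" using na tri_adjs(3) by blast
      then show ?thesis using 3 i by (simp add: w)
    qed (use D(3)[of i] i in \<open>auto simp: w\<close>)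
  qed
  moreover have "v ` {1..int k} \<subseteq> V" using D(1) by auto
  ultimately show "pth w" unfolding pth_def by simp
qed

text \<open>The outside partner \<open>x\<close> of the rotated path can itself be put first there.
  The interval shape of its \<open>Sset\<close> makes it adjacent to position \<open>s\<close>,
  which holds \<open>v 1\<close>, so \<open>x\<close> is also the outside partner of
  \<open>v\<close>.\<close>

lemma rotate_out:
  assumes p: "pth v" and s: "2 * s = int k - 1" "3 \<le> s"
  shows "\<exists>x. out v x \<and> tri (v s) (v (s - 1)) x"
proof -
  define w where "w = (\<lambda>i. if 1 \<le> i \<and> i \<le> s then v (s + 1 - i) else v i)"
  have pw: "pth w" and img: "w ` {1..int k} = v ` {1..int k}"
    using rotate_pth[OF p s(1)] unfolding w_def by simp_all
  obtain x where x: "out w x" using end_out[OF pw] by blast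
  obtain s' where s': "2 * s' = int k - 1" "Sset (w(1 := x)) = {1..s'}"
    using Sset_interval[OF replace_pth(1)[OF pw x]] by blast
  then have "s' = s" using s by linarith
  then have "s - 1 \<in> Sset (w(1 := x))" using s' s by simp
  then have "adj x (w s)" using s by (simp add: Sset_def)
  moreover have "w s = v 1" "w 1 = v s" "w 2 = v (s - 1)" using s by (auto simp: w_def)
  moreover have "x \<in> V" "x \<notin> v ` {1..int k}" "tri (w 1) (w 2) x" using x img by (simp_all add: out_def)
  ultimately show ?thesis using nb_end[OF p, of x] by auto
qed

lemma no_pth: "pth v \<Longrightarrow> False"
proof -
  assume p: "pth v"
  obtain s where s: "2 * s = int k - 1" using Sset_interval[OF p] by blast
  have deg: "int (deg (u 1)) = s + 1" if "pth u" for u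
    using deg_end[OF that] end_out[OF that] Sset_half(1)[OF that] s k4 by auto
  show False
  proof (cases "3 \<le> s")
    case True
    obtain x where x: "out v x" "tri (v s) (v (s - 1)) x" using rotate_out[OF p s True] by blast
    let ?u = "v(1 := x)"
    obtain y where y: "out ?u y" "tri (?u s) (?u (s - 1)) y"
      using rotate_out[OF replace_pth(1)[OF p x(1)] s True] by blast
    \<comment> \<open>For \<open>s \<ge> 3\<close>, putting \<open>x\<close> first leaves positions
      \<open>s - 1\<close> and \<open>s\<close> unchanged, so their edge is still completed by
      \<open>x\<close>, which now lies on the path.\<close>
    have "y = x" by (rule tri_unique[OF _ x(2)]) (use y True in simp)
    moreover have "x = ?u 1" by simp
    ultimately show False using y(1) k4 unfolding out_def by (metis atLeastAtMost_iff image_eqI of_nat_1 of_nat_le_iff order_refl one_le_numeral order_trans)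
  next
    case False
    have s2: "s = 2" using False s k4 by linarith
    then have k5: "k = 5" using s by simp
    obtain x where x: "out v x" using end_out[OF p] by blast
    then have t: "tri (v 1) (v 2) x" "x \<in> V" by (simp_all add: out_def)
    have "pth (\<lambda>i. if 1 \<le> i \<and> i \<le> s then v (s + 1 - i) else v i)" by (rule rotate_pth(1)[OF p s])
    from deg[OF this] have "deg (v 2) = 3" using s2 by simp
    moreover have "deg (v 1) = 3" using deg[OF p] s2 by simp
    moreover have "deg x = 3" using deg[OF replace_pth(1)[OF p x]] s2 by simp
    \<comment> \<open>The strict bound for a triangle fails by equality:
      \<open>3 * 4 + 6 = 2 * 9\<close>.\<close>
    ultimately show False
      using deg_triangle_gt[of "v 1" "v 2" x] t tri_adjs[OF t(1)] pthD(1)[OF p, of 1] pthD(1)[OF p, of 2] k5 by simp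
  qed
qed

end

subsection \<open>Hypergraphs\<close>

lemma (in core) no_path_k:
  assumes xs: "walk xs" "distinct xs" "set xs \<subseteq> V" and l: "length xs = k"
  shows False
proof (rule no_pth)
  let ?v = "\<lambda>i. xs ! nat (i - 1)"
  have "inj_on ?v {1..int k}"
    unfolding inj_on_def using xs(2) l by (auto simp: nth_eq_iff_index_eq)
  moreover have "?v ` {1..int k} \<subseteq> V" using xs(3) l by (auto simp: subset_iff)
  moreover have "adj (?v i) (?v (i + 1))" if "1 \<le> i" "i < int k" for i
  proof -
    have e: "nat (i + 1 - 1) = Suc (nat (i - 1))" and "Suc (nat (i - 1)) < length xs" using that l by auto
    then show ?thesis using xs(1) unfolding walk_nth e by blast
  qed
  moreover have "\<not> tri (?v i) (?v (i + 1)) (?v (i + 2))" if "1 \<le> i" "i + 1 < int k" for i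
  proof -
    have e: "nat (i + 1 - 1) = Suc (nat (i - 1))" "nat (i + 2 - 1) = Suc (Suc (nat (i - 1)))"
      and "Suc (Suc (nat (i - 1))) < length xs" using that l by auto
    then show ?thesis using xs(1) unfolding walk_nth e by blast
  qed
  ultimately show "pth ?v" unfolding pth_def by blast
qed

text \<open>The first vertex \<open>a\<close> of a walk on three vertices has degree at most 2 and
  lies in a triple with \<open>b\<close> and some \<open>x\<close> (\<open>end3\<close>). Then
  \<open>x\<close> starts such a walk too, and two adjacent vertices of degree 2 violate the pair
  bound. Without these walks all neighbours lie in one triple, whose degree sum 6 is too
  small.\<close>

lemma (in mincex) no_mincex_3:
  assumes l: "l = 3" and K: "K = 3"
  shows False
proof -
  have le2: "deg a \<le> 2" if "nb V a \<subseteq> {b, x}" for a b x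
    using card_mono[OF _ that] card_insert_le_m1[of 2 "{x}" b] by simp
  have end3: "\<exists>x\<in>V. tri x a b \<and> x \<noteq> c \<and> nb V a \<subseteq> {b, x}"
    if w: "adj a b" "adj b c" "\<not> tri a b c" "a \<noteq> c" and V: "a \<in> V" "b \<in> V" "c \<in> V" for a b c
  proof -
    have ne: "a \<noteq> b" "b \<noteq> c" using w adj_irrefl by auto
    have t: "tri y a b \<and> y \<noteq> c" if y: "y \<in> V" "adj a y" "y \<noteq> b" for y
    proof -
      have yc: "y \<noteq> c"
      proof
        assume "y = c"
        then have ac: "adj a c" using y by simp
        have "\<not> tri b c a" "\<not> tri c a b" using w(3) triD(4)[of b c a] triD(3)[of c a b] by blast+
        then obtain cc where "cyc (int (length [a, b, c])) cc" "range cc = set [a, b, c]"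
          using cyc_of_list[of "[a, b, c]"] w ne ac adj_sym[OF ac] by auto
        moreover have "3 < card V" using card_V K by simp
        ultimately show False using no_cyc_l[of cc] l V by simp
      qed
      have "tri y a b"
      proof (rule ccontr)
        assume "\<not> tri y a b"
        then have "walk [y, a, b, c]" using w y adj_sym[of a y] by simp
        moreover have "distinct [y, a, b, c]" using ne w(4) y yc adj_irrefl[of a] by auto
        ultimately show False using path_bound[of "[y, a, b, c]"] l V y by simp
      qed
      then show ?thesis using yc by simp
    qed
    have "\<not> nb V a \<subseteq> {b}"
    proof
      assume "nb V a \<subseteq> {b}"
      then have "deg a \<le> 1" using card_mono[of "{b}" "nb V a"] by simp
      then show False using deg_gt[OF V(1)] K by simp
    qed
    then obtain x where x: "x \<in> V" "adj a x" "x \<noteq> b" by (auto simp: nb_def)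
    have tx: "tri x a b" "x \<noteq> c" using t[OF x] by auto
    have "y = b \<or> y = x" if "y \<in> V" "adj a y" for y
      using t[OF that] tri_unique1[OF _ tx(1)] by blast
    then show ?thesis using x(1) tx by (auto simp: nb_def)
  qed
  have no3: False if w: "adj a b" "adj b c" "\<not> tri a b c" "a \<noteq> c" and V: "a \<in> V" "b \<in> V" "c \<in> V" for a b c
  proof -
    obtain x where x: "x \<in> V" "tri x a b" "x \<noteq> c" "nb V a \<subseteq> {b, x}" using end3[OF w V] by blast
    have "\<not> tri x b c"
    proof
      assume "tri x b c"
      then have "c = a" by (rule tri_unique[OF _ triD(2)[OF x(2)]])
      then show False using w by simp
    qed
    then obtain x' where x': "nb V x \<subseteq> {b, x'}" using end3[OF tri_adjs(3)[OF x(2)] w(2) _ x(3) x(1) V(2,3)] by blast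
    show False using deg_pair_gt[OF V(1) x(1)] tri_adjs(2)[OF x(2)] tri_neq(1)[OF x(2)] le2[OF x(4)] le2[OF x'] K by simp
  qed
  have nbt: "nb V u \<subseteq> {v, w}" if t: "tri u v w" and V: "u \<in> V" "v \<in> V" for u v w
  proof
    fix z assume z: "z \<in> nb V u"
    show "z \<in> {v, w}"
    proof (rule ccontr)
      assume n: "z \<notin> {v, w}"
      have "\<not> tri z u v"
      proof
        assume "tri z u v"
        then have "z = w" by (rule tri_unique1[OF _ triD(4)[OF t]])
        then show False using n by simp
      qed
      then show False using no3[of z u v] z n tri_adjs(1)[OF t] V adj_sym by (auto simp: nb_def)
    qed
  qed
  have "V \<noteq> {}" using card_V by auto
  then obtain u where u: "u \<in> V" by blast
  have "2 \<le> deg u" using deg_gt[OF u] K by simp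
  then obtain v w where vw: "v \<in> nb V u" "w \<in> nb V u" "v \<noteq> w"
    by (metis card_le_Suc0_iff_eq finV nb_finite not_less_eq_eq numeral_2_eq_2)
  then have V: "v \<in> V" "w \<in> V" "adj u v" "adj u w" by (auto simp: nb_def)
  have t: "tri v u w" using no3[OF adj_sym[OF V(3)] V(4) _ vw(3) V(1) u V(2)] by blast
  have "deg u \<le> 2" "deg v \<le> 2" "deg w \<le> 2"
    using le2[OF nbt[OF triD(1)[OF t]]] le2[OF nbt[OF t]] le2[OF nbt[OF triD(4)[OF t]]] u V by auto
  then show False using deg_triangle_gt[OF u V(1,2) V(3,4) tri_adjs(3)[OF t]] K by simp
qed

lemma (in tgraph) E2_bound:
  assumes "4 \<le> k" "finite W"
    and "\<And>xs. walk xs \<Longrightarrow> distinct xs \<Longrightarrow> set xs \<subseteq> W \<Longrightarrow> length xs \<le> k"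
  shows "E2 W \<le> (k - 1) * card W"
  using assms
proof (induction k arbitrary: W rule: less_induct)
  case (less k)
  note IHk = less.IH and k4 = less.prems(1)
  show ?case
    using less.prems(2,3)
  proof (induction W rule: finite_psubset_induct)
    case (psubset W)
    have sub: "E2 U \<le> (k - 1) * card U" if "U \<subset> W" for U
      using psubset.IH[OF that] psubset.prems that by blast
    show ?case
    proof (rule ccontr)
      assume "\<not> ?case"
      then interpret core adj tri W k
        by unfold_locales (use psubset.hyps psubset.prems sub k4 in auto)
      have short: "length xs \<le> k - 1" if xs: "walk xs" "distinct xs" "set xs \<subseteq> W" for xs
      proof -
        have "length xs \<noteq> k" using no_path_k[OF xs] by blast
        then show ?thesis using path_bound[OF xs] by linarith
      qed
      show False
      proof (cases "k = 4")
        case True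
        interpret m: mincex adj tri W 3 3
          by unfold_locales (use psubset.hyps big sub short True in auto)
        show False by (rule m.no_mincex_3) simp_all
      next
        case False
        then have "E2 W \<le> (k - 1 - 1) * card W" using IHk[of "k - 1" W] k4 psubset.hyps short by simp
        also have "\<dots> \<le> (k - 1) * card W" by (intro mult_le_mono1) simp
        finally show False using big by simp
      qed
    qed
  qed
qed

section \<open>Translation to Berge paths and the 2-shadow\<close>

definition hadj :: "'a set set \<Rightarrow> 'a \<Rightarrow> 'a \<Rightarrow> bool" where
  "hadj E x y \<longleftrightarrow> x \<noteq> y \<and> (\<exists>h\<in>E. {x, y} \<subseteq> h)"

definition htri :: "'a set set \<Rightarrow> 'a \<Rightarrow> 'a \<Rightarrow> 'a \<Rightarrow> bool" where
  "htri E x y z \<longleftrightarrow> x \<noteq> y \<and> y \<noteq> z \<and> x \<noteq> z \<and> {x, y, z} \<in> E"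

lemma linear_tgraph:
  assumes "linear_hg E"
  shows "tgraph (hadj E) (htri E)"
proof
  fix x y z z'
  show "hadj E y x" if "hadj E x y" using that by (auto simp: hadj_def)
  show "\<not> hadj E x x" by (simp add: hadj_def)
  show "htri E x y z = htri E y x z" "htri E x y z = htri E x z y"
    by (auto simp: htri_def insert_commute)
  show "hadj E x y" if "htri E x y z" using that by (auto simp: hadj_def htri_def)
  show "z = z'" if t: "htri E x y z" "htri E x y z'"
  proof (rule ccontr)
    assume "z \<noteq> z'"
    then have "{x, y, z} \<noteq> {x, y, z'}" using t by (auto simp: htri_def)
    moreover have "{x, y, z} \<in> E" "{x, y, z'} \<in> E" using t by (simp_all add: htri_def)
    ultimately have "card ({x, y, z} \<inter> {x, y, z'}) \<le> 1"
      using assms[unfolded linear_hg_def, rule_format, of "{x, y, z}" "{x, y, z'}"] by simp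
    moreover have "card {x, y} \<le> card ({x, y, z} \<inter> {x, y, z'})" by (rule card_mono) auto
    ultimately show False using t by (auto simp: htri_def)
  qed
qed

text \<open>A hyperedge used twice would contain four vertices of the walk, or else three
  consecutive ones. The first exceeds size 3, and the second makes it a triple that a walk
  forbids.\<close>

lemma walk_berge_path:
  assumes u: "uniform_in {2, 3} E" and t: "tgraph (hadj E) (htri E)"
    and w: "tgraph.walk (hadj E) (htri E) vs" and d: "distinct vs" and V: "set vs \<subseteq> V" and l: "length vs = k + 1"
  shows "has_berge_path V E k"
proof -
  interpret tgraph "hadj E" "htri E" by (rule t)
  have a: "hadj E (vs ! i) (vs ! Suc i)" if "i < k" for i
    using w that l unfolding walk_nth by simp
  have nt: "\<not> htri E (vs ! i) (vs ! Suc i) (vs ! Suc (Suc i))" if "Suc i < k" for i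
    using w that l unfolding walk_nth by simp
  obtain h where h: "h i \<in> E" "{vs ! i, vs ! Suc i} \<subseteq> h i" if "i < k" for i
    using a unfolding hadj_def by metis
  have ne: "vs ! i \<noteq> vs ! j" if "i < j" "j \<le> k" for i j
    using d that l by (simp add: nth_eq_iff_index_eq)
  have c: "card (h i) \<le> 3" "finite (h i)" if "i < k" for i
  proof -
    have "card (h i) \<in> {2, 3}" using u h(1)[OF that] unfolding uniform_in_def by blast
    then show "card (h i) \<le> 3" "finite (h i)" by (auto intro: card_ge_0_finite)
  qed
  have hne: "h i \<noteq> h j" if ij: "i < j" "j < k" for i j
  proof
    assume e: "h i = h j"
    have hi: "vs ! i \<in> h i" "vs ! Suc i \<in> h i" "vs ! j \<in> h i" "vs ! Suc j \<in> h i"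
      using h(2)[of i] h(2)[of j] ij e by auto
    have ci: "card (h i) \<le> 3" "finite (h i)" using c[of i] ij by auto
    show False
    proof (cases "j = Suc i")
      case True
      have "card {vs ! i, vs ! Suc i, vs ! Suc j} = 3"
        using ne[of i "Suc i"] ne[of i "Suc j"] ne[of j "Suc j"] True ij by simp
      then have "{vs ! i, vs ! Suc i, vs ! Suc j} = h i"
        using ci hi True by (intro card_seteq) simp_all
      then show False using nt[of i] h(1)[of i] ne[of i "Suc i"] ne[of i "Suc j"] ne[of j "Suc j"] True ij
        by (simp add: htri_def)
    next
      case False
      have "card {vs ! i, vs ! Suc i, vs ! j, vs ! Suc j} = 4"
        using ne[of i "Suc i"] ne[of i j] ne[of i "Suc j"] ne[of "Suc i" j] ne[of "Suc i" "Suc j"] ne[of j "Suc j"] False ij by simp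
      moreover have "card {vs ! i, vs ! Suc i, vs ! j, vs ! Suc j} \<le> card (h i)"
        using ci hi by (intro card_mono) auto
      ultimately show False using ci by simp
    qed
  qed
  let ?hs = "map h [0..<k]"
  have "inj_on h {0..<k}"
    unfolding inj_on_def by (metis atLeastLessThan_iff hne linorder_neqE_nat)
  then have "distinct ?hs" by (simp add: distinct_map)
  moreover have "set ?hs \<subseteq> E" using h(1) by auto
  ultimately have "berge_path V E vs ?hs"
    using d V l h(2) unfolding berge_path_def by simp
  then show ?thesis unfolding has_berge_path_def by (intro exI[of _ vs] exI[of _ ?hs]) simp
qed

text \<open>Each shadow edge underlies exactly two ordered adjacent pairs.\<close>

lemma shadow2_E2:
  assumes H: "hypergraph V E" and t: "tgraph (hadj E) (htri E)"
  shows "2 * card (shadow2 E) = tgraph.E2 (hadj E) V"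
proof -
  interpret tgraph "hadj E" "htri E" by (rule t)
  have V: "u \<in> V" "v \<in> V" if "hadj E u v" for u v
    using H that unfolding hypergraph_def hadj_def by auto
  have fV: "finite V" using H by (simp add: hypergraph_def)
  define ends where "ends e = {(u, v). u \<noteq> v \<and> {u, v} = e}" for e :: "'a set"
  have S: "shadow2 E = {{u, v} | u v. hadj E u v}" by (simp add: shadow2_def hadj_def)
  have "shadow2 E \<subseteq> Pow V" using V unfolding S by blast
  then have fS: "finite (shadow2 E)" using fV finite_subset by blast
  have c2: "card (ends e) = 2 \<and> finite (ends e)" if e: "e \<in> shadow2 E" for e
  proof -
    obtain u v where uv: "u \<noteq> v" "e = {u, v}" using e by (auto simp: shadow2_def)
    then have "ends e = {(u, v), (v, u)}" by (auto simp: ends_def doubleton_eq_iff)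
    then show ?thesis using uv by simp
  qed
  have "E2 V = card (SIGMA u:V. nb V u)" using fV by (simp add: E2_def)
  also have "(SIGMA u:V. nb V u) = (\<Union>e\<in>shadow2 E. ends e)"
  proof (intro equalityI subsetI)
    fix p assume "p \<in> (SIGMA u:V. nb V u)"
    then obtain u v where p: "p = (u, v)" "hadj E u v" by (auto simp: nb_def)
    then have "p \<in> ends {u, v}" "{u, v} \<in> shadow2 E" unfolding S by (auto simp: ends_def hadj_def)
    then show "p \<in> (\<Union>e\<in>shadow2 E. ends e)" by blast
  next
    fix p assume "p \<in> (\<Union>e\<in>shadow2 E. ends e)"
    then obtain a b u v where p: "p = (u, v)" "{u, v} = {a, b}" "u \<noteq> v" "hadj E a b"
      unfolding S ends_def by blast
    then have "hadj E u v" by (auto simp: hadj_def)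
    then show "p \<in> (SIGMA u:V. nb V u)" using V p(1) by (auto simp: nb_def)
  qed
  also have "card (\<Union>e\<in>shadow2 E. ends e) = (\<Sum>e\<in>shadow2 E. card (ends e))"
    by (rule card_UN_disjoint[OF fS]) (use c2 in \<open>auto simp: ends_def\<close>)
  also have "\<dots> = 2 * card (shadow2 E)" using c2 by simp
  finally show ?thesis by simp
qed

theorem theorem3:
  fixes V :: "'a set" and E :: "'a set set" and k :: nat
  assumes "k \<ge> 4"
    and "hypergraph V E"
    and "uniform_in {2, 3} E"
    and "linear_hg E"
    and "\<not> has_berge_path V E k"
  shows "real (card (shadow2 E)) \<le> (real k - 1) / 2 * real (card V)"
proof -
  have t: "tgraph (hadj E) (htri E)" by (rule linear_tgraph[OF assms(4)])
  interpret tgraph "hadj E" "htri E" by (rule t)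
  have "finite V" using assms(2) by (simp add: hypergraph_def)
  moreover have "length xs \<le> k" if xs: "walk xs" "distinct xs" "set xs \<subseteq> V" for xs
  proof (rule ccontr)
    assume "\<not> length xs \<le> k"
    then have l: "k + 1 \<le> length xs" by simp
    \<comment> \<open>A Berge path of length \<open>k\<close> has \<open>k + 1\<close> vertices, so
      a longer walk is cut to that size.\<close>
    let ?ys = "take (k + 1) xs"
    have "walk ?ys"
    proof (cases "drop (k + 1) xs = []")
      case False
      moreover have "?ys \<noteq> []" using l by auto
      ultimately show ?thesis using xs(1) walk_append[of ?ys "drop (k + 1) xs"] by simp
    qed (use xs(1) in simp)
    then have "has_berge_path V E k"
    proof (rule walk_berge_path[OF assms(3) t])
      show "set ?ys \<subseteq> V" by (rule order_trans[OF set_take_subset xs(3)])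
    qed (use xs(2) l in simp_all)
    then show False using assms(5) by simp
  qed
  ultimately have "E2 V \<le> (k - 1) * card V" by (rule E2_bound[OF assms(1)])
  then have "2 * card (shadow2 E) \<le> (k - 1) * card V" using shadow2_E2[OF assms(2) t] by simp
  then have "real (2 * card (shadow2 E)) \<le> real ((k - 1) * card V)" by (rule of_nat_mono)
  then show ?thesis using assms(1) by (simp add: of_nat_diff)
qed

end
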